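(* Let $d\geq 1$, let $J:\mathbb{Z}^d\times \mathbb{Z}^d \to [0,\infty)$ be a symmetric, integrable, translation-invariant kernel, and suppose that there exist constants $0<\alpha<d$, $c>0$ and $C<\infty$ such that $c \|x-y\|^{-d-\alpha} \leq J(x,y) \leq C\|x-y\|^{-d-\alpha}$ for all distinct $x,y \in \mathbb{Z}^d$. If $\alpha<1$ then $\chi(\beta)\asymp \xi(\beta)^\alpha$ for every $0\leq \beta \leq \beta_c$ and $$\mathbb{P}_{\beta}(0\leftrightarrow x) \asymp \begin{cases} \|x\|^{-d+\alpha} & \text{ if }\|x\|\leq \xi(\beta) \\ \chi(\beta)^2 \|x\|^{-d-\alpha} & \text{ if }\|x\|> \xi(\beta) \end{cases} \ \asymp\ \|x\|^{-d+\alpha} \left(1 \vee \frac{\|x\|}{\xi(\beta)}\right)^{-2\alpha}$$ for every $\beta_c/2\leq \beta \leq \beta_c$ and $x\in \mathbb{Z}^d \setminus\{0\}$. All implicit constants depend only on $d$, $\alpha$, $c$ and $C$.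
   Context: Long-range percolation: given a symmetric kernel $J$ (i.e. $J(x,y)=J(y,x)$) and $\beta\geq 0$, $\mathbb{P}_\beta$ (with expectation $\mathbb{E}_\beta$) is the law of the random graph with vertex set $\mathbb{Z}^d$ in which each potential edge $\{x,y\}$ ($x\neq y$) is included (is "open") independently at random with probability $1-\exp(-\beta J(x,y))$. Translation-invariant means $J(x,y)=J(0,y-x)$ for all $x,y$; integrable means $\sum_{x\in\mathbb{Z}^d}J(0,x)<\infty$. $\|\cdot\|$ denotes the $\ell^\infty$ norm, and $a\vee b=\max\{a,b\}$. $\{x\leftrightarrow y\}$ is the event that $x$ and $y$ belong to the same connected component (cluster) of the random graph; $K$ is the cluster of the origin. The critical value is $\beta_c=\inf\{\beta\geq 0:\mathbb{P}_\beta(\text{an infinite cluster exists})>0\}$. The susceptibility is $\chi(\beta)=\mathbb{E}_\beta|K|=\sum_{x\in\mathbb{Z}^d}\mathbb{P}_\beta(0\leftrightarrow x)\in[1,\infty]$, and the correlation length is $$\xi(\beta)=\inf\Bigl\{r\geq 1:\sum_{x\in[-r,r]^d}\mathbb{P}_\beta(0\leftrightarrow x)\geq \tfrac12\chi(\beta)\Bigr\},$$ where sums over boxes run over their integer points and $\inf\emptyset=\infty$. In particular $\chi(\beta_c)=\xi(\beta_c)=\infty$, the relation $\chi\asymp\xi^\alpha$ at $\beta_c$ being understood as both sides being infinite, and $\|x\|/\xi(\beta_c)=0$. The relation $f\asymp g$ means that $f$ and $g$ are each bounded by a positive constant multiple of the other. *)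

theory Defs
  imports "HOL-Probability.Probability"
begin

definition linf_norm :: "int ^ 'n \<Rightarrow> real" where
  "linf_norm x = infnorm (\<chi> i. real_of_int (x $ i) :: real ^ 'n)"

definition edges :: "'v set set" where
  "edges = {{x, y} | x y. x \<noteq> y}"

text \<open>
  An edge is an unordered pair, while \<open>J\<close> takes ordered arguments; for symmetric \<open>J\<close> the
  description is unambiguous, see \<open>edge_prob_pair\<close> below.
\<close>

definition edge_prob :: "('v \<Rightarrow> 'v \<Rightarrow> real) \<Rightarrow> real \<Rightarrow> 'v set \<Rightarrow> real" where
  "edge_prob J \<beta> e = (THE p. \<exists>x y. e = {x, y} \<and> x \<noteq> y \<and> p = 1 - exp (- \<beta> * J x y))"

definition perc :: "('v \<Rightarrow> 'v \<Rightarrow> real) \<Rightarrow> real \<Rightarrow> ('v set \<Rightarrow> bool) measure" where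
  "perc J \<beta> = PiM edges (\<lambda>e. measure_pmf (bernoulli_pmf (edge_prob J \<beta> e)))"

definition open_adj :: "('v set \<Rightarrow> bool) \<Rightarrow> 'v rel" where
  "open_adj \<omega> = {(x, y). x \<noteq> y \<and> \<omega> {x, y}}"

definition cluster :: "('v set \<Rightarrow> bool) \<Rightarrow> 'v \<Rightarrow> 'v set" where
  "cluster \<omega> x = {y. (x, y) \<in> (open_adj \<omega>)\<^sup>*}"

definition two_point :: "('v \<Rightarrow> 'v \<Rightarrow> real) \<Rightarrow> real \<Rightarrow> 'v \<Rightarrow> 'v \<Rightarrow> real" where
  "two_point J \<beta> x y = measure (perc J \<beta>) {\<omega> \<in> space (perc J \<beta>). y \<in> cluster \<omega> x}"

definition beta_c :: "('v \<Rightarrow> 'v \<Rightarrow> real) \<Rightarrow> ereal" where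
  "beta_c J = Inf (ereal ` {\<beta>. 0 \<le> \<beta> \<and>
     measure (perc J \<beta>) {\<omega> \<in> space (perc J \<beta>). \<exists>x. infinite (cluster \<omega> x)} > 0})"

text \<open>
  \<open>emeasure (count_space UNIV)\<close> is the \<open>[0, \<infinity>]\<close>-valued cardinality, so that infinite clusters
  count as \<open>\<infinity>\<close> (whereas \<open>card\<close> would give 0).
\<close>

definition susceptibility :: "(int ^ 'n \<Rightarrow> int ^ 'n \<Rightarrow> real) \<Rightarrow> real \<Rightarrow> ennreal" where
  "susceptibility J \<beta> = (\<integral>\<^sup>+ \<omega>. emeasure (count_space UNIV) (cluster \<omega> 0) \<partial>perc J \<beta>)"

definition lattice_box :: "real \<Rightarrow> (int ^ 'n) set" where
  "lattice_box r = {x. \<forall>i. real_of_int (x $ i) \<in> {-r..r}}"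

definition correlation_length :: "(int ^ 'n \<Rightarrow> int ^ 'n \<Rightarrow> real) \<Rightarrow> real \<Rightarrow> ennreal" where
  "correlation_length J \<beta> = Inf (ennreal ` {r. 1 \<le> r \<and>
     ennreal (\<Sum>x\<in>lattice_box r. two_point J \<beta> 0 x) \<ge> susceptibility J \<beta> / 2})"

text \<open>
  Real powers on \<open>[0, \<infinity>]\<close>, with \<open>\<infinity>\<^sup>a = \<infinity>\<close> for \<open>a > 0\<close>. The junk value of \<open>powr\<close> at base 0 plays no
  role, as this is only applied to bases that are at least 1.
\<close>

definition ennpowr :: "ennreal \<Rightarrow> real \<Rightarrow> ennreal" where
  "ennpowr t a =
     (if t = \<infinity> then (if a < 0 then 0 else if a = 0 then 1 else \<infinity>)
      else ennreal (enn2real t powr a))"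

definition comparable :: "real \<Rightarrow> ennreal \<Rightarrow> ennreal \<Rightarrow> bool" where
  "comparable A f g \<longleftrightarrow> f \<le> ennreal A * g \<and> g \<le> ennreal A * f"

lemma linf_norm_eq_Max: "linf_norm x = Max (range (\<lambda>i. \<bar>real_of_int (x $ i)\<bar>))"
  by (simp add: linf_norm_def infnorm_cart full_SetCompr_eq cSup_eq_Max)

lemma finite_lattice_box: "finite (lattice_box r :: (int ^ 'n) set)"
proof -
  have "inj_on vec_nth (lattice_box r :: (int ^ 'n) set)"
    by (simp add: inj_on_def vec_eq_iff)
  moreover have "vec_nth ` (lattice_box r :: (int ^ 'n) set) \<subseteq> PiE UNIV (\<lambda>_. {\<lceil>-r\<rceil>..\<lfloor>r\<rfloor>})"
    by (auto simp: lattice_box_def le_floor_iff ceiling_le_iff)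
  ultimately show ?thesis
    by (metis finite_PiE finite_atLeastAtMost_int finite_class.finite_UNIV finite_imageD finite_subset)
qed

lemma edge_prob_pair:
  assumes "\<And>x y. J x y = J y x" "x \<noteq> y"
  shows "edge_prob J \<beta> {x, y} = 1 - exp (- \<beta> * J x y)"
  unfolding edge_prob_def using assms by (intro the_equality) (auto simp: doubleton_eq_iff)

lemma prob_space_perc: "prob_space (perc J \<beta>)"
  unfolding perc_def by (intro prob_space_PiM) (rule measure_pmf.prob_space_axioms)

lemma measurable_cluster:
  fixes J :: "'v::countable \<Rightarrow> 'v \<Rightarrow> real"
  shows "Measurable.pred (perc J \<beta>) (\<lambda>\<omega>. y \<in> cluster \<omega> x)"
proof -
  have step: "Measurable.pred (perc J \<beta>) (\<lambda>\<omega>. (u, v) \<in> open_adj \<omega>)" for u v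
  proof (cases "u = v")
    case False
    then have "{u, v} \<in> edges" by (auto simp: edges_def)
    then have "(\<lambda>\<omega>. \<omega> {u, v}) \<in> perc J \<beta> \<rightarrow>\<^sub>M measure_pmf (bernoulli_pmf (edge_prob J \<beta> {u, v}))"
      unfolding perc_def by (rule measurable_component_singleton)
    then have "Measurable.pred (perc J \<beta>) (\<lambda>\<omega>. \<omega> {u, v})" by simp
    with False show ?thesis by (simp add: open_adj_def)
  qed (simp add: open_adj_def)
  have "Measurable.pred (perc J \<beta>) (\<lambda>\<omega>. (x, y) \<in> open_adj \<omega> ^^ n)" for n
  proof (induction n arbitrary: y)
    case (Suc n)
    have "(\<lambda>\<omega>. (x, y) \<in> open_adj \<omega> ^^ Suc n)
        = (\<lambda>\<omega>. \<exists>z. (x, z) \<in> open_adj \<omega> ^^ n \<and> (z, y) \<in> open_adj \<omega>)"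
      by (auto simp: relcomp_unfold)
    then show ?case using Suc step by simp
  qed simp
  then show ?thesis by (simp add: cluster_def rtrancl_power)
qed

lemma measurable_infinite_cluster:
  fixes J :: "'v::countable \<Rightarrow> 'v \<Rightarrow> real"
  shows "Measurable.pred (perc J \<beta>) (\<lambda>\<omega>. \<exists>x. infinite (cluster \<omega> x))"
proof -
  have [measurable]: "Measurable.pred (perc J \<beta>) (\<lambda>\<omega>. y \<in> cluster \<omega> x)" for x y
    by (rule measurable_cluster)
  have "finite S \<longleftrightarrow> (\<exists>ys. \<forall>y. y \<in> S \<longrightarrow> y \<in> set ys)" for S :: "'v set"
    by (metis List.finite_set finite_list finite_subset subsetI)
  then show ?thesis by simp
qed

lemma susceptibility_eq_sum:
  "susceptibility J \<beta> = (\<integral>\<^sup>+ x. ennreal (two_point J \<beta> 0 x) \<partial>count_space UNIV)"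
proof -
  interpret prob_space "perc J \<beta>" by (rule prob_space_perc)
  have [measurable]: "Measurable.pred (perc J \<beta>) (\<lambda>\<omega>. y \<in> cluster \<omega> 0)" for y
    by (rule measurable_cluster)
  have "susceptibility J \<beta>
      = (\<integral>\<^sup>+ \<omega>. \<integral>\<^sup>+ x. indicator (cluster \<omega> 0) x \<partial>count_space UNIV \<partial>perc J \<beta>)"
    by (simp add: susceptibility_def)
  also have "\<dots> = (\<integral>\<^sup>+ x. \<integral>\<^sup>+ \<omega>. indicator (cluster \<omega> 0) x \<partial>perc J \<beta> \<partial>count_space UNIV)"
    by (rule nn_integral_count_space_nn_integral) (auto simp: indicator_def)
  also have "\<dots> = (\<integral>\<^sup>+ x. ennreal (two_point J \<beta> 0 x) \<partial>count_space UNIV)"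
  proof (rule nn_integral_cong)
    fix x
    have "(\<integral>\<^sup>+ \<omega>. indicator (cluster \<omega> 0) x \<partial>perc J \<beta>)
        = (\<integral>\<^sup>+ \<omega>. indicator {\<omega> \<in> space (perc J \<beta>). x \<in> cluster \<omega> 0} \<omega> \<partial>perc J \<beta>)"
      by (intro nn_integral_cong) (auto simp: indicator_def)
    also have "\<dots> = ennreal (two_point J \<beta> 0 x)"
      by (simp add: two_point_def emeasure_eq_measure)
    finally show "(\<integral>\<^sup>+ \<omega>. indicator (cluster \<omega> 0) x \<partial>perc J \<beta>) = ennreal (two_point J \<beta> 0 x)" .
  qed
  finally show ?thesis .
qed

end

theory Submission
  imports Defs "HOL-Real_Asymp.Real_Asymp"
begin

text \<open>
  Everything is reduced to percolation on finite vertex sets. Two facts drive the proof. First, splitting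
  a large cluster into two disjoint ones, the van den Berg--Kesten inequality shows that the cluster
  size in a box decays fast beyond the typical size \<open>T\<close> of the largest cluster. Second, if \<open>T\<close> were
  much larger than \<open>r powr ((d + \<alpha>) / 2)\<close> in a box of side \<open>r\<close>, then the largest clusters of neighbouring
  boxes would merge with high probability, and iterating over scales would produce an infinite
  cluster. Hence below \<open>\<beta>\<^sub>c\<close> the truncation at that size costs at most a factor 2 in expectations, and merging the
  clusters of two neighbouring boxes gives \<open>S(2 * r) \<ge> const * r powr (- d - \<alpha>) * S(r)\<^sup>2\<close> for the number
  \<open>S(r)\<close> of connected pairs in the box. As \<open>S\<close> grows polynomially, \<open>S(r)\<close> is at most of order \<open>r powr (d + \<alpha>)\<close>.

  The pointwise upper bound follows by decomposing a connection at the edge through which it leaves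
  a box around its starting point and averaging over the radius of the box. As \<open>\<alpha> < 1\<close>, an edge
  shorter than \<open>\<epsilon> * r\<close> contributes only a small multiple of the bound on smaller scales. The same
  averaging shows that a ball whose in-ball susceptibility is less than a small multiple of \<open>r powr \<alpha>\<close> carries
  most of the susceptibility, which yields \<open>\<chi> \<asymp> \<xi> powr \<alpha>\<close>, and that beyond the correlation length a
  connection costs one long edge. The lower bounds come from merging the truncated clusters of the two
  endpoints. Since all these are statements about finite volumes, they extend to \<open>\<beta>\<^sub>c\<close> by continuity.
\<close>

section \<open>Bernoulli configurations on a finite edge set\<close>

text \<open>The exponent (d + \<alpha>) / 2 is the size at which merging becomes likely: clusters of
  size \<open>m\<close> in neighbouring boxes of side \<open>r\<close> have \<open>m\<^sup>2\<close>
  potential edges between them, each open with probability of order r powr (- d - \<alpha>). Up to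
  that size the chance of merging is linear in the product of the sizes, so independence of the two
  boxes turns it into a product of expectations. This is why truncation matters, and why the
  recursion for \<open>S\<close> is quadratic: once \<open>S(r)\<close> exceeds its threshold by a
  constant factor, the ratio is squared at every doubling and soon contradicts the trivial bound r
  powr (2 * d). The two conditions on \<alpha> have separate origins. Clusters of positive density
  in boxes of side \<open>R\<close> have about R powr (d - \<alpha>) open edges between them, so
  \<alpha> < d makes failures of merging summable over scales. An edge of length \<open>k\<close>
  crosses up to \<open>k\<close> of the radii averaged over, and the sum of the lengths of the short
  edges at a vertex, weighted by the kernel, grows like R powr (1 - \<alpha>); \<alpha> < 1 makes
  the longest of them dominate, so that a cut-off at a small fraction of the scale leaves
  little.\<close>

definition bwt :: "('e \<Rightarrow> real) \<Rightarrow> 'e set \<Rightarrow> 'e set \<Rightarrow> real" where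
  "bwt p E w = (\<Prod>e\<in>w. p e) * (\<Prod>e\<in>E - w. 1 - p e)"

text \<open>A configuration is the set of its open edges, so an expectation is a finite sum,
  polynomial in the edge probabilities. No measurability arises and continuity in \<beta> is
  immediate; \<open>perc_cylinder\<close> links it to the product measure.\<close>

definition bex :: "('e \<Rightarrow> real) \<Rightarrow> 'e set \<Rightarrow> ('e set \<Rightarrow> real) \<Rightarrow> real" where
  "bex p E f = (\<Sum>w\<in>Pow E. bwt p E w * f w)"

definition pvalid :: "('e \<Rightarrow> real) \<Rightarrow> bool" where
  "pvalid p \<longleftrightarrow> (\<forall>e. 0 \<le> p e \<and> p e \<le> 1)"

lemma bwt_nonneg: "pvalid p \<Longrightarrow> 0 \<le> bwt p E w"
  by (auto simp: bwt_def pvalid_def intro!: mult_nonneg_nonneg prod_nonneg)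

lemma bex_cong:
  assumes "\<And>w. w \<subseteq> E \<Longrightarrow> f w = g w"
  shows "bex p E f = bex p E g"
  unfolding bex_def using assms by (intro sum.cong) auto

lemma bex_mono:
  assumes "pvalid p" "\<And>w. w \<subseteq> E \<Longrightarrow> f w \<le> g w"
  shows "bex p E f \<le> bex p E g"
  unfolding bex_def using assms by (intro sum_mono mult_left_mono bwt_nonneg) auto

lemma bex_nonneg:
  assumes "pvalid p" "\<And>w. w \<subseteq> E \<Longrightarrow> 0 \<le> f w"
  shows "0 \<le> bex p E f"
  unfolding bex_def using assms by (intro sum_nonneg mult_nonneg_nonneg bwt_nonneg) auto

lemma bex_add: "bex p E (\<lambda>w. f w + g w) = bex p E f + bex p E g"
  by (simp add: bex_def distrib_left sum.distrib)

lemma bex_diff: "bex p E (\<lambda>w. f w - g w) = bex p E f - bex p E g"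
  by (simp add: bex_def right_diff_distrib sum_subtractf)

lemma bex_cmult: "bex p E (\<lambda>w. c * f w) = c * bex p E f"
  by (simp add: bex_def sum_distrib_left mult.left_commute)

lemma bex_cmult_right: "bex p E (\<lambda>w. f w * c) = bex p E f * c"
  by (simp add: bex_def sum_distrib_right mult.assoc)

lemma bex_sum: "bex p E (\<lambda>w. \<Sum>i\<in>I. f i w) = (\<Sum>i\<in>I. bex p E (f i))"
proof -
  have "bex p E (\<lambda>w. \<Sum>i\<in>I. f i w) = (\<Sum>w\<in>Pow E. \<Sum>i\<in>I. bwt p E w * f i w)"
    by (simp add: bex_def sum_distrib_left)
  also have "\<dots> = (\<Sum>i\<in>I. \<Sum>w\<in>Pow E. bwt p E w * f i w)" by (rule sum.swap)
  finally show ?thesis by (simp add: bex_def)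
qed

lemma bex_empty: "bex p {} f = f {}"
  by (simp add: bex_def bwt_def)

lemma bex_insert:
  assumes "finite E" "e \<notin> E"
  shows "bex p (insert e E) f = (1 - p e) * bex p E f + p e * bex p E (\<lambda>w. f (insert e w))"
proof -
  have inj: "inj_on (insert e) (Pow E)" using assms by (auto simp: inj_on_def)
  have disj: "Pow E \<inter> insert e ` Pow E = {}" using assms by auto
  have w1: "bwt p (insert e E) w = (1 - p e) * bwt p E w" if "w \<subseteq> E" for w
  proof -
    have "insert e E - w = insert e (E - w)" using that assms by auto
    then show ?thesis using assms that by (simp add: bwt_def algebra_simps)
  qed
  have w2: "bwt p (insert e E) (insert e w) = p e * bwt p E w" if "w \<subseteq> E" for w
  proof -
    have "insert e E - insert e w = E - w" "e \<notin> w" "finite w"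
      using that assms by (auto intro: finite_subset)
    then show ?thesis using assms that by (simp add: bwt_def algebra_simps)
  qed
  have "bex p (insert e E) f = (\<Sum>w\<in>Pow E. bwt p (insert e E) w * f w)
      + (\<Sum>w\<in>insert e ` Pow E. bwt p (insert e E) w * f w)"
    unfolding bex_def Pow_insert using assms disj by (intro sum.union_disjoint) auto
  also have "(\<Sum>w\<in>insert e ` Pow E. bwt p (insert e E) w * f w)
      = (\<Sum>w\<in>Pow E. bwt p (insert e E) (insert e w) * f (insert e w))"
    using inj by (simp add: sum.reindex)
  finally show ?thesis
    by (simp add: w1 w2 bex_def sum_distrib_left mult.assoc)
qed

lemma bex_union:
  assumes "finite E1" "finite E2" "E1 \<inter> E2 = {}"
  shows "bex p (E1 \<union> E2) f = bex p E1 (\<lambda>w1. bex p E2 (\<lambda>w2. f (w1 \<union> w2)))"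
  using assms
proof (induction E1 arbitrary: f rule: finite_induct)
  case empty
  then show ?case by (simp add: bex_empty)
next
  case (insert e E1)
  then have "bex p (insert e (E1 \<union> E2)) f =
    (1 - p e) * bex p (E1 \<union> E2) f + p e * bex p (E1 \<union> E2) (\<lambda>w. f (insert e w))"
    by (intro bex_insert) auto
  with insert show ?case by (simp add: bex_insert)
qed

lemma bex_const: "finite E \<Longrightarrow> bex p E (\<lambda>_. c) = c"
  by (induction E rule: finite_induct) (simp_all add: bex_empty bex_insert algebra_simps)

lemma bex_restrict:
  assumes "finite E" "E' \<subseteq> E"
  shows "bex p E (\<lambda>w. f (w \<inter> E')) = bex p E' f"
proof -
  have "bex p (E' \<union> (E - E')) (\<lambda>w. f (w \<inter> E'))
      = bex p E' (\<lambda>w1. bex p (E - E') (\<lambda>w2. f ((w1 \<union> w2) \<inter> E')))"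
    using assms by (intro bex_union) (auto intro: finite_subset)
  also have "\<dots> = bex p E' (\<lambda>w1. bex p (E - E') (\<lambda>w2. f w1))"
    by (intro bex_cong) (auto intro!: arg_cong[where f = f])
  also have "\<dots> = bex p E' f" using assms by (simp add: bex_const)
  moreover have "E' \<union> (E - E') = E" using assms by auto
  ultimately show ?thesis by simp
qed

text \<open>Fubini for two disjoint edge sets. \<open>f\<close> need not be a product: in
  \<open>bex_cross\<close> one part of the configuration decides which edges of the other part
  matter.\<close>

lemma bex_indep2:
  assumes "finite E" "E1 \<subseteq> E" "E2 \<subseteq> E" "E1 \<inter> E2 = {}"
  shows "bex p E (\<lambda>w. f (w \<inter> E1) (w \<inter> E2)) = bex p E1 (\<lambda>w1. bex p E2 (\<lambda>w2. f w1 w2))"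
proof -
  have fin: "finite E1" "finite E2" using assms by (auto intro: finite_subset)
  have "bex p E (\<lambda>w. f (w \<inter> E1) (w \<inter> E2))
      = bex p E (\<lambda>w. (\<lambda>v. f (v \<inter> E1) (v \<inter> E2)) (w \<inter> (E1 \<union> E2)))"
    by (intro bex_cong) (auto intro!: arg_cong2[where f = f])
  also have "\<dots> = bex p (E1 \<union> E2) (\<lambda>v. f (v \<inter> E1) (v \<inter> E2))"
    using assms by (intro bex_restrict) auto
  also have "\<dots> = bex p E1 (\<lambda>w1. bex p E2 (\<lambda>w2. f ((w1 \<union> w2) \<inter> E1) ((w1 \<union> w2) \<inter> E2)))"
    using fin assms by (intro bex_union) auto
  also have "\<dots> = bex p E1 (\<lambda>w1. bex p E2 (\<lambda>w2. f w1 w2))"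
    using assms by (intro bex_cong arg_cong2[where f = f]) auto
  finally show ?thesis .
qed

lemma bex_none_open:
  assumes "finite E"
  shows "bex p E (\<lambda>w. of_bool (w \<inter> E = {})) = (\<Prod>e\<in>E. 1 - p e)"
proof -
  have "bex p E (\<lambda>w. of_bool (w \<inter> E = {})) = (\<Sum>w\<in>Pow E. if w = {} then bwt p E w else 0)"
    unfolding bex_def by (intro sum.cong) auto
  also have "\<dots> = bwt p E {}" using assms by simp
  finally show ?thesis by (simp add: bwt_def)
qed

lemma continuous_on_bex:
  assumes "\<And>e. continuous_on S (\<lambda>t. p t e)"
  shows "continuous_on S (\<lambda>t. bex (p t) E f)"
  unfolding bex_def bwt_def by (intro continuous_intros assms)

subsection \<open>The van den Berg--Kesten inequality for increasing events\<close>

text \<open>Disjoint occurrence. For increasing events the second witness may be enlarged to all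
  open edges outside the first, so a single set \<open>H\<close> suffices.\<close>

definition disjointly :: "('e set \<Rightarrow> bool) \<Rightarrow> ('e set \<Rightarrow> bool) \<Rightarrow> 'e set \<Rightarrow> bool" where
  "disjointly A B w \<longleftrightarrow> (\<exists>H\<subseteq>w. A H \<and> B (w - H))"

text \<open>Induction on the edges: once the state of one edge is revealed, the hypothesis applies
  to the events with and without that edge granted, in all four combinations, and what remains is an
  inequality between real numbers.\<close>

theorem bk_inequality:
  assumes "finite E" "pvalid p"
    and "\<And>w w'. A w \<Longrightarrow> w \<subseteq> w' \<Longrightarrow> A w'" "\<And>w w'. B w \<Longrightarrow> w \<subseteq> w' \<Longrightarrow> B w'"
  shows "bex p E (\<lambda>w. of_bool (disjointly A B w)) \<le> bex p E (\<lambda>w. of_bool (A w)) * bex p E (\<lambda>w. of_bool (B w))"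
  using assms(1,3,4)
proof (induction E arbitrary: A B rule: finite_induct)
  case empty
  then show ?case by (auto simp: bex_empty disjointly_def)
next
  case (insert e E)
  define A1 where "A1 = (\<lambda>w. A (insert e w))"
  define B1 where "B1 = (\<lambda>w. B (insert e w))"
  note up = insert.prems
  have upA1: "A1 w'" if "A1 w" "w \<subseteq> w'" for w w'
    using up(1)[of "insert e w" "insert e w'"] that by (auto simp: A1_def)
  have upB1: "B1 w'" if "B1 w" "w \<subseteq> w'" for w w'
    using up(2)[of "insert e w" "insert e w'"] that by (auto simp: B1_def)
  have AA1: "A w \<Longrightarrow> A1 w" and BB1: "B w \<Longrightarrow> B1 w" for w
    using up(1)[of w "insert e w"] up(2)[of w "insert e w"] by (auto simp: A1_def B1_def)
  define P where "P = (\<lambda>F. bex p E (\<lambda>w. of_bool (F w)))"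
  define x where "x = P (disjointly A B)"
  define y where "y = bex p E (\<lambda>w. of_bool (disjointly A B (insert e w)))"
  \<comment> \<open>Only one of the two disjoint witnesses can use \<open>e\<close>, so the edge is
    granted to \<open>A\<close> or to \<open>B\<close> but never to both.\<close>
  have split: "disjointly A B (insert e w) \<longleftrightarrow> disjointly A1 B w \<or> disjointly A B1 w" if "w \<subseteq> E" for w
  proof
    assume "disjointly A B (insert e w)"
    then obtain H where H: "H \<subseteq> insert e w" "A H" "B (insert e w - H)" by (auto simp: disjointly_def)
    show "disjointly A1 B w \<or> disjointly A B1 w"
    proof (cases "e \<in> H")
      case True
      then have "A1 (H - {e})" "B (w - (H - {e}))" "H - {e} \<subseteq> w"
        using H that insert(2) by (auto simp: A1_def insert_absorb intro: up(2))
      then show ?thesis by (auto simp: disjointly_def)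
    next
      case False
      then have "insert e w - H = insert e (w - H)" "H \<subseteq> w" using H by auto
      then show ?thesis using H by (auto simp: disjointly_def B1_def)
    qed
  next
    assume "disjointly A1 B w \<or> disjointly A B1 w"
    then show "disjointly A B (insert e w)"
    proof
      assume "disjointly A1 B w"
      then obtain H where H: "H \<subseteq> w" "A (insert e H)" "B (w - H)" by (auto simp: disjointly_def A1_def)
      moreover have "insert e w - insert e H = w - H" using that insert(2) by auto
      ultimately show ?thesis unfolding disjointly_def by (intro exI[of _ "insert e H"]) auto
    next
      assume "disjointly A B1 w"
      then obtain H where H: "H \<subseteq> w" "A H" "B (insert e (w - H))" by (auto simp: disjointly_def B1_def)
      moreover have "insert e w - H = insert e (w - H)" using that insert(2) H by auto
      ultimately show ?thesis unfolding disjointly_def B1_def by (intro exI[of _ H]) auto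
    qed
  qed
  have le1: "P (disjointly A1 B1) \<le> P A1 * P B1" unfolding P_def
    using insert.IH[of A1 B1] upA1 upB1 by blast
  have le2: "P (disjointly A1 B) \<le> P A1 * P B" unfolding P_def
    using insert.IH[of A1 B] upA1 up by blast
  have le3: "P (disjointly A B1) \<le> P A * P B1" unfolding P_def
    using insert.IH[of A B1] upB1 up by blast
  have y1: "y \<le> P A1 * P B1"
  proof -
    have "y \<le> P (disjointly A1 B1)" unfolding y_def P_def
    proof (intro bex_mono assms(2))
      fix w assume "w \<subseteq> E"
      have "disjointly A1 B1 w" if "disjointly A B (insert e w)"
        using that split[OF \<open>w \<subseteq> E\<close>] AA1 BB1 unfolding disjointly_def by blast
      then show "of_bool (disjointly A B (insert e w)) \<le> (of_bool (disjointly A1 B1 w) :: real)" by auto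
    qed
    then show ?thesis using le1 by simp
  qed
  \<comment> \<open>Inclusion-exclusion: \<open>y\<close> is the probability of the union of two
    events, and \<open>disjointly A B\<close>, of probability \<open>x\<close>, implies
    both.\<close>
  have y2: "y + x \<le> P A1 * P B + P A * P B1"
  proof -
    have "y + x \<le> P (disjointly A1 B) + P (disjointly A B1)"
      unfolding y_def x_def P_def bex_add[symmetric]
    proof (intro bex_mono assms(2))
      fix w assume "w \<subseteq> E"
      have "disjointly A1 B w \<and> disjointly A B1 w" if "disjointly A B w"
        using that AA1 BB1 unfolding disjointly_def by blast
      then show "of_bool (disjointly A B (insert e w)) + of_bool (disjointly A B w)
          \<le> (of_bool (disjointly A1 B w) + of_bool (disjointly A B1 w) :: real)"
        using split[OF \<open>w \<subseteq> E\<close>] by auto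
    qed
    then show ?thesis using le2 le3 by simp
  qed
  have mA: "P A \<le> P A1" and mB: "P B \<le> P B1"
    unfolding P_def using AA1 BB1 by (auto intro!: bex_mono assms(2))
  have x0: "x \<le> P A * P B" unfolding x_def P_def using insert.IH[of A B] up by blast
  have pe: "0 \<le> p e" "p e \<le> 1" using assms(2) by (auto simp: pvalid_def)
  \<comment> \<open>The left side is a combination of \<open>y + x\<close> with \<open>x\<close> or
    with \<open>y\<close>; which of the two has nonnegative coefficients depends on the side of 1 /
    2 on which \<open>p e\<close> lies. The discarded term is a square times the product of the
    gains of \<open>A\<close> and \<open>B\<close> from opening \<open>e\<close>.\<close>
  have key: "(1 - p e) * x + p e * y
      \<le> ((1 - p e) * P A + p e * P A1) * ((1 - p e) * P B + p e * P B1)"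
  proof (cases "p e \<le> 1 / 2")
    case True
    have "(1 - p e) * x + p e * y = (1 - 2 * p e) * x + p e * (y + x)" by (simp add: algebra_simps)
    also have "\<dots> \<le> (1 - 2 * p e) * (P A * P B) + p e * (P A1 * P B + P A * P B1)"
      using True pe by (intro add_mono[OF mult_left_mono[OF x0] mult_left_mono[OF y2]]) auto
    also have "\<dots> = ((1 - p e) * P A + p e * P A1) * ((1 - p e) * P B + p e * P B1)
        - (p e)\<^sup>2 * ((P A1 - P A) * (P B1 - P B))"
      by (simp add: algebra_simps power2_eq_square)
    also have "\<dots> \<le> ((1 - p e) * P A + p e * P A1) * ((1 - p e) * P B + p e * P B1)"
      using mA mB by simp
    finally show ?thesis .
  next
    case False
    have "(1 - p e) * x + p e * y = (1 - p e) * (y + x) + (2 * p e - 1) * y"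
      by (simp add: algebra_simps)
    also have "\<dots> \<le> (1 - p e) * (P A1 * P B + P A * P B1) + (2 * p e - 1) * (P A1 * P B1)"
      using False pe by (intro add_mono[OF mult_left_mono[OF y2] mult_left_mono[OF y1]]) auto
    also have "\<dots> = ((1 - p e) * P A + p e * P A1) * ((1 - p e) * P B + p e * P B1)
        - (1 - p e)\<^sup>2 * ((P A1 - P A) * (P B1 - P B))"
      by (simp add: algebra_simps power2_eq_square)
    also have "\<dots> \<le> ((1 - p e) * P A + p e * P A1) * ((1 - p e) * P B + p e * P B1)"
      using mA mB by simp
    finally show ?thesis .
  qed
  show ?case using key insert(1,2)
    by (simp add: bex_insert x_def y_def P_def A1_def B1_def)
qed

lemma bex_indep:
  assumes "finite E" "E1 \<subseteq> E" "E2 \<subseteq> E" "E1 \<inter> E2 = {}"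
  shows "bex p E (\<lambda>w. f (w \<inter> E1) * g (w \<inter> E2)) = bex p E1 f * bex p E2 g"
  using bex_indep2[OF assms, of p "\<lambda>a b. f a * g b"] by (simp add: bex_cmult bex_cmult_right)

section \<open>Percolation on a finite vertex set\<close>

definition ed :: "'v set \<Rightarrow> 'v set set" where
  "ed V = {{x, y} | x y. x \<in> V \<and> y \<in> V \<and> x \<noteq> y}"

definition cl :: "'v set set \<Rightarrow> 'v \<Rightarrow> 'v set" where
  "cl w x = {y. (x, y) \<in> {(a, b). {a, b} \<in> w}\<^sup>*}"

definition tau :: "('v set \<Rightarrow> real) \<Rightarrow> 'v set \<Rightarrow> 'v \<Rightarrow> 'v \<Rightarrow> real" where
  "tau p V x y = bex p (ed V) (\<lambda>w. of_bool (y \<in> cl w x))"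

lemma finite_ed: "finite V \<Longrightarrow> finite (ed V)"
  by (rule finite_subset[of _ "Pow V"]) (auto simp: ed_def)

lemma ed_mono: "S \<subseteq> V \<Longrightarrow> ed S \<subseteq> ed V"
  by (auto simp: ed_def)

lemma mem_edD: "{a, b} \<in> ed V \<Longrightarrow> a \<in> V \<and> b \<in> V \<and> a \<noteq> b"
  by (auto simp: ed_def doubleton_eq_iff)

lemma mem_edI: "a \<in> V \<Longrightarrow> b \<in> V \<Longrightarrow> a \<noteq> b \<Longrightarrow> {a, b} \<in> ed V"
  by (auto simp: ed_def)

lemma cl_self [simp]: "x \<in> cl w x"
  by (simp add: cl_def)

lemma cl_step: "y \<in> cl w x \<Longrightarrow> {y, z} \<in> w \<Longrightarrow> z \<in> cl w x"
  by (auto simp: cl_def intro: rtrancl_into_rtrancl)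

lemma cl_induct [consumes 1, case_names base step]:
  assumes "y \<in> cl w x" "P x"
    "\<And>y z. y \<in> cl w x \<Longrightarrow> P y \<Longrightarrow> {y, z} \<in> w \<Longrightarrow> P z"
  shows "P y"
proof -
  have "(x, y) \<in> {(a, b). {a, b} \<in> w}\<^sup>*" using assms(1) by (simp add: cl_def)
  then show ?thesis
    by (induction rule: rtrancl_induct) (use assms(2,3) in \<open>auto simp: cl_def\<close>)
qed

lemma cl_mono: "w \<subseteq> w' \<Longrightarrow> cl w x \<subseteq> cl w' x"
proof
  fix y assume "w \<subseteq> w'" "y \<in> cl w x"
  show "y \<in> cl w' x" using \<open>y \<in> cl w x\<close>
    by (induction rule: cl_induct) (use \<open>w \<subseteq> w'\<close> in \<open>auto intro: cl_step\<close>)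
qed

lemma cl_trans: "y \<in> cl w x \<Longrightarrow> z \<in> cl w y \<Longrightarrow> z \<in> cl w x"
  by (auto simp: cl_def)

lemma cl_sym: "y \<in> cl w x \<longleftrightarrow> x \<in> cl w y"
proof -
  have "sym ({(a, b). {a, b} \<in> w}\<^sup>*)"
    by (intro sym_rtrancl) (auto simp: sym_def insert_commute)
  then show ?thesis by (auto simp: cl_def sym_def)
qed

lemma cl_eq: "y \<in> cl w x \<Longrightarrow> cl w y = cl w x"
  by (meson cl_sym cl_trans subsetI subset_antisym)

lemma cl_subset:
  assumes "w \<subseteq> ed V"
  shows "cl w x \<subseteq> insert x V"
proof
  fix y assume "y \<in> cl w x"
  then show "y \<in> insert x V"
  proof (induction rule: cl_induct)
    case (step y z)
    then have "{y, z} \<in> ed V" using assms by auto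
    then show ?case using mem_edD by fast
  qed simp
qed

lemma cl_subset': "w \<subseteq> ed V \<Longrightarrow> x \<in> V \<Longrightarrow> cl w x \<subseteq> V"
  using cl_subset[of w V x] by auto

lemma finite_cl: "finite V \<Longrightarrow> w \<subseteq> ed V \<Longrightarrow> finite (cl w x)"
  using cl_subset[of w V x] by (auto intro: finite_subset)

lemma cl_closedI:
  assumes "x \<in> C" "\<And>y z. y \<in> C \<Longrightarrow> {y, z} \<in> w \<Longrightarrow> z \<in> C"
  shows "cl w x \<subseteq> C"
proof
  fix y assume "y \<in> cl w x"
  then show "y \<in> C" by (induction rule: cl_induct) (use assms in auto)
qed

text \<open>Whether the cluster is \<open>C\<close> is decided by the edges meeting
  \<open>C\<close>: those inside build it, and those leaving it must be closed. All edges disjoint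
  from \<open>C\<close> stay independent of this event.\<close>

lemma cl_eq_touch:
  assumes "C \<noteq> {}"
  shows "cl w x = C \<longleftrightarrow> cl (w \<inter> {e. e \<inter> C \<noteq> {}}) x = C" (is "_ \<longleftrightarrow> cl ?w x = C")
proof
  assume C: "cl w x = C"
  have "cl w x \<subseteq> cl ?w x"
  proof
    fix y assume "y \<in> cl w x"
    then show "y \<in> cl ?w x"
    proof (induction rule: cl_induct)
      case (step y z)
      then have "{y, z} \<in> ?w" using C by auto
      then show ?case using step cl_step by metis
    qed simp
  qed
  then show "cl ?w x = C" using C cl_mono[of ?w w x] by auto
next
  assume C: "cl ?w x = C"
  have "cl w x \<subseteq> C"
  proof (rule cl_closedI)
    show "x \<in> C" using C cl_self[of x ?w] by simp
    show "z \<in> C" if "y \<in> C" "{y, z} \<in> w" for y z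
      using that C cl_step[of y ?w x z] by auto
  qed
  then show "cl w x = C" using C cl_mono[of ?w w x] by auto
qed

lemma tau_nonneg: "pvalid p \<Longrightarrow> 0 \<le> tau p V x y"
  unfolding tau_def by (intro bex_nonneg) auto

lemma tau_le_1:
  assumes "pvalid p" "finite V"
  shows "tau p V x y \<le> 1"
proof -
  have "tau p V x y \<le> bex p (ed V) (\<lambda>_. 1)"
    unfolding tau_def by (intro bex_mono assms) auto
  then show ?thesis using assms by (simp add: bex_const finite_ed)
qed

lemma tau_sym: "tau p V x y = tau p V y x"
  unfolding tau_def by (intro bex_cong) (simp add: cl_sym)

lemma tau_self: "finite V \<Longrightarrow> tau p V x x = 1"
  by (simp add: tau_def bex_const finite_ed)

lemma tau_outside: "finite V \<Longrightarrow> y \<notin> V \<Longrightarrow> x \<in> V \<Longrightarrow> tau p V x y = 0"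
proof -
  assume V: "finite V" "y \<notin> V" "x \<in> V"
  have "tau p V x y = bex p (ed V) (\<lambda>_. 0)"
    unfolding tau_def
  proof (rule bex_cong)
    fix w assume "w \<subseteq> ed V"
    then show "of_bool (y \<in> cl w x) = (0 :: real)" using V cl_subset[of w V x] by auto
  qed
  then show ?thesis using V by (simp add: bex_const finite_ed)
qed

lemma tau_restrict:
  assumes "finite V" "S \<subseteq> V"
  shows "tau p S x y = bex p (ed V) (\<lambda>w. of_bool (y \<in> cl (w \<inter> ed S) x))"
  unfolding tau_def
  using bex_restrict[of "ed V" "ed S" p "\<lambda>w. of_bool (y \<in> cl w x)"] assms
  by (simp add: finite_ed ed_mono)

lemma tau_mono:
  assumes "pvalid p" "finite V" "S \<subseteq> V"
  shows "tau p S x y \<le> tau p V x y"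
proof -
  have "cl (w \<inter> ed S) x \<subseteq> cl w x" for w :: "'a set set" by (rule cl_mono) auto
  then show ?thesis unfolding tau_restrict[OF assms(2,3)] unfolding tau_def
    by (intro bex_mono assms) auto
qed

lemma sum_tau:
  assumes "finite V" "x \<in> V"
  shows "(\<Sum>y\<in>V. tau p V x y) = bex p (ed V) (\<lambda>w. real (card (cl w x)))"
proof -
  have "real (card (cl w x)) = (\<Sum>y\<in>V. of_bool (y \<in> cl w x))" if "w \<subseteq> ed V" for w
  proof -
    have "(\<Sum>y\<in>V. of_bool (y \<in> cl w x) :: real) = real (card {y \<in> V. y \<in> cl w x})"
      using assms by (simp add: of_bool_def sum.If_cases Int_def)
    moreover have "{y \<in> V. y \<in> cl w x} = cl w x" using cl_subset'[OF that assms(2)] by auto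
    ultimately show ?thesis by simp
  qed
  then show ?thesis by (simp add: tau_def bex_sum[symmetric] cong: bex_cong)
qed

text \<open>Explore the cluster \<open>C\<close> of \<open>x\<close> inside \<open>S\<close>. The edges leaving \<open>C\<close> towards \<open>V - S\<close> and the
  edges inside \<open>V - C\<close> have not been inspected, so only independence is needed, no correlation
  inequality.\<close>

lemma tau_exit:
  assumes p: "pvalid p" and V: "finite V" and S: "S \<subseteq> V" and x: "x \<in> S"
  shows "tau p V x y \<le> tau p S x y + (\<Sum>a\<in>S. \<Sum>b\<in>V - S. tau p S x a * p {a, b} * tau p V b y)"
proof -
  have fin: "finite (ed V)" "finite (ed S)" "finite S"
    using V S by (auto intro: finite_ed finite_subset)
  define T where "T = (\<lambda>C a b w. of_bool (cl (w \<inter> ed S) x = C) *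
    (of_bool ({a, b} \<in> w) * of_bool (y \<in> cl (w \<inter> ed (V - C)) b)) :: real)"
  have pt: "of_bool (y \<in> cl w x) \<le> of_bool (y \<in> cl (w \<inter> ed S) x)
      + (\<Sum>C\<in>Pow S. \<Sum>a\<in>C. \<Sum>b\<in>V - S. T C a b w)" if w: "w \<subseteq> ed V" for w
  proof -
    let ?C = "cl (w \<inter> ed S) x"
    have C: "?C \<subseteq> S" using cl_subset'[of "w \<inter> ed S" S x] x by auto
    have T0: "0 \<le> T C a b w" for C a b by (auto simp: T_def)
    have NN: "0 \<le> (\<Sum>C\<in>Pow S. \<Sum>a\<in>C. \<Sum>b\<in>V - S. T C a b w)" using T0 by (intro sum_nonneg)
    have "\<exists>a\<in>?C. \<exists>b\<in>V - S. {a, b} \<in> w \<and> y \<in> cl (w \<inter> ed (V - ?C)) b"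
      if y: "y \<in> cl w x" "y \<notin> ?C"
    proof -
      \<comment> \<open>Along a path, every step out of \<open>?C\<close> leads outside
        \<open>S\<close>, since an open edge from \<open>?C\<close> to a vertex of \<open>S\<close>
        would keep that vertex in \<open>?C\<close>. The pair \<open>a\<close>, \<open>b\<close> is
        renewed at each such step and is finally the last exit, after which the path avoids
        \<open>?C\<close>.\<close>
      have "y \<in> ?C \<or> (\<exists>a\<in>?C. \<exists>b\<in>V - S. {a, b} \<in> w \<and> y \<in> cl (w \<inter> ed (V - ?C)) b)"
        using y(1)
      proof (induction rule: cl_induct)
        case (step y z)
        have "{y, z} \<in> ed V" using w step by auto
        then have yz: "y \<in> V" "z \<in> V" "y \<noteq> z" by (auto dest: mem_edD)
        show ?case
        proof (cases "z \<in> ?C")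
          case zC: False
          show ?thesis
          proof (cases "y \<in> ?C")
            case True
            have "z \<notin> S"
            proof
              assume "z \<in> S"
              then have "{y, z} \<in> w \<inter> ed S" using True C yz step by (auto intro: mem_edI)
              then show False using cl_step[OF True] zC by blast
            qed
            then have "z \<in> V - S" using yz by simp
            then show ?thesis using True step by (metis cl_self)
          next
            case False
            then obtain a b where ab: "a \<in> ?C" "b \<in> V - S" "{a, b} \<in> w"
              "y \<in> cl (w \<inter> ed (V - ?C)) b" using step by blast
            have "{y, z} \<in> w \<inter> ed (V - ?C)" using False zC yz step by (auto intro: mem_edI)
            then show ?thesis using ab cl_step[OF ab(4)] by blast
          qed
        qed simp
      qed simp
      then show ?thesis using y by blast
    qed
    then consider "y \<notin> cl w x" | "y \<in> ?C" |
      a b where "y \<notin> ?C" "a \<in> ?C" "b \<in> V - S" "{a, b} \<in> w" "y \<in> cl (w \<inter> ed (V - ?C)) b"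
      by blast
    then show ?thesis
    proof cases
      case 1
      then show ?thesis using NN by simp
    next
      case 2
      then show ?thesis using NN by simp
    next
      case 3
      have "(1::real) = T ?C a b w" using 3 by (simp add: T_def)
      also have "\<dots> \<le> (\<Sum>b\<in>V - S. T ?C a b w)"
        using V 3 T0 by (intro member_le_sum) auto
      also have "\<dots> \<le> (\<Sum>a\<in>?C. \<Sum>b\<in>V - S. T ?C a b w)"
        using fin C 3 T0 by (intro member_le_sum[of a]) (auto intro: sum_nonneg finite_subset)
      also have "\<dots> \<le> (\<Sum>C\<in>Pow S. \<Sum>a\<in>C. \<Sum>b\<in>V - S. T C a b w)"
        using fin C T0 by (intro member_le_sum[of ?C]) (auto intro!: sum_nonneg)
      finally show ?thesis by auto
    qed
  qed
  have ET: "bex p (ed V) (T C a b)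
      \<le> bex p (ed S) (\<lambda>w. of_bool (cl w x = C)) * (p {a, b} * tau p V b y)"
    if C: "C \<subseteq> S" "a \<in> C" "b \<in> V - S" for C a b
  proof -
    \<comment> \<open>\<open>?E1\<close> decides that the cluster is \<open>C\<close> and
      \<open>?E3\<close> carries the rest of the path. They are disjoint, because every edge of
      \<open>?E1\<close> meets \<open>C\<close>, and neither contains \<open>{a, b}\<close>.\<close>
    let ?E1 = "ed S \<inter> {e. e \<inter> C \<noteq> {}}" and ?E3 = "ed (V - C)"
    let ?E2 = "insert {a, b} ?E3"
    have ne: "C \<noteq> {}" using C by auto
    have nin: "{a, b} \<notin> ?E3" using C by (auto dest: mem_edD)
    have abV: "{a, b} \<in> ed V" using C S by (intro mem_edI) auto
    have abS: "{a, b} \<notin> ed S" using C by (auto dest: mem_edD)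
    have disj: "?E1 \<inter> ?E2 = {}"
    proof -
      have "e \<inter> C = {}" if "e \<in> ?E3" for e using that by (auto simp: ed_def)
      then show ?thesis using abS by auto
    qed
    have "bex p (ed V) (T C a b) = bex p (ed V) (\<lambda>w. of_bool (cl (w \<inter> ?E1) x = C) *
       (of_bool ({a, b} \<in> w \<inter> ?E2) * of_bool (y \<in> cl ((w \<inter> ?E2) \<inter> ?E3) b)))"
    proof (rule bex_cong)
      fix w
      have "(cl (w \<inter> ed S) x = C) = (cl (w \<inter> ?E1) x = C)"
        using cl_eq_touch[OF ne, of "w \<inter> ed S" x] by (simp add: Int_assoc)
      moreover have "w \<inter> ?E2 \<inter> ?E3 = w \<inter> ?E3" by auto
      ultimately show "T C a b w = of_bool (cl (w \<inter> ?E1) x = C) *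
       (of_bool ({a, b} \<in> w \<inter> ?E2) * of_bool (y \<in> cl ((w \<inter> ?E2) \<inter> ?E3) b))"
        unfolding T_def by simp
    qed
    also have "\<dots> = bex p ?E1 (\<lambda>w. of_bool (cl w x = C)) *
        bex p ?E2 (\<lambda>w. of_bool ({a, b} \<in> w) * of_bool (y \<in> cl (w \<inter> ?E3) b))"
      using disj abV S ed_mono[of S V] ed_mono[of "V - C" V] fin
      by (intro bex_indep[where f = "\<lambda>w. of_bool (cl w x = C)"
        and g = "\<lambda>w. of_bool ({a, b} \<in> w) * of_bool (y \<in> cl (w \<inter> ?E3) b)"]) auto
    also have "bex p ?E1 (\<lambda>w. of_bool (cl w x = C)) = bex p (ed S) (\<lambda>w. of_bool (cl (w \<inter> ?E1) x = C))"
      using fin by (intro bex_restrict[symmetric]) auto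
    also have "\<dots> = bex p (ed S) (\<lambda>w. of_bool (cl w x = C))"
    proof (rule bex_cong)
      fix w assume w: "w \<subseteq> ed S"
      then have "w \<inter> ?E1 = w \<inter> {e. e \<inter> C \<noteq> {}}" by auto
      then show "of_bool (cl (w \<inter> ?E1) x = C) = (of_bool (cl w x = C) :: real)"
        using cl_eq_touch[OF ne, of w x] by simp
    qed
    also have "bex p ?E2 (\<lambda>w. of_bool ({a, b} \<in> w) * of_bool (y \<in> cl (w \<inter> ?E3) b))
        = (1 - p {a, b}) * bex p ?E3 (\<lambda>w. of_bool ({a, b} \<in> w) * of_bool (y \<in> cl (w \<inter> ?E3) b))
        + p {a, b} * bex p ?E3 (\<lambda>w. of_bool (y \<in> cl (insert {a, b} w \<inter> ?E3) b))"
      using nin V by (subst bex_insert) (auto intro: finite_ed)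
    also have "bex p ?E3 (\<lambda>w. of_bool ({a, b} \<in> w) * of_bool (y \<in> cl (w \<inter> ?E3) b))
        = bex p ?E3 (\<lambda>w. 0)" using nin by (intro bex_cong) auto
    also have "\<dots> = 0" using V by (simp add: bex_const finite_ed)
    also have "bex p ?E3 (\<lambda>w. of_bool (y \<in> cl (insert {a, b} w \<inter> ?E3) b)) = tau p (V - C) b y"
      unfolding tau_def
    proof (rule bex_cong)
      fix w assume "w \<subseteq> ?E3"
      then have "insert {a, b} w \<inter> ?E3 = w" using nin by auto
      then show "of_bool (y \<in> cl (insert {a, b} w \<inter> ?E3) b) = (of_bool (y \<in> cl w b) :: real)"
        by simp
    qed
    also have "bex p (ed S) (\<lambda>w. of_bool (cl w x = C)) * ((1 - p {a, b}) * 0 + p {a, b} * tau p (V - C) b y)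
        \<le> bex p (ed S) (\<lambda>w. of_bool (cl w x = C)) * (p {a, b} * tau p V b y)"
      using p V by (auto intro!: mult_left_mono bex_nonneg tau_mono simp: pvalid_def)
    finally show ?thesis by (simp add: mult.assoc)
  qed
  have "tau p V x y \<le> bex p (ed V) (\<lambda>w. of_bool (y \<in> cl (w \<inter> ed S) x)
      + (\<Sum>C\<in>Pow S. \<Sum>a\<in>C. \<Sum>b\<in>V - S. T C a b w))"
    unfolding tau_def by (intro bex_mono p pt)
  also have "\<dots> = tau p S x y + (\<Sum>C\<in>Pow S. \<Sum>a\<in>C. \<Sum>b\<in>V - S. bex p (ed V) (T C a b))"
    using V S by (simp add: bex_add bex_sum tau_restrict)
  also have "(\<Sum>C\<in>Pow S. \<Sum>a\<in>C. \<Sum>b\<in>V - S. bex p (ed V) (T C a b))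
      \<le> (\<Sum>C\<in>Pow S. \<Sum>a\<in>C. \<Sum>b\<in>V - S.
          bex p (ed S) (\<lambda>w. of_bool (cl w x = C)) * (p {a, b} * tau p V b y))"
    using ET by (intro sum_mono) auto
  \<comment> \<open>An indicator extends the sum over \<open>a\<close> from \<open>C\<close> to
    \<open>S\<close>, so that the sum over \<open>C\<close> can be moved inside, where it collapses
    to \<open>tau p S x a\<close>.\<close>
  also have "\<dots> = (\<Sum>C\<in>Pow S. \<Sum>a\<in>S. \<Sum>b\<in>V - S. of_bool (a \<in> C) *
          bex p (ed S) (\<lambda>w. of_bool (cl w x = C)) * (p {a, b} * tau p V b y))"
    using fin by (intro sum.cong sum.mono_neutral_cong_left) (auto intro: finite_subset)
  also have "\<dots> = (\<Sum>a\<in>S. \<Sum>b\<in>V - S. (\<Sum>C\<in>Pow S. of_bool (a \<in> C) *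
          bex p (ed S) (\<lambda>w. of_bool (cl w x = C))) * (p {a, b} * tau p V b y))"
    by (subst sum.swap, intro sum.cong refl, subst sum.swap) (simp add: sum_distrib_right)
  also have "\<dots> = (\<Sum>a\<in>S. \<Sum>b\<in>V - S. tau p S x a * (p {a, b} * tau p V b y))"
  proof -
    have "(\<Sum>C\<in>Pow S. of_bool (a \<in> C) * bex p (ed S) (\<lambda>w. of_bool (cl w x = C))) = tau p S x a" for a
    proof -
      have "(\<Sum>C\<in>Pow S. of_bool (a \<in> C) * bex p (ed S) (\<lambda>w. of_bool (cl w x = C)))
        = bex p (ed S) (\<lambda>w. \<Sum>C\<in>Pow S. of_bool (a \<in> C) * of_bool (cl w x = C))"
        by (simp add: bex_sum bex_cmult)
      also have "\<dots> = tau p S x a" unfolding tau_def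
      proof (rule bex_cong)
        fix w assume "w \<subseteq> ed S"
        then have "cl w x \<in> Pow S" using cl_subset'[of w S x] x by auto
        then show "(\<Sum>C\<in>Pow S. of_bool (a \<in> C) * of_bool (cl w x = C)) = (of_bool (a \<in> cl w x) :: real)"
          using fin by (simp add: of_bool_def if_distrib[where f = "\<lambda>z. _ * z"] cong: if_cong)
      qed
      finally show ?thesis .
    qed
    then show ?thesis by simp
  qed
  finally show ?thesis by (simp add: mult.assoc)
qed

text \<open>The sets \<open>C1\<close> and \<open>C2\<close> depend only on the edges inside
  \<open>V1\<close> and \<open>V2\<close>. Given those, the edges between the two sets are still
  independent, and each is closed with probability at most exp (- q).\<close>

lemma bex_cross:
  assumes p: "pvalid p" and V: "finite V" "V1 \<subseteq> V" "V2 \<subseteq> V" "V1 \<inter> V2 = {}"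
    and C: "\<And>w. w \<subseteq> ed V1 \<Longrightarrow> C1 w \<subseteq> V1" "\<And>w. w \<subseteq> ed V2 \<Longrightarrow> C2 w \<subseteq> V2"
    and g: "\<And>w1 w2. 0 \<le> g w1 w2"
    and q: "\<And>a b. a \<in> V1 \<Longrightarrow> b \<in> V2 \<Longrightarrow> 1 - exp (- q) \<le> p {a, b}"
  shows "bex p (ed V) (\<lambda>w. g (w \<inter> ed V1) (w \<inter> ed V2) *
      of_bool (\<forall>a\<in>C1 (w \<inter> ed V1). \<forall>b\<in>C2 (w \<inter> ed V2). {a, b} \<notin> w))
    \<le> bex p (ed V1) (\<lambda>w1. bex p (ed V2) (\<lambda>w2.
        g w1 w2 * exp (- q * real (card (C1 w1)) * real (card (C2 w2)))))"
proof -
  define X where "X = (\<lambda>(a, b). {a, b}) ` (V1 \<times> V2)"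
  have fin: "finite V1" "finite V2" "finite (ed V)" "finite (ed V1)" "finite (ed V2)" "finite X"
    using V by (auto intro: finite_ed finite_subset simp: X_def)
  have XV: "X \<subseteq> ed V" using V by (auto simp: X_def intro!: mem_edI)
  have d: "ed V1 \<inter> ed V2 = {}" "(ed V1 \<union> ed V2) \<inter> X = {}"
    using V(4) by (auto simp: ed_def X_def doubleton_eq_iff)
  have e: "ed V1 \<subseteq> ed V" "ed V2 \<subseteq> ed V" using V by (auto intro!: ed_mono)
  define f where "f = (\<lambda>w v. g (w \<inter> ed V1) (w \<inter> ed V2) *
      of_bool (\<forall>a\<in>C1 (w \<inter> ed V1). \<forall>b\<in>C2 (w \<inter> ed V2). {a, b} \<notin> v))"
  have "bex p (ed V) (\<lambda>w. g (w \<inter> ed V1) (w \<inter> ed V2) *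
      of_bool (\<forall>a\<in>C1 (w \<inter> ed V1). \<forall>b\<in>C2 (w \<inter> ed V2). {a, b} \<notin> w))
    = bex p (ed V) (\<lambda>w. f (w \<inter> (ed V1 \<union> ed V2)) (w \<inter> X))"
  proof (rule bex_cong)
    fix w assume "w \<subseteq> ed V"
    have i: "w \<inter> (ed V1 \<union> ed V2) \<inter> ed V1 = w \<inter> ed V1" "w \<inter> (ed V1 \<union> ed V2) \<inter> ed V2 = w \<inter> ed V2"
      by auto
    have "{a, b} \<in> X" if "a \<in> C1 (w \<inter> ed V1)" "b \<in> C2 (w \<inter> ed V2)" for a b
      using that C(1)[of "w \<inter> ed V1"] C(2)[of "w \<inter> ed V2"] by (auto simp: X_def)
    then show "g (w \<inter> ed V1) (w \<inter> ed V2) *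
      of_bool (\<forall>a\<in>C1 (w \<inter> ed V1). \<forall>b\<in>C2 (w \<inter> ed V2). {a, b} \<notin> w)
      = f (w \<inter> (ed V1 \<union> ed V2)) (w \<inter> X)" unfolding f_def i by auto
  qed
  also have "\<dots> = bex p (ed V1 \<union> ed V2) (\<lambda>w. bex p X (f w))"
    using fin e XV d by (intro bex_indep2) auto
  also have "\<dots> = bex p (ed V1) (\<lambda>w1. bex p (ed V2) (\<lambda>w2. bex p X (f (w1 \<union> w2))))"
    using fin d by (intro bex_union)
  also have "\<dots> \<le> bex p (ed V1) (\<lambda>w1. bex p (ed V2) (\<lambda>w2.
        g w1 w2 * exp (- q * real (card (C1 w1)) * real (card (C2 w2)))))"
  proof (intro bex_mono p)
    fix w1 w2 assume w: "w1 \<subseteq> ed V1" "w2 \<subseteq> ed V2"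
    have i: "(w1 \<union> w2) \<inter> ed V1 = w1" "(w1 \<union> w2) \<inter> ed V2 = w2" using w d by auto
    define D where "D = (\<lambda>(a, b). {a, b}) ` (C1 w1 \<times> C2 w2)"
    have CC: "C1 w1 \<subseteq> V1" "C2 w2 \<subseteq> V2" using C w by auto
    then have DX: "D \<subseteq> X" unfolding D_def X_def by auto
    have "inj_on (\<lambda>(a, b). {a, b}) (C1 w1 \<times> C2 w2)"
      using CC V(4) by (auto simp: inj_on_def doubleton_eq_iff)
    then have cD: "card D = card (C1 w1) * card (C2 w2)"
      unfolding D_def by (simp add: card_image card_cartesian_product)
    have "bex p X (f (w1 \<union> w2)) = g w1 w2 * bex p X (\<lambda>v. of_bool ((v \<inter> D) \<inter> D = {}))"
      unfolding f_def i bex_cmult D_def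
      by (intro arg_cong[where f = "\<lambda>t. g w1 w2 * t"] bex_cong) auto
    also have "bex p X (\<lambda>v. of_bool ((v \<inter> D) \<inter> D = {})) = bex p D (\<lambda>v. of_bool (v \<inter> D = {}))"
      using fin DX by (intro bex_restrict)
    also have "\<dots> = (\<Prod>e\<in>D. 1 - p e)"
      using fin DX by (intro bex_none_open) (auto intro: finite_subset)
    also have "\<dots> \<le> (\<Prod>e\<in>D. exp (- q))"
    proof (intro prod_mono conjI)
      fix e assume "e \<in> D"
      then obtain a b where "e = {a, b}" "a \<in> V1" "b \<in> V2" using CC by (auto simp: D_def)
      then show "1 - p e \<le> exp (- q)" using q[of a b] by simp
      show "0 \<le> 1 - p e" using p by (auto simp: pvalid_def)
    qed
    also have "\<dots> = exp (- q * real (card (C1 w1)) * real (card (C2 w2)))"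
      by (simp add: cD exp_of_nat_mult[symmetric] algebra_simps)
    finally show "bex p X (f (w1 \<union> w2)) \<le> g w1 w2 * exp (- q * real (card (C1 w1)) * real (card (C2 w2)))"
      using g by (simp add: mult_left_mono)
  qed
  finally show ?thesis .
qed

text \<open>One open edge between the two inner clusters already connects \<open>x\<close> to
  \<open>y\<close>.\<close>

lemma tau_merge:
  assumes p: "pvalid p" and V: "finite V" "V1 \<subseteq> V" "V2 \<subseteq> V" "V1 \<inter> V2 = {}"
    and x: "x \<in> V1" and y: "y \<in> V2"
    and q: "\<And>a b. a \<in> V1 \<Longrightarrow> b \<in> V2 \<Longrightarrow> 1 - exp (- q) \<le> p {a, b}"
  shows "bex p (ed V1) (\<lambda>w1. bex p (ed V2) (\<lambda>w2.
      1 - exp (- q * real (card (cl w1 x)) * real (card (cl w2 y))))) \<le> tau p V x y"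
proof -
  have fin: "finite (ed V1)" "finite (ed V2)" "finite (ed V)"
    using V by (auto intro: finite_ed finite_subset)
  have C: "w \<subseteq> ed V1 \<Longrightarrow> cl w x \<subseteq> V1" "w \<subseteq> ed V2 \<Longrightarrow> cl w y \<subseteq> V2" for w
    using x y cl_subset'[of w V1 x] cl_subset'[of w V2 y] by auto
  have le: "1 - tau p V x y \<le> bex p (ed V) (\<lambda>w. 1 *
     of_bool (\<forall>a\<in>cl (w \<inter> ed V1) x. \<forall>b\<in>cl (w \<inter> ed V2) y. {a, b} \<notin> w))"
  proof -
    have "1 - tau p V x y = bex p (ed V) (\<lambda>w. 1 - of_bool (y \<in> cl w x))"
      using fin by (simp add: bex_diff bex_const tau_def)
    also have "\<dots> \<le> bex p (ed V) (\<lambda>w. 1 *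
     of_bool (\<forall>a\<in>cl (w \<inter> ed V1) x. \<forall>b\<in>cl (w \<inter> ed V2) y. {a, b} \<notin> w))"
    proof (intro bex_mono p)
      fix w
      have "y \<in> cl w x" if "a \<in> cl (w \<inter> ed V1) x" "b \<in> cl (w \<inter> ed V2) y" "{a, b} \<in> w" for a b
      proof -
        have "a \<in> cl w x" "b \<in> cl w y" using that cl_mono[of "w \<inter> _" w] by blast+
        then show ?thesis using cl_step[of a w x b] that cl_sym[of b w y] cl_trans by metis
      qed
      then show "1 - of_bool (y \<in> cl w x) \<le> 1 *
       (of_bool (\<forall>a\<in>cl (w \<inter> ed V1) x. \<forall>b\<in>cl (w \<inter> ed V2) y. {a, b} \<notin> w) :: real)"
        by auto
    qed
    finally show ?thesis .
  qed
  also have "\<dots> \<le> bex p (ed V1) (\<lambda>w1. bex p (ed V2) (\<lambda>w2.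
        1 * exp (- q * real (card (cl w1 x)) * real (card (cl w2 y)))))"
    using bex_cross[OF p V C _ q, where g = "\<lambda>_ _. 1"] by simp
  finally show ?thesis using fin by (simp add: bex_diff bex_const)
qed

subsection \<open>Tails of cluster sizes\<close>

lemma cl_remove_edge:
  assumes "{v, z} \<in> H"
  shows "cl H v \<subseteq> cl (H - {{v, z}}) v \<union> cl (H - {{v, z}}) z"
proof (rule cl_closedI)
  fix y u assume *: "y \<in> cl (H - {{v, z}}) v \<union> cl (H - {{v, z}}) z" "{y, u} \<in> H"
  show "u \<in> cl (H - {{v, z}}) v \<union> cl (H - {{v, z}}) z"
  proof (cases "{y, u} = {v, z}")
    case True
    then show ?thesis by (auto simp: doubleton_eq_iff)
  next
    case False
    then show ?thesis using * cl_step[of y "H - {{v, z}}" _ u] by auto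
  qed
qed simp

text \<open>A cluster survives the deletion of all edges that are not contained in it. In
  \<open>cluster_split\<close> this cuts a witness down to a single component.\<close>

lemma cl_inside: "cl (w \<inter> {e. e \<subseteq> cl w v}) v = cl w v"
proof
  show "cl w v \<subseteq> cl (w \<inter> {e. e \<subseteq> cl w v}) v"
  proof
    fix y assume "y \<in> cl w v"
    then show "y \<in> cl (w \<inter> {e. e \<subseteq> cl w v}) v"
    proof (induction rule: cl_induct)
      case (step y z)
      have "{y, z} \<in> w \<inter> {e. e \<subseteq> cl w v}" using step cl_step[of y w v z] by auto
      then show ?case using step cl_step by metis
    qed simp
  qed
qed (rule cl_mono, auto)

text \<open>Take a smallest \<open>H \<subseteq> w\<close> such that a cluster of \<open>H\<close> has at least \<open>l\<close> vertices, meets the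
  cluster of \<open>u\<close> in \<open>w - H\<close> and together with it covers the cluster of \<open>u\<close> in \<open>w\<close>. Deleting an
  edge of \<open>H\<close> at a vertex of the intersection splits that cluster into two parts with fewer than \<open>l\<close>
  vertices each.\<close>

lemma cluster_split:
  assumes V: "finite V" "w \<subseteq> ed V" and u: "u \<in> V" and l: "1 \<le> l" and big: "3 * l \<le> card (cl w u)"
  shows "disjointly (\<lambda>w. l \<le> card (cl w u)) (\<lambda>w. \<exists>v\<in>V. l \<le> card (cl w v)) w"
proof -
  define Q where "Q = (\<lambda>H. H \<subseteq> w \<and> (\<exists>v\<in>V. v \<in> cl (w - H) u \<and> l \<le> card (cl H v) \<and>
    cl w u \<subseteq> cl H v \<union> cl (w - H) u))"
  have finw: "finite w" using V finite_ed finite_subset by blast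
  have "Q w" using u big by (auto simp: Q_def intro!: bexI[of _ u])
  then obtain H where H: "Q H" and min: "\<And>H'. Q H' \<Longrightarrow> card H \<le> card H'"
    using ex_has_least_nat[of Q w card] by blast
  obtain v where v: "v \<in> V" "v \<in> cl (w - H) u" "l \<le> card (cl H v)" "cl w u \<subseteq> cl H v \<union> cl (w - H) u"
    and Hw: "H \<subseteq> w" using H by (auto simp: Q_def)
  have fcl: "finite (cl w' x)" if "w' \<subseteq> w" for w' x
    using finite_cl[OF V(1), of w' x] that V by auto
  have finH: "finite H" using Hw finw finite_subset by blast
  have "card (cl H v) \<le> 2 * l"
  proof (cases "\<exists>z. {v, z} \<in> H")
    case False
    then have "cl H v \<subseteq> {v}" by (intro cl_closedI) auto
    then have "card (cl H v) \<le> 1" using card_mono[of "{v}" "cl H v"] by simp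
    then show ?thesis using l by simp
  next
    case True
    then obtain z where z: "{v, z} \<in> H" by blast
    let ?H1 = "H - {{v, z}}"
    have zV: "z \<in> V" using z Hw V mem_edD[of v z V] by auto
    have zin: "z \<in> cl (w - H') u" if "{v, z} \<notin> H'" "H' \<subseteq> H" for H'
    proof -
      have "v \<in> cl (w - H') u" using v(2) cl_mono[of "w - H" "w - H'" u] that by auto
      then show ?thesis using cl_step[of v "w - H'" u z] z Hw that by auto
    qed
    \<comment> \<open>Otherwise the edges \<open>?H'\<close> of the component of \<open>x\<close>
      alone would satisfy \<open>Q\<close>, and they form a proper subset of \<open>H\<close>
      because \<open>{v, z}\<close> is missing.\<close>
    have small: "card (cl ?H1 x) < l" if x: "(x = v \<and> y = z) \<or> (x = z \<and> y = v)" for x y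
    proof (rule ccontr)
      assume "\<not> card (cl ?H1 x) < l"
      then have xl: "l \<le> card (cl ?H1 x)" by simp
      let ?H' = "?H1 \<inter> {e. e \<subseteq> cl ?H1 x}"
      have sub: "?H' \<subseteq> H" "{v, z} \<notin> ?H'" by auto
      have xV: "x \<in> V" using x v zV by auto
      have vin: "v \<in> cl (w - ?H') u" using v(2) cl_mono[of "w - H" "w - ?H'" u] by auto
      have xin: "x \<in> cl (w - ?H') u" "y \<in> cl (w - ?H') u" using x vin zin[OF sub(2,1)] by auto
      \<comment> \<open>The other component is not lost when it is dropped from the witness: its
        edges now belong to \<open>w - ?H'\<close>, where \<open>y\<close> is joined to
        \<open>u\<close>.\<close>
      have yc: "cl ?H1 y \<subseteq> cl ?H1 x \<union> cl (w - ?H') u"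
      proof (cases "y \<in> cl ?H1 x")
        case True
        show ?thesis using equalityD1[OF cl_eq[OF True]] by (rule le_supI1)
      next
        case False
        have "cl ?H1 y \<subseteq> cl (w - ?H') y"
        proof
          fix t assume "t \<in> cl ?H1 y"
          then show "t \<in> cl (w - ?H') y"
          proof (induction rule: cl_induct)
            case (step t s)
            have "t \<notin> cl ?H1 x"
            proof
              assume "t \<in> cl ?H1 x"
              then have "cl ?H1 t = cl ?H1 x" by (rule cl_eq)
              with cl_eq[OF step(1)] have "cl ?H1 y = cl ?H1 x" by simp
              then show False using False cl_self[of y ?H1] by simp
            qed
            then have "{t, s} \<in> w - ?H'" using step Hw by auto
            with step.IH show ?case by (rule cl_step)
          qed simp
        qed
        then show ?thesis using cl_trans[OF xin(2)] by blast
      qed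
      have "cl ?H1 v \<union> cl ?H1 z = cl ?H1 x \<union> cl ?H1 y"
        using x by (elim disjE conjE) (simp_all add: Un_commute)
      then have "cl H v \<subseteq> cl ?H1 x \<union> cl (w - ?H') u" using cl_remove_edge[OF z] yc by blast
      moreover have "cl (w - H) u \<subseteq> cl (w - ?H') u" by (rule cl_mono) auto
      ultimately have "cl w u \<subseteq> cl ?H' x \<union> cl (w - ?H') u"
        using v(4) unfolding cl_inside by auto
      then have "Q ?H'" unfolding Q_def using xV xin xl Hw
        by (intro conjI bexI[of _ x]) (auto simp: cl_inside)
      then have "card H \<le> card ?H'" by (rule min)
      moreover have "?H' \<subset> H" using sub z by auto
      ultimately show False using psubset_card_mono[OF finH] by (meson not_le)
    qed
    have "card (cl H v) \<le> card (cl ?H1 v \<union> cl ?H1 z)"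
      using fcl[of ?H1] Hw by (intro card_mono cl_remove_edge z) auto
    also have "\<dots> \<le> card (cl ?H1 v) + card (cl ?H1 z)" by (rule card_Un_le)
    also have "\<dots> \<le> 2 * l" using small[of v z] small[of z v] by simp
    finally show ?thesis .
  qed
  moreover have "card (cl w u) \<le> card (cl H v) + card (cl (w - H) u)"
  proof -
    have "card (cl w u) \<le> card (cl H v \<union> cl (w - H) u)"
      using fcl Hw v by (intro card_mono) auto
    then show ?thesis using card_Un_le[of "cl H v" "cl (w - H) u"] by simp
  qed
  \<comment> \<open>\<open>H\<close> accounts for at most \<open>2 * l\<close> of the at least
    \<open>3 * l\<close> vertices. Hence \<open>w - H\<close> witnesses the event at
    \<open>u\<close>, and its complement \<open>H\<close> the event at \<open>v\<close>.\<close>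
  ultimately have "l \<le> card (cl (w - H) u)" using big by simp
  then show ?thesis unfolding disjointly_def using v Hw
    by (intro exI[of _ "w - H"]) (auto simp: double_diff)
qed

definition cluster_tail :: "('v set \<Rightarrow> real) \<Rightarrow> 'v set \<Rightarrow> 'v \<Rightarrow> nat \<Rightarrow> real" where
  "cluster_tail p V u l = bex p (ed V) (\<lambda>w. of_bool (l \<le> card (cl w u)))"

definition max_cluster_tail :: "('v set \<Rightarrow> real) \<Rightarrow> 'v set \<Rightarrow> nat \<Rightarrow> real" where
  "max_cluster_tail p V l = bex p (ed V) (\<lambda>w. of_bool (\<exists>v\<in>V. l \<le> card (cl w v)))"

lemma max_cluster_tail_nonneg: "pvalid p \<Longrightarrow> 0 \<le> max_cluster_tail p V l"
  unfolding max_cluster_tail_def by (intro bex_nonneg) auto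

lemma cluster_tail_nonneg: "pvalid p \<Longrightarrow> 0 \<le> cluster_tail p V u l"
  unfolding cluster_tail_def by (intro bex_nonneg) auto

lemma max_cluster_tail_antimono: "pvalid p \<Longrightarrow> l \<le> l' \<Longrightarrow> max_cluster_tail p V l' \<le> max_cluster_tail p V l"
  unfolding max_cluster_tail_def by (intro bex_mono) (auto, meson le_trans)

lemma cluster_tail_step:
  assumes p: "pvalid p" and V: "finite V" and u: "u \<in> V" and l: "1 \<le> l"
  shows "cluster_tail p V u (3 * l) \<le> cluster_tail p V u l * max_cluster_tail p V l"
proof -
  \<comment> \<open>Intersecting with \<open>ed V\<close> keeps all clusters finite. For arbitrary
    \<open>w\<close> a cluster could be infinite, with \<open>card\<close> equal to 0, and the
    events would fail to be increasing.\<close>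
  let ?A = "\<lambda>l w. l \<le> card (cl (w \<inter> ed V) u)" and ?B = "\<lambda>w. \<exists>v\<in>V. l \<le> card (cl (w \<inter> ed V) v)"
  have up: "card (cl (w \<inter> ed V) v) \<le> card (cl (w' \<inter> ed V) v)" if "w \<subseteq> w'" for w w' v
    using that V by (intro card_mono cl_mono finite_cl) auto
  have r: "bex p (ed V) (\<lambda>w. of_bool (F (w \<inter> ed V))) = bex p (ed V) (\<lambda>w. of_bool (F w))"
    for F :: "'a set set \<Rightarrow> bool"
    by (intro bex_cong) (simp add: Int_absorb2)
  have "cluster_tail p V u (3 * l) \<le> bex p (ed V) (\<lambda>w. of_bool (disjointly (?A l) ?B w))"
    unfolding cluster_tail_def
  proof (intro bex_mono p)
    fix w assume w: "w \<subseteq> ed V"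
    have "disjointly (?A l) ?B w" if big: "3 * l \<le> card (cl w u)"
    proof -
      obtain H where H: "H \<subseteq> w" "l \<le> card (cl H u)" "\<exists>v\<in>V. l \<le> card (cl (w - H) v)"
        using cluster_split[OF V w u l big] unfolding disjointly_def by blast
      have "H \<inter> ed V = H" "(w - H) \<inter> ed V = w - H" using H w by auto
      then show ?thesis unfolding disjointly_def using H by (intro exI[of _ H]) simp
    qed
    then show "of_bool (3 * l \<le> card (cl w u)) \<le> (of_bool (disjointly (?A l) ?B w) :: real)" by auto
  qed
  also have "\<dots> \<le> bex p (ed V) (\<lambda>w. of_bool (?A l w)) * bex p (ed V) (\<lambda>w. of_bool (?B w))"
  proof (rule bk_inequality[OF finite_ed[OF V] p])
    show "?A l w'" if "?A l w" "w \<subseteq> w'" for w w' using up[OF that(2)] that(1) le_trans by blast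
    show "?B w'" if "?B w" "w \<subseteq> w'" for w w' using up[OF that(2)] that(1) le_trans by blast
  qed
  also have "\<dots> = cluster_tail p V u l * max_cluster_tail p V l"
    unfolding cluster_tail_def max_cluster_tail_def
    using r[of "\<lambda>w. l \<le> card (cl w u)"] r[of "\<lambda>w. \<exists>v\<in>V. l \<le> card (cl w v)"] by simp
  finally show ?thesis .
qed

lemma cluster_tail_power:
  assumes p: "pvalid p" and V: "finite V" and u: "u \<in> V" and l: "1 \<le> l" and t: "max_cluster_tail p V l \<le> t"
  shows "cluster_tail p V u (3 ^ i * l) \<le> t ^ i * cluster_tail p V u l"
proof (induction i)
  case (Suc i)
  have t0: "0 \<le> t" using t max_cluster_tail_nonneg[OF p] order_trans by blast
  have l1: "l \<le> 3 ^ i * l" using mult_le_mono1[of 1 "3 ^ i" l] by simp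
  then have l1: "l \<le> 3 ^ i * l" "1 \<le> 3 ^ i * l" using l by linarith+
  have "cluster_tail p V u (3 ^ Suc i * l) = cluster_tail p V u (3 * (3 ^ i * l))" by (simp add: mult.assoc)
  also have "\<dots> \<le> cluster_tail p V u (3 ^ i * l) * max_cluster_tail p V (3 ^ i * l)"
    using cluster_tail_step[OF p V u l1(2)] .
  also have "\<dots> \<le> (t ^ i * cluster_tail p V u l) * t"
    using Suc t max_cluster_tail_antimono[OF p l1(1), of V] t0
    by (intro mult_mono mult_nonneg_nonneg cluster_tail_nonneg max_cluster_tail_nonneg p) auto
  finally show ?case by (simp add: algebra_simps)
qed simp

text \<open>With t = 1 / 27 each tripling of the size divides the tail by 27, so the contribution to
  the expectation falls by 9. Above \<open>3 * l\<close> at most 3 / 8 of the expectation remains,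
  less than half.\<close>

lemma truncated_cluster:
  assumes p: "pvalid p" and V: "finite V" and u: "u \<in> V" and l: "1 \<le> l"
    and t: "max_cluster_tail p V l \<le> 1 / 27"
  shows "bex p (ed V) (\<lambda>w. real (card (cl w u))) / 2
     \<le> bex p (ed V) (\<lambda>w. real (card (cl w u)) * of_bool (card (cl w u) < 3 * l))"
proof -
  define X where "X = (\<lambda>w. real (card (cl w u)))"
  define g where "g = (\<lambda>m. bex p (ed V) (\<lambda>w. X w * of_bool (m \<le> card (cl w u))))"
  have fin: "finite (ed V)" using V by (rule finite_ed)
  have step: "g m \<le> real (3 * m) * cluster_tail p V u m + g (3 * m)" for m
  proof -
    have "g m \<le> bex p (ed V) (\<lambda>w. real (3 * m) * of_bool (m \<le> card (cl w u))
        + X w * of_bool (3 * m \<le> card (cl w u)))"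
      unfolding g_def X_def by (intro bex_mono p) (auto simp: not_le)
    then show ?thesis by (simp add: bex_add bex_cmult cluster_tail_def g_def)
  qed
  have zero: "g m = 0" if "card V < m" for m
  proof -
    have "g m = bex p (ed V) (\<lambda>w. 0)" unfolding g_def
    proof (rule bex_cong)
      fix w assume w: "w \<subseteq> ed V"
      then have "card (cl w u) \<le> card V" using cl_subset'[OF w u] V by (intro card_mono)
      then show "X w * of_bool (m \<le> card (cl w u)) = 0" using that by simp
    qed
    then show ?thesis using fin by (simp add: bex_const)
  qed
  define P where "P = real l * cluster_tail p V u l"
  have P0: "0 \<le> P" unfolding P_def by (intro mult_nonneg_nonneg cluster_tail_nonneg p) auto
  \<comment> \<open>Downward induction from a scale beyond \<open>card V\<close>, where
    \<open>g\<close> vanishes. The constant 27 / 8 solves c = 3 + c / 9, as \<open>step\<close>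
    requires.\<close>
  have dec: "g (3 ^ (n - i) * l) \<le> 27 / 8 * (1 / 9) ^ (n - i) * P" if n: "card V < 3 ^ n * l" "i \<le> n" for n i
    using n(2)
  proof (induction i)
    case 0
    then show ?case using zero[OF n(1)] P0 by simp
  next
    case (Suc i)
    define j where "j = n - Suc i"
    have j: "n - i = Suc j" using Suc by (simp add: j_def)
    have "g (3 ^ j * l) \<le> real (3 * (3 ^ j * l)) * cluster_tail p V u (3 ^ j * l) + g (3 * (3 ^ j * l))"
      by (rule step)
    also have "g (3 * (3 ^ j * l)) \<le> 27 / 8 * (1 / 9) ^ Suc j * P"
      using Suc j by (simp add: mult.assoc)
    also have "real (3 * (3 ^ j * l)) * cluster_tail p V u (3 ^ j * l)
        \<le> real (3 * (3 ^ j * l)) * ((1 / 27) ^ j * cluster_tail p V u l)"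
      by (intro mult_left_mono cluster_tail_power assms) auto
    also have "\<dots> = 3 * (3 ^ j * (1 / 27) ^ j) * P" by (simp add: P_def)
    also have "(3 ^ j * (1 / 27) ^ j :: real) = (1 / 9) ^ j"
      by (simp add: power_mult_distrib[symmetric])
    also have "3 * (1 / 9) ^ j * P + 27 / 8 * (1 / 9) ^ Suc j * P = 27 / 8 * (1 / 9) ^ j * P"
      by simp
    finally show ?case by (simp add: j_def)
  qed
  have "card V < 3 ^ (card V + 1) * l"
  proof -
    have "card V + 1 < 2 ^ (card V + 1)" by (rule less_exp)
    also have "\<dots> \<le> (3::nat) ^ (card V + 1)" by (intro power_mono) auto
    also have "\<dots> \<le> 3 ^ (card V + 1) * l" using mult_le_mono2[OF l, of "3 ^ (card V + 1)"] by simp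
    finally show ?thesis by simp
  qed
  from dec[OF this, of "card V"] have "g (3 * l) \<le> 27 / 8 * (1 / 9) * P" by simp
  moreover have "P \<le> bex p (ed V) X"
  proof -
    have "P = bex p (ed V) (\<lambda>w. real l * of_bool (l \<le> card (cl w u)))"
      by (simp add: P_def cluster_tail_def bex_cmult)
    also have "\<dots> \<le> bex p (ed V) X" unfolding X_def by (intro bex_mono p) auto
    finally show ?thesis .
  qed
  moreover have "bex p (ed V) X = bex p (ed V) (\<lambda>w. X w * of_bool (card (cl w u) < 3 * l)) + g (3 * l)"
    unfolding g_def bex_add[symmetric] by (intro bex_cong) auto
  ultimately show ?thesis using P0 unfolding X_def by linarith
qed

text \<open>Rests on 1 - exp (- x) \<ge> x / (1 + x). For truncated clusters the denominator is
  bounded by a constant, which leaves a multiple of the product of the sizes, and the two sizes are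
  independent. The 4 pays for the two truncations.\<close>

lemma tau_merge_truncated:
  assumes p: "pvalid p" and V: "finite V" "V1 \<subseteq> V" "V2 \<subseteq> V" "V1 \<inter> V2 = {}"
    and x: "x \<in> V1" and y: "y \<in> V2"
    and q0: "0 \<le> q" and q: "\<And>a b. a \<in> V1 \<Longrightarrow> b \<in> V2 \<Longrightarrow> 1 - exp (- q) \<le> p {a, b}"
    and l: "1 \<le> l" "max_cluster_tail p V1 l \<le> 1 / 27" "max_cluster_tail p V2 l \<le> 1 / 27"
  shows "q / (4 * (1 + q * (3 * real l)\<^sup>2)) * (\<Sum>z\<in>V1. tau p V1 x z) * (\<Sum>z\<in>V2. tau p V2 y z)
     \<le> tau p V x y"
proof -
  let ?Y = "\<lambda>x w. real (card (cl w x)) * of_bool (card (cl w x) < 3 * l)"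
  define k where "k = q / (1 + q * (3 * real l)\<^sup>2)"
  have k0: "0 \<le> k" unfolding k_def using q0 by (intro divide_nonneg_nonneg add_nonneg_nonneg mult_nonneg_nonneg) auto
  have fin: "finite V1" "finite V2" using V finite_subset by blast+
  have pt: "k * (?Y x w1 * ?Y y w2) \<le> 1 - exp (- q * real (card (cl w1 x)) * real (card (cl w2 y)))"
    for w1 w2
  proof (cases "card (cl w1 x) < 3 * l \<and> card (cl w2 y) < 3 * l")
    case False
    then show ?thesis using q0 by auto
  next
    case True
    define s where "s = real (card (cl w1 x)) * real (card (cl w2 y))"
    have "real (card (cl w1 x)) \<le> 3 * real l" "real (card (cl w2 y)) \<le> 3 * real l"
      using True by linarith+
    then have s: "0 \<le> s" "s \<le> (3 * real l)\<^sup>2"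
      unfolding s_def power2_eq_square by (simp, intro mult_mono) auto
    have "k * s \<le> q * s / (1 + q * s)"
    proof -
      have "q * s / (1 + q * (3 * real l)\<^sup>2) \<le> q * s / (1 + q * s)"
        using s q0 by (intro divide_left_mono mult_pos_pos add_pos_nonneg mult_nonneg_nonneg add_left_mono mult_left_mono) auto
      then show ?thesis by (simp add: k_def)
    qed
    also have "\<dots> \<le> 1 - exp (- (q * s))"
    proof -
      have "0 \<le> q * s" using s q0 by simp
      moreover have "1 + q * s \<le> exp (q * s)" by (rule exp_ge_add_one_self)
      ultimately have "1 / exp (q * s) \<le> 1 / (1 + q * s)" by (intro divide_left_mono) auto
      then show ?thesis using \<open>0 \<le> q * s\<close> by (simp add: exp_minus field_simps)
    qed
    finally show ?thesis using True by (simp add: s_def mult.assoc)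
  qed
  have "k * ((\<Sum>z\<in>V1. tau p V1 x z) / 2 * ((\<Sum>z\<in>V2. tau p V2 y z) / 2))
    \<le> k * (bex p (ed V1) (?Y x) * bex p (ed V2) (?Y y))"
    unfolding sum_tau[OF fin(1) x] sum_tau[OF fin(2) y]
    using truncated_cluster[OF p fin(1) x l(1,2)] truncated_cluster[OF p fin(2) y l(1,3)]
    by (intro mult_left_mono mult_mono k0 bex_nonneg p divide_nonneg_nonneg) auto
  also have "\<dots> = bex p (ed V1) (\<lambda>w1. bex p (ed V2) (\<lambda>w2. k * (?Y x w1 * ?Y y w2)))"
    by (simp only: bex_cmult bex_cmult_right)
  also have "\<dots> \<le> bex p (ed V1) (\<lambda>w1. bex p (ed V2) (\<lambda>w2.
      1 - exp (- q * real (card (cl w1 x)) * real (card (cl w2 y)))))"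
    by (intro bex_mono p pt)
  also have "\<dots> \<le> tau p V x y" by (rule tau_merge[OF p V x y q])
  finally show ?thesis by (simp add: k_def)
qed

section \<open>Lattice geometry and power sums\<close>

text \<open>The sup norm as a natural number, so that radii can be summed over and serve for
  induction.\<close>

definition nm :: "int ^ 'n \<Rightarrow> nat" where
  "nm x = nat (Max (range (\<lambda>i. \<bar>x $ i\<bar>)))"

lemma nm_le_iff: "nm x \<le> k \<longleftrightarrow> (\<forall>i. \<bar>x $ i\<bar> \<le> int k)"
  unfolding nm_def by (simp add: nat_le_iff)

lemma linf_norm_eq_nm: "linf_norm x = real (nm x)"
proof -
  have "Max (range (\<lambda>i. \<bar>real_of_int (x $ i)\<bar>)) \<in> range (\<lambda>i. \<bar>real_of_int (x $ i)\<bar>)"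
    by (intro Max_in) auto
  then obtain j where j: "Max (range (\<lambda>i. \<bar>real_of_int (x $ i)\<bar>)) = \<bar>real_of_int (x $ j)\<bar>"
    by blast
  have "Max (range (\<lambda>i. \<bar>x $ i\<bar>)) \<in> range (\<lambda>i. \<bar>x $ i\<bar>)"
    by (intro Max_in) auto
  then obtain k where k: "Max (range (\<lambda>i. \<bar>x $ i\<bar>)) = \<bar>x $ k\<bar>" by blast
  have "\<bar>real_of_int (x $ k)\<bar> \<le> \<bar>real_of_int (x $ j)\<bar>" unfolding j[symmetric] by (intro Max_ge) auto
  moreover have "\<bar>x $ j\<bar> \<le> \<bar>x $ k\<bar>" unfolding k[symmetric] by (intro Max_ge) auto
  ultimately show ?thesis unfolding linf_norm_eq_Max nm_def j k by linarith
qed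

lemma nm_zero [simp]: "nm 0 = 0"
  using nm_le_iff[of 0 0] by simp

lemma nm_eq_0_iff: "nm x = 0 \<longleftrightarrow> x = 0"
  using nm_le_iff[of x 0] by (auto simp: vec_eq_iff)

lemma nm_minus: "nm (- x) = nm x"
  by (simp add: nm_def)

lemma nm_commute: "nm (x - y) = nm (y - x)"
  using nm_minus[of "x - y"] by simp

lemma nm_triangle: "nm (x + y) \<le> nm x + nm y"
proof -
  have "\<bar>x $ i\<bar> \<le> int (nm x)" "\<bar>y $ i\<bar> \<le> int (nm y)" for i
    using nm_le_iff[of x "nm x"] nm_le_iff[of y "nm y"] by auto
  then have "\<bar>x $ i + y $ i\<bar> \<le> int (nm x) + int (nm y)" for i
    by (meson abs_triangle_ineq add_mono order_trans)
  then show ?thesis by (simp add: nm_le_iff)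
qed

lemma nm_triangle_diff: "nm (x - z) \<le> nm (x - y) + nm (y - z)"
  using nm_triangle[of "x - y" "y - z"] by simp

text \<open>Half-open cubes tile the lattice, as the renormalisation requires. The closed balls
  \<open>nball\<close> serve for quantities with a distinguished centre; they are cubes of odd
  side.\<close>

definition lbox :: "int ^ 'n \<Rightarrow> nat \<Rightarrow> (int ^ 'n) set" where
  "lbox u r = {x. \<forall>i. u $ i \<le> x $ i \<and> x $ i < u $ i + int r}"

definition nball :: "int ^ 'n \<Rightarrow> nat \<Rightarrow> (int ^ 'n) set" where
  "nball x m = {y. nm (y - x) \<le> m}"

lemma lbox_vec_nth: "vec_nth ` (lbox u r :: (int ^ 'n) set) = PiE UNIV (\<lambda>i. {u $ i..<u $ i + int r})"
proof (intro equalityI subsetI)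
  fix f :: "'n \<Rightarrow> int" assume f: "f \<in> PiE UNIV (\<lambda>i. {u $ i..<u $ i + int r})"
  then have "vec_lambda f \<in> lbox u r" by (auto simp: lbox_def PiE_iff)
  then show "f \<in> vec_nth ` lbox u r" by (intro image_eqI[of _ _ "vec_lambda f"]) (auto simp: fun_eq_iff)
qed (auto simp: lbox_def)

lemma inj_vec_nth: "inj_on vec_nth (A :: (int ^ 'n) set)"
  by (auto simp: inj_on_def vec_eq_iff)

lemma finite_lbox: "finite (lbox u r)"
proof -
  have "finite (vec_nth ` (lbox u r))"
    unfolding lbox_vec_nth by (intro finite_PiE) auto
  then show ?thesis by (rule finite_imageD[OF _ inj_vec_nth])
qed

lemma card_lbox: "card (lbox u r :: (int ^ 'n) set) = r ^ CARD('n)"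
proof -
  have "card (lbox u r) = card (vec_nth ` (lbox u r))"
    by (rule card_image[symmetric]) (rule inj_vec_nth)
  also have "\<dots> = r ^ CARD('n)" unfolding lbox_vec_nth by (simp add: card_PiE)
  finally show ?thesis .
qed

lemma nball_eq_lbox: "nball x m = lbox (x - (\<chi> i. int m)) (2 * m + 1)"
proof -
  have "\<bar>y $ i - x $ i\<bar> \<le> int m \<longleftrightarrow> x $ i - int m \<le> y $ i \<and> y $ i < x $ i - int m + int (2 * m + 1)"
    for y and i by auto
  then show ?thesis by (simp add: nball_def lbox_def nm_le_iff)
qed

lemma finite_nball: "finite (nball x m)"
  by (simp add: nball_eq_lbox finite_lbox)

lemma card_nball: "card (nball x m :: (int ^ 'n) set) = (2 * m + 1) ^ CARD('n)"
  by (simp add: nball_eq_lbox card_lbox)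

lemma mem_nball: "y \<in> nball x m \<longleftrightarrow> nm (y - x) \<le> m"
  by (simp add: nball_def)

lemma nball_mono: "m \<le> m' \<Longrightarrow> nball x m \<subseteq> nball x m'"
  by (auto simp: nball_def)

lemma lbox_diam: "x \<in> lbox u r \<Longrightarrow> y \<in> lbox u r \<Longrightarrow> nm (x - y) < r"
proof -
  assume *: "x \<in> lbox u r" "y \<in> lbox u r"
  have "0 < r" using * by (cases r) (auto simp: lbox_def)
  have "\<bar>x $ i - y $ i\<bar> \<le> int (r - 1)" for i
  proof -
    have "u $ i \<le> x $ i" "x $ i < u $ i + int r" "u $ i \<le> y $ i" "y $ i < u $ i + int r"
      using * by (auto simp: lbox_def)
    then show ?thesis using \<open>0 < r\<close> by (simp add: of_nat_diff abs_le_iff)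
  qed
  then have "nm (x - y) \<le> r - 1" by (simp add: nm_le_iff)
  then show ?thesis using \<open>0 < r\<close> by simp
qed

section \<open>Sizes of spheres and radial power sums\<close>

lemma power_diff_le:
  fixes a b :: real
  assumes "0 \<le> b" "b \<le> a"
  shows "a ^ Suc n - b ^ Suc n \<le> real (Suc n) * (a - b) * a ^ n"
proof (induction n)
  case (Suc n)
  have "a ^ Suc (Suc n) - b ^ Suc (Suc n) = a * (a ^ Suc n - b ^ Suc n) + (a - b) * b ^ Suc n"
    by (simp add: algebra_simps)
  also have "\<dots> \<le> a * (real (Suc n) * (a - b) * a ^ n) + (a - b) * a ^ Suc n"
    using Suc assms by (intro add_mono mult_left_mono power_mono) auto
  finally show ?case by (simp add: algebra_simps)
qed simp

text \<open>From (2 * k + 1) ^ d - (2 * k - 1) ^ d \<le> 2 * d * (2 * k + 1) ^ (d - 1) and 2 * k + 1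
  \<le> 3 * k for k \<ge> 1.\<close>

definition shell_const :: "'n itself \<Rightarrow> real" where
  "shell_const _ = 2 * real CARD('n) * 3 ^ (CARD('n) - 1)"

lemma shell_const_pos: "0 < shell_const TYPE('n::finite)"
  by (simp add: shell_const_def)

lemma finite_shell: "finite {z :: int ^ 'n. nm (z - x) = k}"
  by (rule finite_subset[OF _ finite_nball[of x k]]) (auto simp: nball_def)

lemma card_shell:
  assumes "1 \<le> k"
  shows "real (card {z :: int ^ 'n. nm (z - x) = k}) \<le> shell_const TYPE('n) * real k ^ (CARD('n) - 1)"
proof -
  obtain n where n: "CARD('n) = Suc n" using not0_implies_Suc[of "CARD('n)"] by auto
  have "{z. nm (z - x) = k} = nball x k - nball x (k - 1)"
    using assms by (auto simp: nball_def)
  then have "card {z. nm (z - x) = k} = card (nball x k) - card (nball x (k - 1))"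
    using card_Diff_subset[OF finite_nball nball_mono[of "k - 1" k x]] by simp
  also have "\<dots> = (2 * k + 1) ^ Suc n - (2 * (k - 1) + 1) ^ Suc n"
    by (simp add: card_nball n del: power_Suc)
  finally have "real (card {z. nm (z - x) = k})
      = (2 * real k + 1) ^ Suc n - (2 * real k - 1) ^ Suc n"
    using assms power_mono[of "2 * (k - 1) + 1" "2 * k + 1" "Suc n"]
    by (simp add: of_nat_diff del: power_Suc) (simp add: algebra_simps)
  also have "\<dots> \<le> real (Suc n) * (2 * real k + 1 - (2 * real k - 1)) * (2 * real k + 1) ^ n"
    using assms by (intro power_diff_le) auto
  also have "\<dots> \<le> real (Suc n) * 2 * (3 * real k) ^ n"
    using assms power_mono[of "2 * real k + 1" "3 * real k" n] by (simp add: mult_left_mono)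
  finally show ?thesis by (simp add: shell_const_def n power_mult_distrib mult.assoc algebra_simps)
qed

lemma radial_sum_le:
  fixes x :: "int ^ 'n" and f :: "nat \<Rightarrow> real"
  assumes V: "finite V" "\<And>z. z \<in> V \<Longrightarrow> m \<le> nm (z - x) \<and> nm (z - x) \<le> N" and m: "1 \<le> m"
    and f: "\<And>k. 0 \<le> f k"
  shows "(\<Sum>z\<in>V. f (nm (z - x))) \<le> (\<Sum>k=m..N. shell_const TYPE('n) * real k ^ (CARD('n) - 1) * f k)"
proof -
  have "(\<Sum>z\<in>V. f (nm (z - x))) = (\<Sum>k=m..N. \<Sum>z\<in>{z\<in>V. nm (z - x) = k}. f (nm (z - x)))"
    using V by (intro sum.group[symmetric]) auto
  also have "\<dots> = (\<Sum>k=m..N. real (card {z\<in>V. nm (z - x) = k}) * f k)"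
    by (intro sum.cong) auto
  also have "\<dots> \<le> (\<Sum>k=m..N. shell_const TYPE('n) * real k ^ (CARD('n) - 1) * f k)"
  proof (intro sum_mono mult_right_mono f)
    fix k assume "k \<in> {m..N}"
    then have "1 \<le> k" using m by simp
    have "card {z\<in>V. nm (z - x) = k} \<le> card {z. nm (z - x) = k}"
      by (intro card_mono finite_shell) auto
    then show "real (card {z\<in>V. nm (z - x) = k}) \<le> shell_const TYPE('n) * real k ^ (CARD('n) - 1)"
      using card_shell[OF \<open>1 \<le> k\<close>, of x] by linarith
  qed
  finally show ?thesis .
qed

text \<open>Comparison of a sum with an integral, via the mean value theorem on [k - 1, k], in a
  form that telescopes.\<close>

lemma powr_step_ge:
  assumes "0 < a" "a < 1" "1 \<le> k"
  shows "real k powr (- a) \<le> (real k powr (1 - a) - real (k - 1) powr (1 - a)) / (1 - a)"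
proof (cases "k = 1")
  case True
  then show ?thesis using assms by (simp add: field_simps)
next
  case False
  have d: "((\<lambda>x. x powr (1 - a)) has_real_derivative (1 - a) * x powr (1 - a - 1)) (at x)"
    if "0 < x" for x :: real using that by (intro has_real_derivative_powr)
  obtain z where z: "real (k - 1) < z" "z < real k"
    "real k powr (1 - a) - real (k - 1) powr (1 - a) = (real k - real (k - 1)) * ((1 - a) * z powr (1 - a - 1))"
    using MVT2[of "real (k - 1)" "real k" "\<lambda>x. x powr (1 - a)" "\<lambda>x. (1 - a) * x powr (1 - a - 1)"]
      d assms False by force
  have "real k powr (- a) \<le> z powr (- a)"
    using z assms by (intro powr_mono2') auto
  then have "(1 - a) * real k powr (- a) \<le> (1 - a) * z powr (- a)"
    using assms by (intro mult_left_mono) auto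
  also have "\<dots> = real k powr (1 - a) - real (k - 1) powr (1 - a)"
    using z(3) assms by (simp add: of_nat_diff)
  finally show ?thesis using assms by (simp add: pos_le_divide_eq mult.commute)
qed

lemma sum_powr_le:
  assumes "0 < a" "a < 1"
  shows "(\<Sum>k=1..m. real k powr (- a)) \<le> real m powr (1 - a) / (1 - a)"
proof (induction m)
  case (Suc m)
  then show ?case using powr_step_ge[OF assms, of "Suc m"] by (simp add: diff_divide_distrib)
qed simp

lemma powr_step_tail:
  assumes "0 < a" "2 \<le> k"
  shows "real k powr (- 1 - a) \<le> (real (k - 1) powr (- a) - real k powr (- a)) / a"
proof -
  have d: "((\<lambda>x. x powr (- a)) has_real_derivative (- a) * x powr (- a - 1)) (at x)"
    if "0 < x" for x :: real using that by (intro has_real_derivative_powr)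
  obtain z where z: "real (k - 1) < z" "z < real k"
    "real k powr (- a) - real (k - 1) powr (- a) = (real k - real (k - 1)) * ((- a) * z powr (- a - 1))"
    using MVT2[of "real (k - 1)" "real k" "\<lambda>x. x powr (- a)" "\<lambda>x. (- a) * x powr (- a - 1)"]
      d assms by force
  have "real k powr (- a - 1) \<le> z powr (- a - 1)"
    using z assms by (intro powr_mono2') auto
  moreover have "- a - 1 = - 1 - a" by simp
  ultimately have "real k powr (- 1 - a) \<le> z powr (- a - 1)" by (simp only:)
  moreover have "real (k - 1) powr (- a) - real k powr (- a) = a * z powr (- a - 1)"
    using z(3) assms by (simp add: of_nat_diff)
  ultimately show ?thesis using assms by (simp add: field_simps)
qed

lemma sum_powr_tail_le:
  assumes "0 < a" "1 \<le> m"
  shows "(\<Sum>k=m..N. real k powr (- 1 - a)) \<le> (1 + 1 / a) * real m powr (- a)"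
proof (cases "m \<le> N")
  case True
  then have "(\<Sum>k=m..N. real k powr (- 1 - a))
      \<le> real m powr (- a) + (real m powr (- a) - real N powr (- a)) / a"
  proof (induction rule: dec_induct)
    case base
    then show ?case using assms by (auto intro!: powr_mono)
  next
    case (step n)
    then show ?case using powr_step_tail[OF assms(1), of "Suc n"] assms
      by (simp add: diff_divide_distrib)
  qed
  also have "\<dots> \<le> (1 + 1 / a) * real m powr (- a)"
    using assms by (simp add: field_simps)
  finally show ?thesis .
qed (use assms in simp)

lemma powr_dim: "1 \<le> k \<Longrightarrow> real k ^ (CARD('n::finite) - 1) * real k powr (- real CARD('n) - a) = real k powr (- 1 - a)"
proof -
  assume k: "1 \<le> k"
  have "real k ^ (CARD('n) - 1) = real k powr (real (CARD('n) - 1))"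
    using k by (intro powr_realpow[symmetric]) auto
  moreover have "real (CARD('n) - 1) = real CARD('n) - 1" by (simp add: of_nat_diff Suc_leI)
  ultimately show ?thesis by (simp add: powr_add[symmetric])
qed

lemma sum_far_le:
  fixes x :: "int ^ 'n"
  assumes "finite V" "\<And>z. z \<in> V \<Longrightarrow> m \<le> nm (z - x)" "1 \<le> m" "0 < a"
  shows "(\<Sum>z\<in>V. real (nm (z - x)) powr (- real CARD('n) - a))
    \<le> shell_const TYPE('n) * (1 + 1 / a) * real m powr (- a)"
proof -
  define N where "N = Max ((\<lambda>z. nm (z - x)) ` V)"
  have "(\<Sum>z\<in>V. real (nm (z - x)) powr (- real CARD('n) - a))
      \<le> (\<Sum>k=m..N. shell_const TYPE('n) * real k ^ (CARD('n) - 1) * real k powr (- real CARD('n) - a))"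
    using assms by (intro radial_sum_le[where f = "\<lambda>k. real k powr (- real CARD('n) - a)"]) (auto simp: N_def)
  also have "\<dots> = shell_const TYPE('n) * (\<Sum>k=m..N. real k powr (- 1 - a))"
    using assms powr_dim[where 'n = 'n] by (auto simp: sum_distrib_left mult.assoc intro!: sum.cong)
  also have "\<dots> \<le> shell_const TYPE('n) * ((1 + 1 / a) * real m powr (- a))"
    using shell_const_pos[where 'n = 'n] assms by (intro mult_left_mono sum_powr_tail_le) auto
  finally show ?thesis by (simp add: mult.assoc)
qed

text \<open>The entry point of \<alpha> < 1: in each shell the weight times the length is of order k
  powr (- \<alpha>), whose sum is governed by the largest \<open>k\<close>, so short edges are
  negligible at scale \<open>m\<close>.\<close>

lemma sum_near_le:
  fixes x :: "int ^ 'n"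
  assumes "finite V" "\<And>z. z \<in> V \<Longrightarrow> 1 \<le> nm (z - x) \<and> nm (z - x) \<le> m" "0 < a" "a < 1"
  shows "(\<Sum>z\<in>V. real (nm (z - x)) powr (- real CARD('n) - a) * real (nm (z - x)))
    \<le> shell_const TYPE('n) / (1 - a) * real m powr (1 - a)"
proof -
  have "(\<Sum>z\<in>V. real (nm (z - x)) powr (- real CARD('n) - a) * real (nm (z - x)))
      \<le> (\<Sum>k=1..m. shell_const TYPE('n) * real k ^ (CARD('n) - 1) * (real k powr (- real CARD('n) - a) * real k))"
    using assms by (intro radial_sum_le[where f = "\<lambda>k. real k powr (- real CARD('n) - a) * real k"]) auto
  also have "\<dots> = (\<Sum>k=1..m. shell_const TYPE('n) * real k powr (- a))"
  proof (intro sum.cong refl)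
    fix k assume "k \<in> {1..m}"
    then have k: "1 \<le> k" by simp
    have "real k powr (- 1 - a) * real k = real k powr (- a)"
      using powr_mult_base[of "real k" "- 1 - a"] by (simp add: mult.commute)
    then show "shell_const TYPE('n) * real k ^ (CARD('n) - 1) * (real k powr (- real CARD('n) - a) * real k)
        = shell_const TYPE('n) * real k powr (- a)"
      unfolding powr_dim[OF k, where 'n = 'n and a = a, symmetric] by simp
  qed
  also have "\<dots> = shell_const TYPE('n) * (\<Sum>k=1..m. real k powr (- a))"
    by (simp add: sum_distrib_left)
  also have "\<dots> \<le> shell_const TYPE('n) * (real m powr (1 - a) / (1 - a))"
    using shell_const_pos[where 'n = 'n] assms by (intro mult_left_mono sum_powr_le) auto
  finally show ?thesis by simp
qed

text \<open>The minimum bounds the number of spheres among \<open>h\<close> consecutive ones that an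
  edge can cross, see \<open>averaged_exit\<close>. Divided by \<open>h\<close>, the total is of
  order h powr (- \<alpha>).\<close>

lemma sum_min_le:
  fixes x :: "int ^ 'n"
  assumes V: "finite V" "x \<notin> V" and h: "1 \<le> h" and a: "0 < a" "a < 1"
  shows "(\<Sum>z\<in>V. real (nm (z - x)) powr (- real CARD('n) - a) * real (min (nm (z - x)) h))
    \<le> shell_const TYPE('n) * (1 + 1 / a + 1 / (1 - a)) * real h powr (1 - a)"
proof -
  let ?f = "\<lambda>z. real (nm (z - x)) powr (- real CARD('n) - a)"
  let ?N = "{z\<in>V. nm (z - x) \<le> h}" and ?F = "{z\<in>V. h < nm (z - x)}"
  have pos: "1 \<le> nm (z - x)" if "z \<in> V" for z
    using that V nm_eq_0_iff[of "z - x"] by (cases "nm (z - x)") auto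
  have "(\<Sum>z\<in>V. ?f z * real (min (nm (z - x)) h))
     = (\<Sum>z\<in>?N. ?f z * real (min (nm (z - x)) h)) + (\<Sum>z\<in>?F. ?f z * real (min (nm (z - x)) h))"
    using V by (subst sum.union_disjoint[symmetric]) (auto intro!: sum.cong)
  also have "(\<Sum>z\<in>?N. ?f z * real (min (nm (z - x)) h)) = (\<Sum>z\<in>?N. ?f z * real (nm (z - x)))"
    by (intro sum.cong) auto
  also have "\<dots> \<le> shell_const TYPE('n) / (1 - a) * real h powr (1 - a)"
    using V pos a by (intro sum_near_le) auto
  also have "(\<Sum>z\<in>?F. ?f z * real (min (nm (z - x)) h)) = (\<Sum>z\<in>?F. ?f z) * real h"
    by (auto simp: sum_distrib_right intro!: sum.cong)
  also have "\<dots> \<le> (shell_const TYPE('n) * (1 + 1 / a) * real h powr (- a)) * real h"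
    using V h a by (intro mult_right_mono sum_far_le) auto
  also have "\<dots> = shell_const TYPE('n) * (1 + 1 / a) * real h powr (1 - a)"
    using h by (simp add: powr_mult_base[symmetric] powr_diff powr_minus field_simps)
  finally show ?thesis by (simp add: algebra_simps)
qed

section \<open>Long-range kernels\<close>

text \<open>Outside \<open>edges\<close>, \<open>edge_prob\<close> is an unspecified description, hence the 0 there.\<close>

definition pr :: "('v \<Rightarrow> 'v \<Rightarrow> real) \<Rightarrow> 'v set \<Rightarrow> real" where
  "pr K e = (if e \<in> edges then edge_prob K 1 e else 0)"

text \<open>The kernel \<open>K\<close> stands for \<open>\<beta> J\<close>, so that \<open>a\<close> and \<open>b\<close> absorb the range of \<open>\<beta>\<close>. Since \<open>a = 0\<close> is
  allowed, \<open>long_range 0 b \<alpha>\<close> only expresses an upper bound.\<close>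

definition long_range :: "real \<Rightarrow> real \<Rightarrow> real \<Rightarrow> (int ^ 'n \<Rightarrow> int ^ 'n \<Rightarrow> real) \<Rightarrow> bool" where
  "long_range a b \<alpha> K \<longleftrightarrow> 0 \<le> a \<and> 0 \<le> b \<and> (\<forall>x y. 0 \<le> K x y \<and> K x y = K y x) \<and>
    (\<forall>x y z. K (x + z) (y + z) = K x y) \<and>
    (\<forall>x y. x \<noteq> y \<longrightarrow> a * real (nm (y - x)) powr (- real CARD('n) - \<alpha>) \<le> K x y \<and>
       K x y \<le> b * real (nm (y - x)) powr (- real CARD('n) - \<alpha>))"

lemma pair_in_edges: "x \<noteq> y \<Longrightarrow> {x, y} \<in> edges"
  by (auto simp: edges_def)

lemma pr_pair:
  assumes "long_range a b \<alpha> K" "x \<noteq> y"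
  shows "pr K {x, y} = 1 - exp (- K x y)"
proof -
  have "K u v = K v u" for u v using assms by (simp add: long_range_def)
  from edge_prob_pair[of K, OF this assms(2), where \<beta> = 1] show ?thesis
    using pair_in_edges[OF assms(2)] by (simp add: pr_def)
qed

lemma pvalid_pr: "long_range a b \<alpha> K \<Longrightarrow> pvalid (pr K)"
  unfolding pvalid_def
proof
  fix e assume K: "long_range a b \<alpha> K"
  show "0 \<le> pr K e \<and> pr K e \<le> 1"
  proof (cases "e \<in> edges")
    case True
    then obtain x y where e: "e = {x, y}" "x \<noteq> y" by (auto simp: edges_def)
    have "0 \<le> K x y" using K by (simp add: long_range_def)
    then show ?thesis unfolding e(1) pr_pair[OF K e(2)] by simp
  qed (simp add: pr_def)
qed

lemma pr_le:
  assumes "long_range a b \<alpha> (K :: int ^ 'n \<Rightarrow> int ^ 'n \<Rightarrow> real)" "x \<noteq> y"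
  shows "pr K {x, y} \<le> b * real (nm (y - x)) powr (- real CARD('n) - \<alpha>)"
proof -
  have "1 - exp (- K x y) \<le> K x y" using exp_ge_add_one_self[of "- K x y"] by linarith
  also have "\<dots> \<le> b * real (nm (y - x)) powr (- real CARD('n) - \<alpha>)"
    using assms by (simp add: long_range_def)
  finally show ?thesis using pr_pair[OF assms] by simp
qed

lemma pr_ge:
  assumes K: "long_range a b \<alpha> (K :: int ^ 'n \<Rightarrow> int ^ 'n \<Rightarrow> real)" "0 < \<alpha>" and xy: "x \<noteq> y" "nm (y - x) \<le> R"
  shows "1 - exp (- (a * real R powr (- real CARD('n) - \<alpha>))) \<le> pr K {x, y}"
proof -
  have "0 < nm (y - x)" using xy nm_eq_0_iff[of "y - x"] by auto
  then have "real R powr (- real CARD('n) - \<alpha>) \<le> real (nm (y - x)) powr (- real CARD('n) - \<alpha>)"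
    using xy K by (intro powr_mono2') auto
  then have "a * real R powr (- real CARD('n) - \<alpha>) \<le> a * real (nm (y - x)) powr (- real CARD('n) - \<alpha>)"
    using K by (intro mult_left_mono) (auto simp: long_range_def)
  also have "\<dots> \<le> K x y" using K xy by (simp add: long_range_def)
  finally show ?thesis using pr_pair[OF K(1) xy(1)] by simp
qed

lemma long_range_weaken: "long_range a b \<alpha> K \<Longrightarrow> 0 \<le> a' \<Longrightarrow> a' \<le> a \<Longrightarrow> b \<le> b' \<Longrightarrow> long_range a' b' \<alpha> K"
  unfolding long_range_def by (meson mult_right_mono order_trans powr_ge_zero)

subsection \<open>Translation invariance\<close>

lemma bex_reindex:
  assumes "inj_on F E"
  shows "bex p (F ` E) f = bex (\<lambda>e. p (F e)) E (\<lambda>w. f (F ` w))"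
proof -
  have inj: "inj_on ((`) F) (Pow E)" using assms by (rule inj_on_image_Pow)
  have "bex p (F ` E) f = (\<Sum>w\<in>(`) F ` Pow E. bwt p (F ` E) w * f w)"
    by (simp add: bex_def image_Pow_surj)
  also have "\<dots> = (\<Sum>w\<in>Pow E. bwt p (F ` E) (F ` w) * f (F ` w))"
    by (simp add: sum.reindex[OF inj])
  also have "\<dots> = (\<Sum>w\<in>Pow E. bwt (\<lambda>e. p (F e)) E w * f (F ` w))"
  proof (intro sum.cong refl)
    fix w assume "w \<in> Pow E"
    then have w: "w \<subseteq> E" by simp
    have "F ` E - F ` w = F ` (E - w)" using inj_on_image_set_diff[OF assms, of E w] w by auto
    moreover have "inj_on F w" "inj_on F (E - w)" using assms w by (auto intro: inj_on_subset)
    ultimately show "bwt p (F ` E) (F ` w) * f (F ` w) = bwt (\<lambda>e. p (F e)) E w * f (F ` w)"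
      by (simp add: bwt_def prod.reindex)
  qed
  finally show ?thesis by (simp add: bex_def)
qed

lemma cl_image:
  assumes "inj g"
  shows "cl ((`) g ` w) (g x) = g ` cl w x"
proof
  show "cl ((`) g ` w) (g x) \<subseteq> g ` cl w x"
  proof (rule cl_closedI)
    fix y z assume "y \<in> g ` cl w x" "{y, z} \<in> (`) g ` w"
    then obtain u e where u: "y = g u" "u \<in> cl w x" and e: "e \<in> w" "{y, z} = g ` e" by auto
    then obtain v where v: "z = g v" "v \<in> e" by auto
    have "g ` {u, v} = g ` e" using e u v by simp
    then have "{u, v} = e" using inj_image_eq_iff[OF assms, of "{u, v}" e] by blast
    then show "z \<in> g ` cl w x" using u v e cl_step[of u w x v] by auto
  qed simp
  show "g ` cl w x \<subseteq> cl ((`) g ` w) (g x)"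
  proof
    fix z assume "z \<in> g ` cl w x"
    then obtain y where y: "y \<in> cl w x" "z = g y" by auto
    have "g y \<in> cl ((`) g ` w) (g x)" using y(1)
    proof (induction rule: cl_induct)
      case (step y z)
      have "{g y, g z} \<in> (`) g ` w" using step.hyps by (intro image_eqI[of _ _ "{y, z}"]) auto
      with step.IH show ?case by (rule cl_step)
    qed simp
    then show "z \<in> cl ((`) g ` w) (g x)" using y by simp
  qed
qed

lemma ed_image:
  assumes "inj g"
  shows "ed (g ` V) = (`) g ` ed V"
proof (intro equalityI subsetI)
  fix e assume "e \<in> ed (g ` V)"
  then obtain x y where "e = {g x, g y}" "x \<in> V" "y \<in> V" "g x \<noteq> g y" by (auto simp: ed_def)
  then show "e \<in> (`) g ` ed V" by (intro image_eqI[of _ _ "{x, y}"]) (auto simp: ed_def)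
next
  fix e assume "e \<in> (`) g ` ed V"
  then obtain x y where "e = {g x, g y}" "x \<in> V" "y \<in> V" "x \<noteq> y" by (auto simp: ed_def)
  then show "e \<in> ed (g ` V)" using assms by (auto simp: inj_eq intro!: mem_edI)
qed

lemma bex_weight_cong:
  assumes "\<And>e. e \<in> E \<Longrightarrow> p e = q e"
  shows "bex p E f = bex q E f"
proof -
  have "bwt p E w = bwt q E w" if "w \<subseteq> E" for w
    unfolding bwt_def using assms that by (intro arg_cong2[where f = "(*)"] prod.cong) auto
  then show ?thesis unfolding bex_def by (intro sum.cong) auto
qed

lemma bex_translate:
  assumes K: "long_range a b \<alpha> K"
  shows "bex (pr K) (ed ((\<lambda>x. x + z) ` V)) f = bex (pr K) (ed V) (\<lambda>w. f ((`) (\<lambda>x. x + z) ` w))"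
proof -
  let ?g = "\<lambda>x. x + z"
  have inj: "inj ?g" by (simp add: inj_def)
  have "bex (pr K) ((`) ?g ` ed V) f = bex (\<lambda>e. pr K (?g ` e)) (ed V) (\<lambda>w. f ((`) ?g ` w))"
    by (intro bex_reindex) (auto simp: inj_on_def inj_image_eq_iff[OF inj])
  also have "\<dots> = bex (pr K) (ed V) (\<lambda>w. f ((`) ?g ` w))"
  proof (rule bex_weight_cong)
    fix e assume "e \<in> ed V"
    then obtain x y where e: "e = {x, y}" "x \<noteq> y" by (auto simp: ed_def)
    have "?g ` e = {x + z, y + z}" "x + z \<noteq> y + z" using e by auto
    moreover have "K (x + z) (y + z) = K x y" using K by (simp add: long_range_def)
    ultimately show "pr K (?g ` e) = pr K e"
      using pr_pair[OF K e(2)] pr_pair[OF K, of "x + z" "y + z"] e by simp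
  qed
  finally show ?thesis by (simp add: ed_image[OF inj])
qed

lemma tau_translate:
  assumes K: "long_range a b \<alpha> K"
  shows "tau (pr K) ((\<lambda>x. x + z) ` V) (x + z) (y + z) = tau (pr K) V x y"
proof -
  have inj: "inj (\<lambda>x. x + z)" by (simp add: inj_def)
  show ?thesis unfolding tau_def bex_translate[OF K]
    using cl_image[OF inj, of _ x] by (intro bex_cong) (auto simp: image_iff)
qed

lemma nball_translate: "(\<lambda>y. y + z) ` nball x m = nball (x + z) m"
proof (intro equalityI subsetI)
  fix y assume "y \<in> nball (x + z) m"
  then show "y \<in> (\<lambda>y. y + z) ` nball x m"
    by (intro image_eqI[of _ _ "y - z"]) (auto simp: nball_def algebra_simps)
qed (auto simp: nball_def)

lemma lbox_translate: "(\<lambda>y. y + z) ` lbox u r = lbox (u + z) r"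
proof (intro equalityI subsetI)
  fix y assume "y \<in> lbox (u + z) r"
  then show "y \<in> (\<lambda>y. y + z) ` lbox u r"
    by (intro image_eqI[of _ _ "y - z"]) (auto simp: lbox_def algebra_simps)
qed (auto simp: lbox_def)

text \<open>The connections themselves are confined to the ball. This makes the quantity continuous
  in \<beta>, and a lower bound for every larger volume.\<close>

definition ball_chi :: "(int ^ 'n \<Rightarrow> int ^ 'n \<Rightarrow> real) \<Rightarrow> nat \<Rightarrow> real" where
  "ball_chi K m = (\<Sum>y\<in>nball 0 m. tau (pr K) (nball 0 m) 0 y)"

lemma sum_tau_mono:
  assumes "pvalid p" "finite V" "S \<subseteq> V"
  shows "(\<Sum>y\<in>S. tau p S x y) \<le> (\<Sum>y\<in>V. tau p V x y)"
proof -
  have "(\<Sum>y\<in>S. tau p S x y) \<le> (\<Sum>y\<in>S. tau p V x y)"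
    using assms by (intro sum_mono tau_mono)
  also have "\<dots> \<le> (\<Sum>y\<in>V. tau p V x y)"
    using assms by (intro sum_mono2) (auto intro: tau_nonneg)
  finally show ?thesis .
qed

lemma ball_chi_center:
  assumes K: "long_range a b \<alpha> K"
  shows "(\<Sum>y\<in>nball x m. tau (pr K) (nball x m) x y) = ball_chi K m"
proof -
  have "(\<Sum>y\<in>nball x m. tau (pr K) (nball x m) x y)
      = (\<Sum>y\<in>(\<lambda>y. y + x) ` nball 0 m. tau (pr K) ((\<lambda>y. y + x) ` nball 0 m) (0 + x) y)"
    by (simp only: nball_translate add_0)
  also have "\<dots> = (\<Sum>y\<in>nball 0 m. tau (pr K) ((\<lambda>y. y + x) ` nball 0 m) (0 + x) (y + x))"
    by (subst sum.reindex) (auto simp: inj_on_def)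
  also have "\<dots> = ball_chi K m" unfolding ball_chi_def tau_translate[OF K] ..
  finally show ?thesis .
qed

lemma ball_chi_ge:
  assumes K: "long_range a b \<alpha> K" and S: "S \<subseteq> nball x m"
  shows "(\<Sum>y\<in>S. tau (pr K) S x y) \<le> ball_chi K m"
  using sum_tau_mono[OF pvalid_pr[OF K] finite_nball S, of x] ball_chi_center[OF K, of x m] by simp

lemma ball_chi_mono: "long_range a b \<alpha> K \<Longrightarrow> m \<le> m' \<Longrightarrow> ball_chi K m \<le> ball_chi K m'"
  using ball_chi_ge[of a b \<alpha> K "nball 0 m" 0 m'] nball_mono by (auto simp: ball_chi_def)

lemma ball_chi_ge_1:
  assumes K: "long_range a b \<alpha> K" shows "1 \<le> ball_chi K m"
proof -
  have "1 = tau (pr K) (nball 0 m) 0 0" using tau_self[OF finite_nball] by metis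
  also have "\<dots> \<le> ball_chi K m" unfolding ball_chi_def
    using tau_nonneg[OF pvalid_pr[OF K]] by (intro member_le_sum finite_nball) (auto simp: nball_def)
  finally show ?thesis .
qed

subsection \<open>Averaging the exit bound over radii\<close>

text \<open>The exit bound summed over the \<open>h\<close> radii in (h, 2 * h]: an edge can be the
  exit edge only for the radii that it crosses. \<open>M\<close> may depend on both ends of the
  edge, because short and long exit edges will need different bounds on the connection from
  \<open>x\<close> to \<open>u\<close>.\<close>

lemma averaged_exit:
  fixes K :: "int ^ 'n \<Rightarrow> int ^ 'n \<Rightarrow> real"
  assumes K: "long_range a b \<alpha> K" and V: "finite V" "x \<in> V" and h: "1 \<le> h"
    and M: "\<And>s u v. s \<in> {h<..2 * h} \<Longrightarrow> u \<in> V \<Longrightarrow> v \<in> V \<Longrightarrow> nm (u - x) \<le> s \<Longrightarrow> s < nm (v - x) \<Longrightarrow>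
      tau (pr K) (V \<inter> nball x s) x u \<le> M u v"
    and M0: "\<And>u v. 0 \<le> M u v"
  shows "real h * tau (pr K) V x y \<le> real h * tau (pr K) (V \<inter> nball x (2 * h)) x y
    + (\<Sum>u\<in>V \<inter> nball x (2 * h). \<Sum>v\<in>V - {u}. M u v *
        (b * (real (nm (v - u)) powr (- real CARD('n) - \<alpha>) * real (min (nm (v - u)) h))) * tau (pr K) V v y)"
proof -
  note p = pvalid_pr[OF K]
  let ?V2 = "V \<inter> nball x (2 * h)"
  define g where "g = (\<lambda>u v. M u v * (b * real (nm (v - u)) powr (- real CARD('n) - \<alpha>)) * tau (pr K) V v y)"
  have b0: "0 \<le> b" using K by (simp add: long_range_def)
  have g0: "0 \<le> g u v" for u v unfolding g_def
    by (intro mult_nonneg_nonneg M0 b0 tau_nonneg p) auto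
  have step: "tau (pr K) V x y \<le> tau (pr K) ?V2 x y
      + (\<Sum>u\<in>?V2. \<Sum>v\<in>V - {u}. of_bool (nm (u - x) \<le> s \<and> s < nm (v - x)) * g u v)"
    if s: "s \<in> {h<..2 * h}" for s
  proof -
    let ?S = "V \<inter> nball x s"
    have S2: "?S \<subseteq> ?V2" using s by (auto simp: nball_def)
    have "tau (pr K) V x y \<le> tau (pr K) ?S x y
      + (\<Sum>u\<in>?S. \<Sum>v\<in>V - ?S. tau (pr K) ?S x u * pr K {u, v} * tau (pr K) V v y)"
      using V by (intro tau_exit p) (auto simp: nball_def)
    also have "tau (pr K) ?S x y \<le> tau (pr K) ?V2 x y"
      using V S2 by (intro tau_mono p) auto
    also have "(\<Sum>u\<in>?S. \<Sum>v\<in>V - ?S. tau (pr K) ?S x u * pr K {u, v} * tau (pr K) V v y)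
      \<le> (\<Sum>u\<in>?S. \<Sum>v\<in>V - ?S. of_bool (nm (u - x) \<le> s \<and> s < nm (v - x)) * g u v)"
    proof (intro sum_mono)
      fix u v assume u: "u \<in> ?S" and v: "v \<in> V - ?S"
      then have uv: "nm (u - x) \<le> s" "s < nm (v - x)" "u \<noteq> v" by (auto simp: nball_def)
      have "tau (pr K) ?S x u * pr K {u, v} * tau (pr K) V v y \<le> g u v"
        unfolding g_def using u v uv p
        by (intro mult_mono M[OF s] pr_le[OF K] mult_nonneg_nonneg tau_nonneg M0 b0) (auto simp: pvalid_def)
      then show "tau (pr K) ?S x u * pr K {u, v} * tau (pr K) V v y
          \<le> of_bool (nm (u - x) \<le> s \<and> s < nm (v - x)) * g u v" using uv by simp
    qed
    also have "\<dots> \<le> (\<Sum>u\<in>?S. \<Sum>v\<in>V - {u}. of_bool (nm (u - x) \<le> s \<and> s < nm (v - x)) * g u v)"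
      using V g0 by (intro sum_mono sum_mono2) (auto simp: nball_def)
    also have "\<dots> \<le> (\<Sum>u\<in>?V2. \<Sum>v\<in>V - {u}. of_bool (nm (u - x) \<le> s \<and> s < nm (v - x)) * g u v)"
      using V g0 S2 by (intro sum_mono2 sum_nonneg) auto
    finally show ?thesis by simp
  qed
  \<comment> \<open>The radii crossed lie between nm (u - x) and nm (v - x), which differ by at most
    nm (v - u) by the triangle inequality; and there are only \<open>h\<close> radii in all.\<close>
  have cnt: "(\<Sum>s\<in>{h<..2 * h}. of_bool (nm (u - x) \<le> s \<and> s < nm (v - x))) \<le> real (min (nm (v - u)) h)" for u v
  proof -
    have "(\<Sum>s\<in>{h<..2 * h}. of_bool (nm (u - x) \<le> s \<and> s < nm (v - x)) :: real)
        = real (card {s \<in> {h<..2 * h}. nm (u - x) \<le> s \<and> s < nm (v - x)})"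
      by (simp add: of_bool_def sum.If_cases Int_def)
    moreover have "card {s \<in> {h<..2 * h}. nm (u - x) \<le> s \<and> s < nm (v - x)} \<le> card {nm (u - x)..<nm (v - x)}"
      by (intro card_mono) auto
    moreover have "card {s \<in> {h<..2 * h}. nm (u - x) \<le> s \<and> s < nm (v - x)} \<le> card {h<..2 * h}"
      by (intro card_mono) auto
    moreover have "nm (v - x) \<le> nm (v - u) + nm (u - x)" by (rule nm_triangle_diff)
    ultimately show ?thesis by simp
  qed
  have "real h * tau (pr K) V x y = (\<Sum>s\<in>{h<..2 * h}. tau (pr K) V x y)" by simp
  also have "\<dots> \<le> (\<Sum>s\<in>{h<..2 * h}. tau (pr K) ?V2 x y
      + (\<Sum>u\<in>?V2. \<Sum>v\<in>V - {u}. of_bool (nm (u - x) \<le> s \<and> s < nm (v - x)) * g u v))"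
    by (intro sum_mono step)
  also have "\<dots> = real h * tau (pr K) ?V2 x y
      + (\<Sum>s\<in>{h<..2 * h}. \<Sum>u\<in>?V2. \<Sum>v\<in>V - {u}. of_bool (nm (u - x) \<le> s \<and> s < nm (v - x)) * g u v)"
    by (simp add: sum.distrib)
  also have "(\<Sum>s\<in>{h<..2 * h}. \<Sum>u\<in>?V2. \<Sum>v\<in>V - {u}. of_bool (nm (u - x) \<le> s \<and> s < nm (v - x)) * g u v)
     = (\<Sum>u\<in>?V2. \<Sum>v\<in>V - {u}. (\<Sum>s\<in>{h<..2 * h}. of_bool (nm (u - x) \<le> s \<and> s < nm (v - x))) * g u v)"
    by (subst sum.swap, intro sum.cong refl, subst sum.swap) (simp add: sum_distrib_right)
  also have "\<dots> \<le> (\<Sum>u\<in>?V2. \<Sum>v\<in>V - {u}. real (min (nm (v - u)) h) * g u v)"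
    by (intro sum_mono mult_right_mono cnt g0)
  finally show ?thesis by (simp add: g_def mult_ac)
qed

section \<open>Large clusters in boxes force percolation\<close>

definition no_large :: "('v set \<Rightarrow> real) \<Rightarrow> 'v set \<Rightarrow> nat \<Rightarrow> real" where
  "no_large p V m = bex p (ed V) (\<lambda>w. of_bool (\<forall>v\<in>V. card (cl w v) < m))"

lemma no_large_nonneg: "pvalid p \<Longrightarrow> 0 \<le> no_large p V m"
  unfolding no_large_def by (intro bex_nonneg) auto

lemma no_large_eq: "finite V \<Longrightarrow> no_large p V m = 1 - max_cluster_tail p V m"
proof -
  assume V: "finite V"
  have "no_large p V m = bex p (ed V) (\<lambda>w. 1 - of_bool (\<exists>v\<in>V. m \<le> card (cl w v)))"
    unfolding no_large_def
  proof (rule bex_cong)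
    fix w
    have "(\<forall>v\<in>V. card (cl w v) < m) \<longleftrightarrow> \<not> (\<exists>v\<in>V. m \<le> card (cl w v))" by (simp add: not_le)
    then show "of_bool (\<forall>v\<in>V. card (cl w v) < m) = (1 - of_bool (\<exists>v\<in>V. m \<le> card (cl w v)) :: real)"
      by (simp only: of_bool_not_iff)
  qed
  then show ?thesis using V by (simp add: bex_diff bex_const finite_ed max_cluster_tail_def)
qed

lemma no_large_translate:
  assumes "long_range a b \<alpha> K"
  shows "no_large (pr K) ((\<lambda>x. x + z) ` V) m = no_large (pr K) V m"
proof -
  have inj: "inj (\<lambda>x. x + z)" by (simp add: inj_def)
  have "card ((\<lambda>x. x + z) ` A) = card A" for A by (intro card_image) (auto simp: inj_on_def)
  then show ?thesis unfolding no_large_def bex_translate[OF assms]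
    using cl_image[OF inj] by (intro bex_cong) simp
qed

lemma no_large_lbox: "long_range a b \<alpha> K \<Longrightarrow> no_large (pr K) (lbox u r) m = no_large (pr K) (lbox 0 r) m"
  using no_large_translate[of a b \<alpha> K u "lbox 0 r" m] by (simp add: lbox_translate)

lemma ed_disjoint: "V1 \<inter> V2 = {} \<Longrightarrow> ed V1 \<inter> ed V2 = {}"
  by (auto simp: ed_def doubleton_eq_iff)

lemma no_large_product:
  assumes p: "pvalid p" and V: "finite V" "V1 \<subseteq> V" "V2 \<subseteq> V" "V1 \<inter> V2 = {}"
  shows "bex p (ed V) (\<lambda>w. of_bool (\<forall>v\<in>V1. card (cl (w \<inter> ed V1) v) < m) *
      of_bool (\<forall>v\<in>V2. card (cl (w \<inter> ed V2) v) < m)) = no_large p V1 m * no_large p V2 m"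
  unfolding no_large_def
  using V by (intro bex_indep[where f = "\<lambda>w. of_bool (\<forall>v\<in>V1. card (cl w v) < m)"
    and g = "\<lambda>w. of_bool (\<forall>v\<in>V2. card (cl w v) < m)"] finite_ed ed_mono ed_disjoint)

text \<open>Passing to a subset only shrinks clusters, and disjoint subsets are independent.\<close>

lemma no_large_mult:
  assumes p: "pvalid p" and V: "finite V" "V1 \<subseteq> V" "V2 \<subseteq> V" "V1 \<inter> V2 = {}"
  shows "no_large p V m \<le> no_large p V1 m * no_large p V2 m"
proof -
  have le: "card (cl (w \<inter> ed S) v) \<le> card (cl w v)" if "w \<subseteq> ed V" for w S v
    using that V by (intro card_mono finite_cl cl_mono) auto
  show ?thesis unfolding no_large_product[OF assms, symmetric] unfolding no_large_def
  proof (intro bex_mono p)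
    fix w assume w: "w \<subseteq> ed V"
    have "(\<forall>v\<in>V1. card (cl (w \<inter> ed V1) v) < m) \<and> (\<forall>v\<in>V2. card (cl (w \<inter> ed V2) v) < m)"
      if "\<forall>v\<in>V. card (cl w v) < m"
      using that V(2,3) le[OF w] by (meson le_less_trans subsetD)
    then show "of_bool (\<forall>v\<in>V. card (cl w v) < m) \<le> of_bool (\<forall>v\<in>V1. card (cl (w \<inter> ed V1) v) < m) *
      (of_bool (\<forall>v\<in>V2. card (cl (w \<inter> ed V2) v) < m) :: real)"
      by simp
  qed
qed

text \<open>If at most one of the sets \<open>F i\<close> has no cluster of size \<open>m\<close> and the chosen clusters of any
  two others are joined by an edge, then these clusters form a single one.\<close>

lemma no_large_renormalise:
  fixes F :: "'i \<Rightarrow> 'v set"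
  assumes p: "pvalid p" and V: "finite V" and I: "finite I" "2 \<le> card I"
    and F: "\<And>i. i \<in> I \<Longrightarrow> F i \<subseteq> V" "\<And>i j. i \<in> I \<Longrightarrow> j \<in> I \<Longrightarrow> i \<noteq> j \<Longrightarrow> F i \<inter> F j = {}"
    and q: "\<And>i. i \<in> I \<Longrightarrow> no_large p (F i) m \<le> q"
    and k: "0 \<le> k" "\<And>i j x y. i \<in> I \<Longrightarrow> j \<in> I \<Longrightarrow> i \<noteq> j \<Longrightarrow> x \<in> F i \<Longrightarrow> y \<in> F j \<Longrightarrow> 1 - exp (- k) \<le> p {x, y}"
  shows "no_large p V ((card I - 1) * m) \<le> (real (card I))\<^sup>2 * (q\<^sup>2 + exp (- k * (real m)\<^sup>2))"
proof -
  define ok where "ok = (\<lambda>i w. \<exists>v\<in>F i. m \<le> card (cl w v))"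
  \<comment> \<open>The choice depends only on the configuration it is given. Applied to the edges
    inside \<open>F i\<close>, it keeps the chosen cluster independent of the other sets and of all
    edges between sets.\<close>
  define c where "c = (\<lambda>i w. SOME v. v \<in> F i \<and> m \<le> card (cl w v))"
  define C where "C = (\<lambda>i w. if ok i w then cl w (c i w) else {})"
  have c: "c i w \<in> F i" "m \<le> card (cl w (c i w))" if "ok i w" for i w
    using that someI_ex[of "\<lambda>v. v \<in> F i \<and> m \<le> card (cl w v)"] unfolding ok_def c_def by blast+
  have CF: "C i w \<subseteq> F i" if "w \<subseteq> ed (F i)" for i w
    using cl_subset'[OF that, of "c i w"] c[of i w] by (auto simp: C_def)
  have Cm: "m \<le> card (C i w)" if "ok i w" for i w using that c(2) by (simp add: C_def)
  define R where "R = (\<lambda>i w. w \<inter> ed (F i))"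
  \<comment> \<open>The two ways to fail: \<open>B i j\<close> means that two sets both lack a large
    cluster, \<open>D i j\<close> that two chosen large clusters are not joined by an edge.\<close>
  define B where "B = (\<lambda>i j w. of_bool (\<forall>v\<in>F i. card (cl (R i w) v) < m) *
      of_bool (\<forall>v\<in>F j. card (cl (R j w) v) < m) :: real)"
  define D where "D = (\<lambda>i j w. of_bool (ok i (R i w) \<and> ok j (R j w)) *
      of_bool (\<forall>x\<in>C i (R i w). \<forall>y\<in>C j (R j w). {x, y} \<notin> w) :: real)"
  have nn: "0 \<le> B i j w" "0 \<le> D i j w" for i j w by (auto simp: B_def D_def)
  have pt: "of_bool (\<forall>v\<in>V. card (cl w v) < (card I - 1) * m)
      \<le> (\<Sum>i\<in>I. \<Sum>j\<in>I - {i}. B i j w + D i j w)" if w: "w \<subseteq> ed V" for w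
  proof (rule ccontr)
    assume neg: "\<not> ?thesis"
    have S0: "0 \<le> (\<Sum>j\<in>I - {i}. B i j w + D i j w)" for i
      by (intro sum_nonneg add_nonneg_nonneg nn)
    have small: "\<And>v. v \<in> V \<Longrightarrow> card (cl w v) < (card I - 1) * m"
      and lt1: "(\<Sum>i\<in>I. \<Sum>j\<in>I - {i}. B i j w + D i j w) < 1"
      using neg sum_nonneg[of I "\<lambda>i. \<Sum>j\<in>I - {i}. B i j w + D i j w"] S0
      by (auto simp: of_bool_def split: if_splits)
    have zero: "B i j w = 0 \<and> D i j w = 0" if ij: "i \<in> I" "j \<in> I" "i \<noteq> j" for i j
    proof -
      have "B i j w + D i j w \<le> (\<Sum>j\<in>I - {i}. B i j w + D i j w)"
        using ij I nn by (intro member_le_sum) (auto intro: add_nonneg_nonneg)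
      also have "\<dots> \<le> (\<Sum>i\<in>I. \<Sum>j\<in>I - {i}. B i j w + D i j w)"
        using ij I S0 by (intro member_le_sum) auto
      finally have "B i j w + D i j w < 1" using lt1 by linarith
      then have "B i j w < 1" "D i j w < 1" using nn[of i j w] by linarith+
      then show ?thesis unfolding B_def D_def by (auto simp: of_bool_def split: if_splits)
    qed
    define G where "G = {i \<in> I. ok i (R i w)}"
    have "card (I - G) \<le> 1"
    proof (rule ccontr)
      assume "\<not> card (I - G) \<le> 1"
      then obtain i j where ij: "i \<in> I - G" "j \<in> I - G" "i \<noteq> j"
        using card_le_Suc0_iff_eq[of "I - G"] I by auto
      then have "B i j w = 1" unfolding B_def G_def ok_def by (auto simp: not_le)
      then show False using zero[of i j] ij by auto
    qed
    then have cG: "card I - 1 \<le> card G"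
      using card_Diff_subset[of G I] I by (auto simp: G_def)
    then have "G \<noteq> {}" using I by auto
    then obtain g where g: "g \<in> G" by blast
    let ?v = "c g (R g w)"
    have gI: "g \<in> I" "ok g (R g w)" using g by (auto simp: G_def)
    have vV: "?v \<in> V" using c(1)[OF gI(2)] F(1)[OF gI(1)] by auto
    \<comment> \<open>Merging is star-shaped: each chosen cluster is joined directly to that of
      \<open>g\<close>.\<close>
    have sub: "C i (R i w) \<subseteq> cl w ?v" if i: "i \<in> G" for i
    proof (cases "i = g")
      case True
      then show ?thesis using gI cl_mono[of "R g w" w ?v] by (auto simp: C_def R_def)
    next
      case False
      have iI: "i \<in> I" "ok i (R i w)" using i by (auto simp: G_def)
      have "D g i w = 0" using zero[of g i] gI iI False by simp
      then obtain x y where xy: "x \<in> C g (R g w)" "y \<in> C i (R i w)" "{x, y} \<in> w"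
        using gI iI unfolding D_def by (auto simp: of_bool_def split: if_splits)
      have "x \<in> cl w ?v" using xy(1) gI cl_mono[of "R g w" w ?v] by (auto simp: C_def R_def)
      then have y: "y \<in> cl w ?v" using xy(3) by (rule cl_step)
      have "y \<in> cl (R i w) (c i (R i w))" using xy(2) iI by (simp add: C_def)
      then have "cl (R i w) y = cl (R i w) (c i (R i w))" by (rule cl_eq)
      then have "cl (R i w) y = C i (R i w)" using iI by (simp add: C_def)
      then have "C i (R i w) \<subseteq> cl w y" using cl_mono[of "R i w" w y] by (auto simp: R_def)
      then show ?thesis using cl_eq[OF y] by simp
    qed
    have Rsub: "R i w \<subseteq> ed (F i)" for i by (auto simp: R_def)
    have finF: "finite (C i (R i w))" if "i \<in> G" for i
      using CF[OF Rsub, of i] F(1)[of i] V that by (auto simp: G_def intro: finite_subset)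
    have "(card I - 1) * m \<le> (\<Sum>i\<in>G. m)" using cG by (simp add: mult_le_mono1)
    also have "\<dots> \<le> (\<Sum>i\<in>G. card (C i (R i w)))"
      by (intro sum_mono Cm) (auto simp: G_def)
    also have "\<dots> = card (\<Union>i\<in>G. C i (R i w))"
    proof (intro card_UN_disjoint[symmetric] ballI impI)
      show "finite G" using I by (simp add: G_def)
      fix i j assume "i \<in> G" "j \<in> G" "i \<noteq> j"
      then have "F i \<inter> F j = {}" using F(2) by (auto simp: G_def)
      then show "C i (R i w) \<inter> C j (R j w) = {}" using CF[OF Rsub, of i] CF[OF Rsub, of j] by blast
    qed (use finF in auto)
    also have "\<dots> \<le> card (cl w ?v)"
      using sub w V by (intro card_mono finite_cl) auto
    finally show False using small[OF vV] by simp
  qed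
  have EB: "bex p (ed V) (B i j) \<le> q\<^sup>2" if ij: "i \<in> I" "j \<in> I" "i \<noteq> j" for i j
  proof -
    have "bex p (ed V) (B i j) = no_large p (F i) m * no_large p (F j) m"
      unfolding B_def R_def using no_large_product[OF p V F(1)[OF ij(1)] F(1)[OF ij(2)] F(2)[OF ij]] .
    also have "\<dots> \<le> q * q"
      using q ij no_large_nonneg[OF p] by (intro mult_mono) (auto intro: order_trans)
    finally show ?thesis by (simp add: power2_eq_square)
  qed
  have ED: "bex p (ed V) (D i j) \<le> exp (- k * (real m)\<^sup>2)" if ij: "i \<in> I" "j \<in> I" "i \<noteq> j" for i j
  proof -
    have fin: "finite (ed (F i))" "finite (ed (F j))"
      using F(1)[OF ij(1)] F(1)[OF ij(2)] V by (auto intro!: finite_ed intro: finite_subset)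
    have "bex p (ed V) (D i j) \<le> bex p (ed (F i)) (\<lambda>w1. bex p (ed (F j)) (\<lambda>w2.
        of_bool (ok i w1 \<and> ok j w2) * exp (- k * real (card (C i w1)) * real (card (C j w2)))))"
      unfolding D_def R_def
      by (intro bex_cross[OF p V F(1)[OF ij(1)] F(1)[OF ij(2)] F(2)[OF ij],
          where g = "\<lambda>w1 w2. of_bool (ok i w1 \<and> ok j w2)"] CF k(2)[OF ij]) auto
    also have "\<dots> \<le> bex p (ed (F i)) (\<lambda>w1. bex p (ed (F j)) (\<lambda>w2. exp (- k * (real m)\<^sup>2)))"
    proof (intro bex_mono p)
      fix w1 w2
      show "of_bool (ok i w1 \<and> ok j w2) * exp (- k * real (card (C i w1)) * real (card (C j w2)))
          \<le> exp (- k * (real m)\<^sup>2)"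
      proof (cases "ok i w1 \<and> ok j w2")
        case True
        then have "real m * real m \<le> real (card (C i w1)) * real (card (C j w2))"
          using Cm by (intro mult_mono) auto
        then show ?thesis using True k(1) by (simp add: power2_eq_square mult.assoc mult_left_mono)
      qed auto
    qed
    finally show ?thesis using fin by (simp add: bex_const)
  qed
  have q0: "0 \<le> q\<^sup>2 + exp (- k * (real m)\<^sup>2)" by (intro add_nonneg_nonneg) auto
  have "no_large p V ((card I - 1) * m) \<le> bex p (ed V) (\<lambda>w. \<Sum>i\<in>I. \<Sum>j\<in>I - {i}. B i j w + D i j w)"
    unfolding no_large_def by (intro bex_mono p pt)
  also have "\<dots> = (\<Sum>i\<in>I. \<Sum>j\<in>I - {i}. bex p (ed V) (B i j) + bex p (ed V) (D i j))"
    by (simp add: bex_sum bex_add)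
  also have "\<dots> \<le> (\<Sum>i\<in>I. \<Sum>j\<in>I - {i}. q\<^sup>2 + exp (- k * (real m)\<^sup>2))"
    using EB ED by (intro sum_mono add_mono) auto
  also have "\<dots> \<le> (\<Sum>i\<in>I. \<Sum>j\<in>I. q\<^sup>2 + exp (- k * (real m)\<^sup>2))"
    using I q0 by (intro sum_mono sum_mono2) auto
  also have "\<dots> = (real (card I))\<^sup>2 * (q\<^sup>2 + exp (- k * (real m)\<^sup>2))"
    by (simp add: power2_eq_square algebra_simps)
  finally show ?thesis .
qed

text \<open>A cube of side \<open>L * r\<close> is tiled by \<open>L ^ d\<close> cubes of side
  \<open>r\<close>. All distances in it are below \<open>L * r\<close>, which bounds all edge
  probabilities from below by a single value.\<close>

lemma no_large_lbox_step:
  fixes K :: "int ^ 'n \<Rightarrow> int ^ 'n \<Rightarrow> real"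
  assumes K: "long_range a b \<alpha> K" "0 < \<alpha>" and L: "2 \<le> L"
  shows "no_large (pr K) (lbox 0 (L * r)) ((L ^ CARD('n) - 1) * m)
    \<le> (real (L ^ CARD('n)))\<^sup>2 * ((no_large (pr K) (lbox 0 r) m)\<^sup>2
      + exp (- (a * real (L * r) powr (- real CARD('n) - \<alpha>)) * (real m)\<^sup>2))"
proof -
  define F where "F = (\<lambda>v :: int ^ 'n. lbox (\<chi> i. int r * v $ i) r)"
  have sub: "F v \<subseteq> lbox 0 (L * r)" if v: "v \<in> lbox 0 L" for v
  proof
    fix x assume x: "x \<in> F v"
    have "0 \<le> x $ i \<and> x $ i < int (L * r)" for i
    proof -
      have "v $ i < int L" using v by (simp add: lbox_def)
      then have vL: "v $ i + 1 \<le> int L" by simp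
      have *: "int r * v $ i \<le> x $ i" "x $ i < int r * v $ i + int r" "0 \<le> v $ i"
        using x v by (auto simp: F_def lbox_def)
      have "int r * (v $ i + 1) \<le> int r * int L" using vL by (intro mult_left_mono) auto
      then show ?thesis using * by (auto simp: algebra_simps intro: order_trans[of 0 "int r * v $ i"])
    qed
    then show "x \<in> lbox 0 (L * r)" by (simp add: lbox_def)
  qed
  have disj: "F u \<inter> F v = {}" if "u \<noteq> v" for u v
  proof (rule ccontr)
    assume "F u \<inter> F v \<noteq> {}"
    then obtain x where x: "x \<in> F u" "x \<in> F v" by blast
    have "u $ i = v $ i" for i
    proof -
      have *: "int r * u $ i \<le> x $ i" "x $ i < int r * u $ i + int r"
        "int r * v $ i \<le> x $ i" "x $ i < int r * v $ i + int r"
        using x by (auto simp: F_def lbox_def)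
      have "0 < int r" using *(1,2) by linarith
      have "int r * u $ i < int r * (v $ i + 1)" "int r * v $ i < int r * (u $ i + 1)"
        using * by (auto simp: algebra_simps)
      then have "u $ i < v $ i + 1" "v $ i < u $ i + 1" using \<open>0 < int r\<close> mult_less_cancel_left_pos by blast+
      then show ?thesis by simp
    qed
    then show False using that by (simp add: vec_eq_iff)
  qed
  have card2: "2 \<le> card (lbox 0 L :: (int ^ 'n) set)"
  proof -
    have "L \<le> L ^ CARD('n)" using L by (intro self_le_power) auto
    then show ?thesis using L by (simp add: card_lbox)
  qed
  have "no_large (pr K) (lbox 0 (L * r)) ((card (lbox 0 L :: (int ^ 'n) set) - 1) * m)
    \<le> (real (card (lbox 0 L :: (int ^ 'n) set)))\<^sup>2 * ((no_large (pr K) (lbox 0 r) m)\<^sup>2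
      + exp (- (a * real (L * r) powr (- real CARD('n) - \<alpha>)) * (real m)\<^sup>2))"
  proof (rule no_large_renormalise[where F = F and I = "lbox 0 L"])
    show "pvalid (pr K)" by (rule pvalid_pr[OF K(1)])
    show "no_large (pr K) (F i) m \<le> no_large (pr K) (lbox 0 r) m" for i
      unfolding F_def by (rule order.eq_iff[THEN iffD1, THEN conjunct1, OF no_large_lbox[OF K(1)]])
    show "0 \<le> a * real (L * r) powr (- real CARD('n) - \<alpha>)" using K by (simp add: long_range_def)
    fix i j x y assume *: "i \<in> lbox 0 L" "j \<in> lbox 0 L" "i \<noteq> j" "x \<in> F i" "y \<in> F j"
    then have "x \<noteq> y" "x \<in> lbox 0 (L * r)" "y \<in> lbox 0 (L * r)" using disj[of i j] sub by blast+
    then show "1 - exp (- (a * real (L * r) powr (- real CARD('n) - \<alpha>))) \<le> pr K {x, y}"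
      using lbox_diam[of y 0 "L * r" x] by (intro pr_ge[OF K]) auto
  qed (use card2 sub disj in \<open>auto intro: finite_lbox\<close>)
  then show ?thesis by (simp add: card_lbox)
qed

text \<open>An infinite cluster of the origin with positive probability, expressed by finite
  volumes; the point is that \<delta> precedes the size \<open>M\<close>.\<close>

definition percolates :: "(int ^ 'n \<Rightarrow> int ^ 'n \<Rightarrow> real) \<Rightarrow> bool" where
  "percolates K \<longleftrightarrow> (\<exists>\<delta>>0. \<forall>M. \<exists>N. \<delta> \<le> cluster_tail (pr K) (nball 0 N) 0 M)"

lemma cluster_tail_translate:
  assumes "long_range a b \<alpha> K"
  shows "cluster_tail (pr K) ((\<lambda>x. x + z) ` V) (x + z) m = cluster_tail (pr K) V x m"
proof -
  have inj: "inj (\<lambda>x. x + z)" by (simp add: inj_def)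
  have "card ((\<lambda>x. x + z) ` A) = card A" for A by (intro card_image) (auto simp: inj_on_def)
  then show ?thesis unfolding cluster_tail_def bex_translate[OF assms]
    using cl_image[OF inj] by (intro bex_cong) simp
qed

lemma cluster_tail_mono:
  assumes "pvalid p" "finite V" "S \<subseteq> V"
  shows "cluster_tail p S x m \<le> cluster_tail p V x m"
proof -
  have "cluster_tail p S x m = bex p (ed V) (\<lambda>w. of_bool (m \<le> card (cl (w \<inter> ed S) x)))"
    unfolding cluster_tail_def using bex_restrict[of "ed V" "ed S" p "\<lambda>w. of_bool (m \<le> card (cl w x))"] assms
    by (simp add: finite_ed ed_mono)
  also have "\<dots> \<le> cluster_tail p V x m" unfolding cluster_tail_def
  proof (intro bex_mono assms)
    fix w assume "w \<subseteq> ed V"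
    then have "card (cl (w \<inter> ed S) x) \<le> card (cl w x)"
      using assms by (intro card_mono finite_cl cl_mono) auto
    then show "of_bool (m \<le> card (cl (w \<inter> ed S) x)) \<le> (of_bool (m \<le> card (cl w x)) :: real)" by auto
  qed
  finally show ?thesis .
qed

text \<open>Double counting: a cluster with at least \<open>m\<close> vertices supplies
  \<open>m\<close> starting points with a large cluster. By translation each starting point in the
  cube is at most as likely to have one as the centre of a ball of radius \<open>r\<close>.\<close>

lemma cluster_tail_ge_of_no_large:
  fixes K :: "int ^ 'n \<Rightarrow> int ^ 'n \<Rightarrow> real"
  assumes K: "long_range a b \<alpha> K" and r: "1 \<le> r" and no_large: "no_large (pr K) (lbox 0 r) m \<le> 1 / 2"
  shows "real m / (2 * real r ^ CARD('n)) \<le> cluster_tail (pr K) (nball 0 r) 0 m"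
proof -
  let ?B = "lbox 0 r :: (int ^ 'n) set"
  note p = pvalid_pr[OF K]
  have "real m * (1 - no_large (pr K) ?B m) = real m * max_cluster_tail (pr K) ?B m" by (simp add: no_large_eq finite_lbox)
  also have "\<dots> = bex (pr K) (ed ?B) (\<lambda>w. real m * of_bool (\<exists>v\<in>?B. m \<le> card (cl w v)))"
    by (simp add: max_cluster_tail_def bex_cmult)
  also have "\<dots> \<le> bex (pr K) (ed ?B) (\<lambda>w. \<Sum>u\<in>?B. of_bool (m \<le> card (cl w u)))"
  proof (intro bex_mono p)
    fix w assume w: "w \<subseteq> ed ?B"
    show "real m * of_bool (\<exists>v\<in>?B. m \<le> card (cl w v)) \<le> (\<Sum>u\<in>?B. of_bool (m \<le> card (cl w u)))"
    proof (cases "\<exists>v\<in>?B. m \<le> card (cl w v)")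
      case True
      then obtain v where v: "v \<in> ?B" "m \<le> card (cl w v)" by blast
      have "real m \<le> (\<Sum>u\<in>cl w v. of_bool (m \<le> card (cl w u)))"
      proof -
        have "(\<Sum>u\<in>cl w v. of_bool (m \<le> card (cl w u)) :: real) = (\<Sum>u\<in>cl w v. 1)"
        proof (intro sum.cong refl)
          fix u assume "u \<in> cl w v"
          from cl_eq[OF this] show "of_bool (m \<le> card (cl w u)) = (1::real)" using v by simp
        qed
        then show ?thesis using v by simp
      qed
      also have "\<dots> \<le> (\<Sum>u\<in>?B. of_bool (m \<le> card (cl w u)))"
        using cl_subset'[OF w v(1)] by (intro sum_mono2) (auto intro: finite_lbox)
      finally show ?thesis using True by simp
    qed (auto intro: sum_nonneg)
  qed
  also have "\<dots> = (\<Sum>u\<in>?B. cluster_tail (pr K) ?B u m)" by (simp add: bex_sum cluster_tail_def)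
  also have "\<dots> \<le> (\<Sum>u\<in>?B. cluster_tail (pr K) (nball 0 r) 0 m)"
  proof (intro sum_mono)
    fix u assume u: "u \<in> ?B"
    have "?B \<subseteq> nball u r" using lbox_diam[OF _ u] by (auto simp: nball_def less_imp_le)
    then have "cluster_tail (pr K) ?B u m \<le> cluster_tail (pr K) (nball u r) u m"
      by (intro cluster_tail_mono p finite_nball)
    also have "\<dots> = cluster_tail (pr K) (nball 0 r) 0 m"
      using cluster_tail_translate[OF K, of u "nball 0 r" 0 m] by (simp add: nball_translate)
    finally show "cluster_tail (pr K) ?B u m \<le> cluster_tail (pr K) (nball 0 r) 0 m" .
  qed
  also have "\<dots> = real r ^ CARD('n) * cluster_tail (pr K) (nball 0 r) 0 m" by (simp add: card_lbox)
  finally have "real m * (1 - no_large (pr K) ?B m) \<le> real r ^ CARD('n) * cluster_tail (pr K) (nball 0 r) 0 m" .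
  moreover have "real m * (1 / 2) \<le> real m * (1 - no_large (pr K) ?B m)"
    using no_large by (intro mult_left_mono) auto
  ultimately have "real m / 2 \<le> real r ^ CARD('n) * cluster_tail (pr K) (nball 0 r) 0 m" by simp
  then show ?thesis using r by (simp add: field_simps)
qed

text \<open>The ratio \<open>2 ^ (k + 3)\<close> of consecutive scales grows with \<open>k\<close>, so that giving up one subbox per step
  leaves clusters of positive density.\<close>

definition box_scale :: "nat \<Rightarrow> nat" where
  "box_scale k = (\<Prod>j<k. 2 ^ (j + 3))"

lemma box_scale_Suc: "box_scale (Suc k) = 2 ^ (k + 3) * box_scale k"
  by (simp add: box_scale_def mult.commute)

lemma box_scale_pos: "0 < box_scale k"
  by (simp add: box_scale_def prod_pos)

lemma box_scale_ge: "2 powr ((real k)\<^sup>2 / 2) \<le> real (box_scale k)"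
proof (induction k)
  case (Suc k)
  have "2 powr ((real (Suc k))\<^sup>2 / 2) \<le> 2 powr (real (k + 3) + (real k)\<^sup>2 / 2)"
    by (intro powr_mono) (auto simp: power2_eq_square field_simps)
  also have "\<dots> = 2 ^ (k + 3) * 2 powr ((real k)\<^sup>2 / 2)"
    by (simp only: powr_add powr_realpow[of 2 "k + 3"])
  also have "\<dots> \<le> 2 ^ (k + 3) * real (box_scale k)"
    using Suc by (intro mult_left_mono) auto
  finally show ?case by (simp add: box_scale_Suc)
qed (simp add: box_scale_def)

lemma box_scale_ge_exp: "2 ^ k \<le> box_scale k"
proof (induction k)
  case (Suc k)
  have "(2::nat) ^ Suc k \<le> 2 ^ (k + 3) * 2 ^ k"
    unfolding power_add[symmetric] by (intro power_increasing) auto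
  also have "\<dots> \<le> 2 ^ (k + 3) * box_scale k" using Suc by (intro mult_left_mono) auto
  finally show ?case by (simp add: box_scale_Suc)
qed (simp add: box_scale_def)

text \<open>Since \<open>box_scale k\<close> is at least 2 powr (k ^ 2 / 2), any power of the ratio
  of consecutive scales, even with a linear prefactor, is negligible against every positive power of
  the scale itself.\<close>

lemma growth_constant:
  fixes s t c1 c2 :: real
  assumes "0 < t"
  obtains E where "0 < E" "\<And>k. (c1 + c2 * real k) * (2 ^ (k + 3)) powr s \<le> E * real (box_scale k) powr t"
proof -
  let ?f = "\<lambda>k::nat. (c1 + c2 * real k) * 2 powr ((real k + 3) * s - t * (real k)\<^sup>2 / 2)"
  have "?f \<longlonglongrightarrow> 0" using assms by real_asymp
  then have "Bseq ?f" by (intro convergent_imp_Bseq convergentI)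
  then obtain E where E: "0 < E" "\<And>k. norm (?f k) \<le> E" by (auto simp: Bseq_def)
  have "(c1 + c2 * real k) * (2 ^ (k + 3)) powr s \<le> E * real (box_scale k) powr t" for k
  proof -
    have "(2 ^ (k + 3)) powr s = 2 powr ((real k + 3) * s)"
    proof -
      have "(2::real) ^ (k + 3) = 2 powr (real (k + 3))" by (rule powr_realpow[symmetric]) simp
      then show ?thesis by (simp add: powr_powr algebra_simps)
    qed
    then have "(c1 + c2 * real k) * (2 ^ (k + 3)) powr s = ?f k * 2 powr (t * (real k)\<^sup>2 / 2)"
      by (simp add: powr_diff)
    also have "\<dots> \<le> E * 2 powr (t * (real k)\<^sup>2 / 2)"
      using E(2)[of k] by (intro mult_right_mono) auto
    also have "2 powr (t * (real k)\<^sup>2 / 2) = (2 powr ((real k)\<^sup>2 / 2)) powr t"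
      by (simp add: powr_powr mult.commute)
    also have "\<dots> \<le> real (box_scale k) powr t"
      using assms by (intro powr_mono2 box_scale_ge) auto
    finally show ?thesis using E by (simp add: mult_left_mono)
  qed
  then show ?thesis using E(1) that by blast
qed

fun cluster_scale :: "nat \<Rightarrow> nat \<Rightarrow> nat \<Rightarrow> nat" where
  "cluster_scale d m 0 = m"
| "cluster_scale d m (Suc k) = ((2 ^ (k + 3)) ^ d - 1) * cluster_scale d m k"

text \<open>The guaranteed density decreases from 1 towards 1 / 2. Its excess \<open>h\<close> over
  1 / 2 is halved at each step, and because h * N \<ge> 2 this covers the loss of one subbox out of
  \<open>N\<close>.\<close>

lemma cluster_scale_ge:
  assumes "1 \<le> d"
  shows "(1 / 2 + (1 / 2) ^ (k + 1)) * real (box_scale k) ^ d * real m \<le> real (cluster_scale d m k)"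
proof (induction k)
  case (Suc k)
  define N where "N = ((2::real) ^ (k + 3)) ^ d"
  have N: "(2::real) ^ (k + 3) \<le> N" unfolding N_def using assms by (intro self_le_power) auto
  have "1 \<le> N" using N one_le_power[of "2::real" "k + 3"] by linarith
  then have N1: "real ((2 ^ (k + 3)) ^ d - 1) = N - 1" by (simp add: N_def of_nat_diff)
  define h where "h = (1 / 2 :: real) ^ (k + 1)"
  have h: "0 \<le> h" "h \<le> 1 / 2" unfolding h_def using power_le_one[of "1/2::real" k] by auto
  have hN: "2 \<le> h * N"
  proof -
    have "h * 2 ^ (k + 3) = 4" by (simp add: h_def power_add power_divide)
    moreover have "h * 2 ^ (k + 3) \<le> h * N" using N h by (intro mult_left_mono) auto
    ultimately show ?thesis by linarith
  qed
  have "(1 / 2 + h / 2) * N \<le> (1 / 2 + h) * (N - 1)"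
  proof -
    have "(1 / 2 + h) * (N - 1) - (1 / 2 + h / 2) * N = h * N / 2 - h - 1 / 2" by (simp add: field_simps)
    then show ?thesis using hN h by linarith
  qed
  then have "(1 / 2 + h / 2) * N * (real (box_scale k) ^ d * real m) \<le> (1 / 2 + h) * (N - 1) * (real (box_scale k) ^ d * real m)"
    by (intro mult_right_mono) auto
  also have "\<dots> = (N - 1) * ((1 / 2 + h) * real (box_scale k) ^ d * real m)" by (simp add: mult_ac)
  also have "\<dots> \<le> (N - 1) * real (cluster_scale d m k)"
    using Suc \<open>1 \<le> N\<close> by (intro mult_left_mono) (auto simp: h_def)
  finally show ?case
    using N1 by (simp add: box_scale_Suc N_def h_def power_mult_distrib mult_ac)
qed (simp add: box_scale_def)

text \<open>With N_k subboxes in step \<open>k\<close>, the failure probability is kept below N_k ^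
  -4: squaring it and paying N_k ^ 2 for the pairs leaves N_k ^ -6, more than enough since N_k grows
  by the fixed factor 2 ^ d. Unmerged clusters cost exp (- X), where \<open>X\<close> grows like
  \<open>box_scale k\<close> to the power d - \<alpha> up to the ratio of scales. The initial bound
  is the case k = 0, with 8 ^ d subboxes.\<close>

lemma percolation_criterion:
  assumes \<alpha>: "0 < \<alpha>" "\<alpha> < real CARD('n::finite)"
  obtains E where "0 < E" "\<And>a b (K :: int ^ 'n \<Rightarrow> int ^ 'n \<Rightarrow> real) r m. long_range a b \<alpha> K \<Longrightarrow> 1 \<le> r \<Longrightarrow> 1 \<le> m \<Longrightarrow>
    E * real r powr (real CARD('n) + \<alpha>) \<le> a * (real m)\<^sup>2 \<Longrightarrow>
    no_large (pr K) (lbox 0 r) m \<le> 1 / (8 ^ CARD('n)) ^ 4 \<Longrightarrow> percolates K"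
proof -
  define d where "d = CARD('n)"
  have d1: "1 \<le> d" by (simp add: d_def Suc_leI)
  \<comment> \<open>Chosen so that exp (- Y k) is \<open>1 / (2 * D ^ 4 * N k ^ 6)\<close>, half of
    the failure probability that the induction step may produce, before the factor
    \<open>(N k)\<^sup>2\<close>.\<close>
  define Y where "Y = (\<lambda>k. (1 + 4 * real d + 6 * real d * (real k + 3)) * ln 2)"
  \<comment> \<open>The factor 4 compensates the cluster density 1 / 2, which enters the number of
    potential edges squared. The exponent d - \<alpha> is what clusters of volume order leave after
    the decay of the kernel.\<close>
  obtain E0 where E0: "0 < E0" "\<And>k. (4 * (1 + 4 * real d + 18 * real d) * ln 2 + (24 * real d * ln 2) * real k) *
      (2 ^ (k + 3)) powr (real d + \<alpha>) \<le> E0 * real (box_scale k) powr (real d - \<alpha>)"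
    using growth_constant[of "real d - \<alpha>" "4 * (1 + 4 * real d + 18 * real d) * ln 2" "24 * real d * ln 2" "real d + \<alpha>"]
      \<alpha> unfolding d_def by auto
  have YE: "4 * Y k * (2 ^ (k + 3)) powr (real d + \<alpha>) \<le> E0 * real (box_scale k) powr (real d - \<alpha>)" for k
    using E0(2)[of k] by (simp add: Y_def algebra_simps)
  have main: "percolates K"
    if K: "long_range a b \<alpha> K" and rm: "1 \<le> r" "1 \<le> m"
      and am: "E0 * real r powr (real d + \<alpha>) \<le> a * (real m)\<^sup>2"
      and b0: "no_large (pr K) (lbox 0 r) m \<le> 1 / (8 ^ d) ^ 4"
    for a b and K :: "int ^ 'n \<Rightarrow> int ^ 'n \<Rightarrow> real" and r m
  proof -
    define M where "M = cluster_scale d m"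
    define N where "N = (\<lambda>k. ((2::real) ^ (k + 3)) ^ d)"
    define D where "D = (2::real) ^ d"
    have D2: "2 \<le> D" unfolding D_def using self_le_power[of "2::real" d] d1 by simp
    have ND: "D ^ 3 \<le> N k" for k
    proof -
      have "(2::real) ^ 3 \<le> 2 ^ (k + 3)" by (intro power_increasing) auto
      then have "((2::real) ^ 3) ^ d \<le> N k" unfolding N_def by (intro power_mono) auto
      moreover have "((2::real) ^ 3) ^ d = D ^ 3"
        unfolding D_def by (simp only: power_mult[symmetric] mult.commute)
      ultimately show ?thesis by simp
    qed
    have D3: "8 \<le> D ^ 3" using power_mono[OF D2, of 3] by simp
    have N8: "8 \<le> N k" for k using ND[of k] D3 by linarith
    have NS: "N (Suc k) = D * N k" for k
      unfolding N_def D_def by (simp only: power_mult_distrib[symmetric] add_Suc power_Suc)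
    have Mge: "real (box_scale k) ^ d * real m / 2 \<le> real (M k)" for k
    proof -
      have "1 / 2 * (real (box_scale k) ^ d * real m) \<le> (1 / 2 + (1 / 2) ^ (k + 1)) * (real (box_scale k) ^ d * real m)"
        by (intro mult_right_mono) auto
      also have "\<dots> \<le> real (M k)" using cluster_scale_ge[OF d1, of k m] by (simp add: M_def mult.assoc)
      finally show ?thesis by simp
    qed
    have bound: "no_large (pr K) (lbox 0 (r * box_scale k)) (M k) \<le> 1 / N k ^ 4" for k
    proof (induction k)
      case 0
      then show ?case using b0 by (simp add: box_scale_def M_def N_def)
    next
      case (Suc k)
      let ?L = "2 ^ (k + 3) :: nat" and ?R = "real (r * box_scale k)"
      define X where "X = a * real (?L * (r * box_scale k)) powr (- real d - \<alpha>) * (real (M k))\<^sup>2"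
      have rr: "r * box_scale (Suc k) = ?L * (r * box_scale k)" by (simp add: box_scale_Suc mult_ac)
      have MS: "M (Suc k) = (?L ^ CARD('n) - 1) * M k" by (simp add: M_def d_def)
      have L2: "2 \<le> ?L" using power_increasing[of 1 "k + 3" "2::nat"] by simp
      have "no_large (pr K) (lbox 0 (r * box_scale (Suc k))) (M (Suc k))
        \<le> (N k)\<^sup>2 * ((no_large (pr K) (lbox 0 (r * box_scale k)) (M k))\<^sup>2 + exp (- X))"
        unfolding rr MS X_def N_def d_def using no_large_lbox_step[OF K \<alpha>(1) L2, of "r * box_scale k" "M k"] by simp
      also have "\<dots> \<le> (N k)\<^sup>2 * ((1 / N k ^ 4)\<^sup>2 + 1 / (2 * D ^ 4 * N k ^ 6))"
      proof (intro mult_left_mono add_mono power_mono Suc no_large_nonneg pvalid_pr[OF K])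
        have "Y k \<le> X"
        proof -
          have rho0: "0 < real (box_scale k)" using box_scale_pos by simp
          have r0: "0 < real r" using rm by simp
          have "Y k * 4 * ?L powr (real d + \<alpha>) \<le> E0 * real (box_scale k) powr (real d - \<alpha>)"
            using YE[of k] by (simp add: mult_ac)
          then have "Y k \<le> E0 * real (box_scale k) powr (real d - \<alpha>) / (4 * real ?L powr (real d + \<alpha>))"
            by (simp add: field_simps)
          also have "\<dots> = E0 * real r powr (real d + \<alpha>) * (real (box_scale k) ^ d)\<^sup>2 / 4
              * real (?L * (r * box_scale k)) powr (- real d - \<alpha>)"
          proof -
            have 1: "real (box_scale k) powr (real d - \<alpha>) = (real (box_scale k) ^ d)\<^sup>2 * real (box_scale k) powr (- real d - \<alpha>)"
            proof -
              have "(real (box_scale k) ^ d)\<^sup>2 = real (box_scale k) powr (real d + real d)"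
                unfolding powr_realpow[OF rho0, symmetric] by (simp only: power2_eq_square powr_add)
              then show ?thesis by (simp add: powr_add[symmetric])
            qed
            have 2: "real (?L * (r * box_scale k)) powr (- real d - \<alpha>)
              = real ?L powr (- real d - \<alpha>) * (real r powr (- real d - \<alpha>) * real (box_scale k) powr (- real d - \<alpha>))"
              by (simp add: powr_mult)
            have 3: "real r powr (real d + \<alpha>) * real r powr (- real d - \<alpha>) = 1"
              using r0 by (simp add: powr_add[symmetric])
            have 4: "real ?L powr (- real d - \<alpha>) = 1 / real ?L powr (real d + \<alpha>)"
              using powr_minus[of "real ?L" "real d + \<alpha>"] by (simp add: divide_inverse)
            show ?thesis unfolding 1 2 4
              using 3 by (simp add: field_simps)
          qed
          also have "\<dots> \<le> a * (real m)\<^sup>2 * (real (box_scale k) ^ d)\<^sup>2 / 4 * real (?L * (r * box_scale k)) powr (- real d - \<alpha>)"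
            by (intro mult_right_mono divide_right_mono am) auto
          also have "\<dots> = a * real (?L * (r * box_scale k)) powr (- real d - \<alpha>) * (real (box_scale k) ^ d * real m / 2)\<^sup>2"
            by (simp add: power_mult_distrib power_divide mult_ac)
          also have "\<dots> \<le> X" unfolding X_def
            using K by (intro mult_left_mono power_mono Mge mult_nonneg_nonneg) (auto simp: long_range_def)
          finally show ?thesis .
        qed
        then have "exp (- X) \<le> exp (- Y k)" by simp
        also have "exp (- Y k) = 1 / (2 * D ^ 4 * N k ^ 6)"
        proof -
          have "Y k = real (1 + 4 * d + 6 * d * (k + 3)) * ln 2" by (simp add: Y_def algebra_simps)
          then have "exp (Y k) = exp (ln 2) ^ (1 + 4 * d + 6 * d * (k + 3))"
            by (simp only: exp_of_nat_mult)
          also have "\<dots> = 2 ^ (1 + 4 * d + 6 * d * (k + 3))" by simp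
          also have "\<dots> = 2 * D ^ 4 * N k ^ 6"
          proof -
            have "N k ^ 6 = 2 ^ (6 * d * (k + 3))" "D ^ 4 = 2 ^ (4 * d)"
              unfolding N_def D_def by (simp_all only: power_mult[symmetric] mult_ac)
            then show ?thesis by (simp only: power_add power_one_right)
          qed
          finally have "exp (Y k) = 2 * D ^ 4 * N k ^ 6" .
          then show ?thesis by (simp only: exp_minus inverse_eq_divide)
        qed
        finally show "exp (- X) \<le> 1 / (2 * D ^ 4 * N k ^ 6)" .
      qed auto
      also have "\<dots> \<le> 1 / N (Suc k) ^ 4"
      proof -
        have N0: "0 < N k" using N8[of k] by linarith
        have D0: "0 < D" using D2 by linarith
        have "2 * D ^ 4 \<le> (N k)\<^sup>2"
        proof -
          have "2 * D ^ 4 \<le> (D * D) * D ^ 4" using D2 mult_mono[OF D2 D2] by (intro mult_right_mono) auto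
          also have "\<dots> = (D ^ 3)\<^sup>2" by (simp add: power2_eq_square eval_nat_numeral)
          also have "\<dots> \<le> (N k)\<^sup>2" using ND[of k] D0 by (intro power_mono) auto
          finally show ?thesis .
        qed
        then have "1 / (N k)\<^sup>2 \<le> 1 / (2 * D ^ 4)" using D0 N0 by (intro divide_left_mono) auto
        then have "1 / N k ^ 4 * (1 / (N k)\<^sup>2) \<le> 1 / N k ^ 4 * (1 / (2 * D ^ 4))"
          using N0 by (intro mult_left_mono) auto
        moreover have "(N k)\<^sup>2 * ((1 / N k ^ 4)\<^sup>2 + 1 / (2 * D ^ 4 * N k ^ 6))
          = 1 / N k ^ 4 * (1 / (N k)\<^sup>2) + 1 / N k ^ 4 * (1 / (2 * D ^ 4))"
          using N0 D0 by (simp add: field_simps eval_nat_numeral)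
        moreover have "1 / N (Suc k) ^ 4 = 1 / N k ^ 4 * (1 / (2 * D ^ 4)) + 1 / N k ^ 4 * (1 / (2 * D ^ 4))"
          unfolding NS using N0 D0 by (simp add: field_simps)
        ultimately show ?thesis by (simp only: add_le_cancel_right)
      qed
      finally show ?case .
    qed
    \<comment> \<open>At scale \<open>k\<close> the guaranteed cluster size \<open>M k\<close>,
      divided by twice the volume of the box, is at least this value, whatever \<open>k\<close>
      is.\<close>
    define \<delta> where "\<delta> = real m / (4 * real r ^ d)"
    have "0 < \<delta>" using rm by (simp add: \<delta>_def)
    moreover have "\<exists>R. \<delta> \<le> cluster_tail (pr K) (nball 0 R) 0 T" for T
    proof -
      \<comment> \<open>\<open>M k\<close> is at least half of \<open>box_scale k\<close>, hence at
        least k / 2 = T.\<close>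
      define k where "k = 2 * T"
      let ?R = "r * box_scale k"
      have "no_large (pr K) (lbox 0 ?R) (M k) \<le> 1 / N k ^ 4" by (rule bound)
      also have "\<dots> \<le> 1 / 8 ^ 4" using N8[of k] by (intro divide_left_mono power_mono) auto
      finally have "no_large (pr K) (lbox 0 ?R) (M k) \<le> 1 / 2" by simp
      moreover have "1 \<le> ?R" using rm box_scale_pos[of k] by (simp add: Suc_leI)
      ultimately have "real (M k) / (2 * real ?R ^ CARD('n)) \<le> cluster_tail (pr K) (nball 0 ?R) 0 (M k)"
        by (intro cluster_tail_ge_of_no_large[OF K]) auto
      also have "\<dots> \<le> cluster_tail (pr K) (nball 0 ?R) 0 T"
      proof -
        have "real T \<le> real (M k)"
        proof -
          have "k < 2 ^ k" by (rule less_exp)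
          then have "k \<le> box_scale k" using box_scale_ge_exp[of k] by linarith
          also have "\<dots> \<le> box_scale k ^ d" using box_scale_pos[of k] d1 by (intro self_le_power) auto
          finally have "real k \<le> real (box_scale k) ^ d" by (metis of_nat_le_iff of_nat_power)
          also have "\<dots> \<le> real (box_scale k) ^ d * real m" using rm by (simp add: mult_le_cancel_left1)
          finally show ?thesis using Mge[of k] by (simp add: k_def)
        qed
        then show ?thesis unfolding cluster_tail_def by (intro bex_mono pvalid_pr[OF K]) auto
      qed
      finally have "real (M k) / (2 * real ?R ^ CARD('n)) \<le> cluster_tail (pr K) (nball 0 ?R) 0 T" .
      moreover have "\<delta> \<le> real (M k) / (2 * real ?R ^ CARD('n))"
      proof -
        have "0 < real (box_scale k)" "0 < real r" using box_scale_pos rm by auto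
        then have "\<delta> = (real (box_scale k) ^ d * real m / 2) / (2 * real ?R ^ d)"
          by (simp add: \<delta>_def power_mult_distrib field_simps)
        also have "\<dots> \<le> real (M k) / (2 * real ?R ^ d)"
          by (intro divide_right_mono Mge) auto
        finally show ?thesis by (simp add: d_def)
      qed
      ultimately show ?thesis by (meson order_trans)
    qed
    ultimately show ?thesis unfolding percolates_def by blast
  qed
  show ?thesis by (rule that[OF E0(1)]) (use main in \<open>auto simp: d_def\<close>)
qed

section \<open>Size of the largest cluster in the absence of percolation\<close>

lemma two_boxes:
  fixes r :: nat
  shows "(lbox 0 r :: (int ^ 'n) set) \<subseteq> lbox 0 (2 * r)" "(lbox (\<chi> i. int r) r :: (int ^ 'n) set) \<subseteq> lbox 0 (2 * r)"
    "(lbox 0 r :: (int ^ 'n) set) \<inter> lbox (\<chi> i. int r) r = {}"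
proof -
  show "(lbox 0 r :: (int ^ 'n) set) \<subseteq> lbox 0 (2 * r)"
    unfolding lbox_def by (force intro: less_le_trans)
  show "(lbox (\<chi> i. int r) r :: (int ^ 'n) set) \<subseteq> lbox 0 (2 * r)"
    unfolding lbox_def by (auto intro: order_trans[of 0 "int r"])
  show "(lbox 0 r :: (int ^ 'n) set) \<inter> lbox (\<chi> i. int r) r = {}"
  proof (rule ccontr)
    assume "\<not> ?thesis"
    then obtain x :: "int ^ 'n" where x: "x \<in> lbox 0 r" "x \<in> lbox (\<chi> i. int r) r" by blast
    have "x $ undefined < int r" "int r \<le> x $ undefined" using x by (auto simp: lbox_def)
    then show False by simp
  qed
qed

text \<open>The doubled box contains two disjoint translates of the box, so the probability is at
  least squared with each doubling.\<close>

lemma no_large_double: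
  assumes K: "long_range a b \<alpha> K"
  shows "no_large (pr K) (lbox 0 (2 ^ j * r)) m \<le> no_large (pr K) (lbox 0 r) m ^ (2 ^ j)"
proof (induction j)
  case (Suc j)
  let ?R = "2 ^ j * r"
  have "no_large (pr K) (lbox 0 (2 * ?R)) m \<le> no_large (pr K) (lbox 0 ?R) m * no_large (pr K) (lbox (\<chi> i. int ?R) ?R) m"
    using two_boxes[of ?R] by (intro no_large_mult pvalid_pr[OF K] finite_lbox)
  also have "\<dots> = (no_large (pr K) (lbox 0 ?R) m)\<^sup>2"
    using no_large_lbox[OF K, of "\<chi> i. int ?R" ?R m] by (simp add: power2_eq_square)
  also have "\<dots> \<le> (no_large (pr K) (lbox 0 r) m ^ 2 ^ j)\<^sup>2"
    using Suc no_large_nonneg[OF pvalid_pr[OF K]] by (intro power_mono)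
  finally show ?case by (simp add: power_mult[symmetric] mult_ac)
qed simp

text \<open>If clusters of size \<open>m\<close> occurred with probability above 1 / 27, then in a
  box larger by a fixed factor 2 ^ j their absence would have probability at most (26 / 27) ^ (2 ^
  j), and the criterion would apply there with the same \<open>m\<close>. \<open>B\<close> absorbs
  the change of side.\<close>

lemma max_cluster_bound:
  assumes \<alpha>: "0 < \<alpha>" "\<alpha> < real CARD('n::finite)"
  obtains B where "0 < B" "\<And>a b (K :: int ^ 'n \<Rightarrow> int ^ 'n \<Rightarrow> real) r m. long_range a b \<alpha> K \<Longrightarrow>
    \<not> percolates K \<Longrightarrow> 1 \<le> r \<Longrightarrow> 1 \<le> m \<Longrightarrow>
    B * real r powr (real CARD('n) + \<alpha>) \<le> a * (real m)\<^sup>2 \<Longrightarrow> max_cluster_tail (pr K) (lbox 0 r) m \<le> 1 / 27"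
proof -
  obtain E where E: "0 < E" "\<And>a b (K :: int ^ 'n \<Rightarrow> int ^ 'n \<Rightarrow> real) r m. long_range a b \<alpha> K \<Longrightarrow> 1 \<le> r \<Longrightarrow> 1 \<le> m \<Longrightarrow>
    E * real r powr (real CARD('n) + \<alpha>) \<le> a * (real m)\<^sup>2 \<Longrightarrow>
    no_large (pr K) (lbox 0 r) m \<le> 1 / (8 ^ CARD('n)) ^ 4 \<Longrightarrow> percolates K"
    using percolation_criterion[OF \<alpha>] by blast
  obtain j where j: "(26 / 27 :: real) ^ j < 1 / (8 ^ CARD('n)) ^ 4"
    using real_arch_pow_inv[of "1 / (8 ^ CARD('n)) ^ 4" "26 / 27 :: real"] by auto
  have j2: "(26 / 27 :: real) ^ (2 ^ j) \<le> 1 / (8 ^ CARD('n)) ^ 4"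
  proof -
    have "(26 / 27 :: real) ^ (2 ^ j) \<le> (26 / 27) ^ j"
      using less_exp[of j] by (intro power_decreasing) auto
    then show ?thesis using j by linarith
  qed
  define B where "B = E * (2 ^ j) powr (real CARD('n) + \<alpha>)"
  have "max_cluster_tail (pr K) (lbox 0 r) m \<le> 1 / 27"
    if K: "long_range a b \<alpha> K" "\<not> percolates K" and rm: "1 \<le> r" "1 \<le> m"
      and am: "B * real r powr (real CARD('n) + \<alpha>) \<le> a * (real m)\<^sup>2"
    for a b r m and K :: "int ^ 'n \<Rightarrow> int ^ 'n \<Rightarrow> real"
  proof (rule ccontr)
    assume "\<not> ?thesis"
    then have small: "no_large (pr K) (lbox 0 r) m \<le> 26 / 27" by (simp add: no_large_eq finite_lbox)
    have "no_large (pr K) (lbox 0 (2 ^ j * r)) m \<le> no_large (pr K) (lbox 0 r) m ^ (2 ^ j)"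
      by (rule no_large_double[OF K(1)])
    also have "\<dots> \<le> (26 / 27) ^ (2 ^ j)"
      using small no_large_nonneg[OF pvalid_pr[OF K(1)]] by (intro power_mono)
    also have "\<dots> \<le> 1 / (8 ^ CARD('n)) ^ 4" by (rule j2)
    finally have 1: "no_large (pr K) (lbox 0 (2 ^ j * r)) m \<le> 1 / (8 ^ CARD('n)) ^ 4" .
    have "E * real (2 ^ j * r) powr (real CARD('n) + \<alpha>) \<le> a * (real m)\<^sup>2"
      using am by (simp add: B_def powr_mult mult.assoc)
    moreover have "1 \<le> 2 ^ j * r" using rm by simp
    ultimately show False using E(2)[OF K(1) _ rm(2) _ 1] K(2) by blast
  qed
  moreover have "0 < B" using E(1) by (simp add: B_def)
  ultimately show ?thesis using that by blast
qed

text \<open>A single vertex is a cluster of size 1, so the criterion holds at r = m = 1 as soon as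
  the kernel is strong enough. This bounds the critical parameter from above uniformly in the
  kernel.\<close>

lemma strong_kernel_percolates:
  assumes \<alpha>: "0 < \<alpha>" "\<alpha> < real CARD('n::finite)"
  obtains E where "0 < E" "\<And>a b (K :: int ^ 'n \<Rightarrow> int ^ 'n \<Rightarrow> real). long_range a b \<alpha> K \<Longrightarrow> E \<le> a \<Longrightarrow> percolates K"
proof -
  obtain E where E: "0 < E" "\<And>a b (K :: int ^ 'n \<Rightarrow> int ^ 'n \<Rightarrow> real) r m. long_range a b \<alpha> K \<Longrightarrow> 1 \<le> r \<Longrightarrow> 1 \<le> m \<Longrightarrow>
    E * real r powr (real CARD('n) + \<alpha>) \<le> a * (real m)\<^sup>2 \<Longrightarrow>
    no_large (pr K) (lbox 0 r) m \<le> 1 / (8 ^ CARD('n)) ^ 4 \<Longrightarrow> percolates K"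
    using percolation_criterion[OF \<alpha>] by blast
  have "percolates K" if K: "long_range a b \<alpha> K" "E \<le> a" for a b and K :: "int ^ 'n \<Rightarrow> int ^ 'n \<Rightarrow> real"
  proof -
    have "no_large (pr K) (lbox 0 1) 1 = bex (pr K) (ed (lbox 0 1)) (\<lambda>_. 0)"
      unfolding no_large_def
    proof (rule bex_cong)
      fix w :: "(int ^ 'n) set set" assume w: "w \<subseteq> ed (lbox 0 1)"
      have "0 \<in> (lbox 0 1 :: (int ^ 'n) set)" by (simp add: lbox_def)
      moreover have "0 < card (cl w 0)"
        using finite_cl[OF finite_lbox w, of 0] cl_self[of 0 w] by (metis card_gt_0_iff empty_iff)
      ultimately show "of_bool (\<forall>v\<in>lbox 0 1. card (cl w v) < 1) = (0::real)" by auto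
    qed
    then have "no_large (pr K) (lbox 0 1) 1 = 0" by (simp add: bex_const finite_ed finite_lbox)
    then show ?thesis using E(2)[OF K(1), of 1 1] K(2) by simp
  qed
  then show ?thesis using E(1) that by blast
qed

lemma truncation_level:
  assumes \<alpha>: "0 < \<alpha>" "\<alpha> < real CARD('n::finite)" and a: "0 < a"
  obtains H where "0 < H" "\<And>b (K :: int ^ 'n \<Rightarrow> int ^ 'n \<Rightarrow> real) r. long_range a b \<alpha> K \<Longrightarrow>
    \<not> percolates K \<Longrightarrow> 1 \<le> r \<Longrightarrow>
    \<exists>l\<ge>1. max_cluster_tail (pr K) (lbox 0 r) l \<le> 1 / 27 \<and> (3 * real l)\<^sup>2 \<le> H * real r powr (real CARD('n) + \<alpha>)"
proof -
  obtain B where B: "0 < B" "\<And>a b (K :: int ^ 'n \<Rightarrow> int ^ 'n \<Rightarrow> real) r m. long_range a b \<alpha> K \<Longrightarrow>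
    \<not> percolates K \<Longrightarrow> 1 \<le> r \<Longrightarrow> 1 \<le> m \<Longrightarrow>
    B * real r powr (real CARD('n) + \<alpha>) \<le> a * (real m)\<^sup>2 \<Longrightarrow> max_cluster_tail (pr K) (lbox 0 r) m \<le> 1 / 27"
    using max_cluster_bound[OF \<alpha>] by blast
  \<comment> \<open>The 1 ensures s \<ge> 1, so that rounding \<open>s\<close> up to
    \<open>l\<close> at most doubles it; this gives (3 * l) ^ 2 \<le> 36 * s ^ 2.\<close>
  define G where "G = max 1 (B / a)"
  have "\<exists>l\<ge>1. max_cluster_tail (pr K) (lbox 0 r) l \<le> 1 / 27 \<and> (3 * real l)\<^sup>2 \<le> 36 * G * real r powr (real CARD('n) + \<alpha>)"
    if K: "long_range a b \<alpha> K" "\<not> percolates K" and r: "1 \<le> r" for b r and K :: "int ^ 'n \<Rightarrow> int ^ 'n \<Rightarrow> real"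
  proof -
    define s where "s = sqrt (G * real r powr (real CARD('n) + \<alpha>))"
    define l where "l = nat \<lceil>s\<rceil>"
    have "1 \<le> real r powr (real CARD('n) + \<alpha>)" using r \<alpha> by (intro ge_one_powr_ge_zero) auto
    then have G1: "1 \<le> G * real r powr (real CARD('n) + \<alpha>)"
      using mult_mono[of 1 G 1 "real r powr (real CARD('n) + \<alpha>)"] by (simp add: G_def)
    then have s1: "1 \<le> s" by (simp add: s_def)
    have s2: "s\<^sup>2 = G * real r powr (real CARD('n) + \<alpha>)" using G1 by (simp add: s_def)
    have l: "s \<le> real l" "real l \<le> s + 1" unfolding l_def using s1 by linarith+
    have l1: "1 \<le> l" using l s1 by linarith
    have "B * real r powr (real CARD('n) + \<alpha>) \<le> a * (G * real r powr (real CARD('n) + \<alpha>))"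
    proof -
      have "B / a \<le> G" by (simp add: G_def)
      then have "B \<le> a * G" using a by (simp add: pos_divide_le_eq mult.commute)
      then show ?thesis unfolding mult.assoc[symmetric] by (intro mult_right_mono) auto
    qed
    also have "\<dots> \<le> a * (real l)\<^sup>2"
      unfolding s2[symmetric] using a l s1 by (intro mult_left_mono power_mono) auto
    finally have "max_cluster_tail (pr K) (lbox 0 r) l \<le> 1 / 27" by (rule B(2)[OF K r l1])
    moreover have "(3 * real l)\<^sup>2 \<le> (6 * s)\<^sup>2" using l s1 by (intro power_mono) auto
    then have "(3 * real l)\<^sup>2 \<le> 36 * G * real r powr (real CARD('n) + \<alpha>)"
      by (simp add: power_mult_distrib s2)
    ultimately show ?thesis using l1 by blast
  qed
  moreover have "0 < 36 * G" by (simp add: G_def)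
  ultimately show ?thesis using that by blast
qed

section \<open>Growth of the expected number of connected pairs\<close>

definition box_chi :: "(int ^ 'n \<Rightarrow> int ^ 'n \<Rightarrow> real) \<Rightarrow> nat \<Rightarrow> real" where
  "box_chi K r = (\<Sum>x\<in>lbox 0 r. \<Sum>y\<in>lbox 0 r. tau (pr K) (lbox 0 r) x y)"

lemma max_cluster_tail_lbox: "long_range a b \<alpha> K \<Longrightarrow> max_cluster_tail (pr K) (lbox u r) m = max_cluster_tail (pr K) (lbox 0 r) m"
  using no_large_lbox[of a b \<alpha> K u r m] by (simp add: no_large_eq finite_lbox)

lemma box_chi_translate:
  assumes K: "long_range a b \<alpha> K"
  shows "(\<Sum>x\<in>lbox u r. \<Sum>y\<in>lbox u r. tau (pr K) (lbox u r) x y) = box_chi K r"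
proof -
  have q: "lbox u r = (\<lambda>x. x + u) ` lbox 0 r" by (simp add: lbox_translate)
  show ?thesis unfolding q box_chi_def
    by (simp add: sum.reindex inj_on_def tau_translate[OF K])
qed

text \<open>The merging bound summed over the starting points in two neighbouring boxes. At the
  truncation level the decay of the edge probability cancels the growth of \<open>l\<close>, so the
  denominator is bounded uniformly in \<open>r\<close>.\<close>

lemma box_chi_double:
  fixes K :: "int ^ 'n \<Rightarrow> int ^ 'n \<Rightarrow> real"
  assumes K: "long_range a b \<alpha> K" "0 < \<alpha>" and r: "1 \<le> r" and a: "0 < a"
    and l: "1 \<le> l" "max_cluster_tail (pr K) (lbox 0 r) l \<le> 1 / 27" "(3 * real l)\<^sup>2 \<le> H * real r powr (real CARD('n) + \<alpha>)"
  shows "a / (4 * (1 + a * H)) * real (2 * r) powr (- real CARD('n) - \<alpha>) * (box_chi K r)\<^sup>2 \<le> box_chi K (2 * r)"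
proof -
  let ?d = "real CARD('n)"
  let ?V1 = "lbox 0 r :: (int ^ 'n) set" and ?V2 = "lbox (\<chi> i. int r) r :: (int ^ 'n) set"
    and ?V = "lbox 0 (2 * r) :: (int ^ 'n) set"
  note p = pvalid_pr[OF K(1)]
  define q where "q = a * real (2 * r) powr (- ?d - \<alpha>)"
  have q0: "0 \<le> q" using a by (simp add: q_def)
  have qH: "q * (3 * real l)\<^sup>2 \<le> a * H"
  proof -
    have "q * (3 * real l)\<^sup>2 \<le> (a * real r powr (- ?d - \<alpha>)) * (H * real r powr (?d + \<alpha>))"
      unfolding q_def using a r K l(3)
      by (intro mult_mono mult_left_mono powr_mono2') auto
    also have "\<dots> = a * H * (real r powr (- ?d - \<alpha>) * real r powr (?d + \<alpha>))" by simp
    also have "real r powr (- ?d - \<alpha>) * real r powr (?d + \<alpha>) = 1"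
      using r by (simp add: powr_add[symmetric])
    finally show ?thesis by simp
  qed
  have k: "q / (4 * (1 + a * H)) \<le> q / (4 * (1 + q * (3 * real l)\<^sup>2))"
    using q0 qH by (intro divide_left_mono mult_left_mono add_left_mono mult_pos_pos)
      (auto intro!: add_pos_nonneg mult_nonneg_nonneg order_trans[OF _ qH])
  have s0: "0 \<le> (\<Sum>z\<in>V. tau (pr K) V x z)" for V x by (intro sum_nonneg tau_nonneg p)
  have "q / (4 * (1 + a * H)) * (box_chi K r)\<^sup>2
      \<le> q / (4 * (1 + q * (3 * real l)\<^sup>2)) * (box_chi K r)\<^sup>2"
    by (intro mult_right_mono k) auto
  also have "\<dots> = (\<Sum>x\<in>?V1. \<Sum>y\<in>?V2. q / (4 * (1 + q * (3 * real l)\<^sup>2)) *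
      (\<Sum>z\<in>?V1. tau (pr K) ?V1 x z) * (\<Sum>z\<in>?V2. tau (pr K) ?V2 y z))"
  proof -
    have "(\<Sum>x\<in>?V1. \<Sum>y\<in>?V2. c * f x * g y) = c * (sum f ?V1 * sum g ?V2)" for c :: real and f g
      by (simp only: sum_distrib_left[symmetric] sum_distrib_right[symmetric] mult.assoc)
    then show ?thesis
      by (simp only: box_chi_translate[OF K(1)] power2_eq_square)
  qed
  also have "\<dots> \<le> (\<Sum>x\<in>?V1. \<Sum>y\<in>?V2. tau (pr K) ?V x y)"
  proof (intro sum_mono tau_merge_truncated p finite_lbox q0 l(1,2))
    show "max_cluster_tail (pr K) ?V2 l \<le> 1 / 27" using l(2) unfolding max_cluster_tail_lbox[OF K(1), of "\<chi> i. int r"] .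
    fix x y assume "x \<in> ?V1" "y \<in> ?V2"
    then have "x \<noteq> y" "x \<in> ?V" "y \<in> ?V" using two_boxes[of r, where 'n = 'n] by blast+
    then show "1 - exp (- q) \<le> pr K {x, y}"
      using lbox_diam[of y 0 "2 * r" x] unfolding q_def by (intro pr_ge[OF K]) auto
  qed (use two_boxes[of r, where 'n = 'n] in auto)
  also have "\<dots> \<le> (\<Sum>x\<in>?V1. \<Sum>y\<in>?V. tau (pr K) ?V x y)"
    using two_boxes[of r, where 'n = 'n] by (intro sum_mono sum_mono2 finite_lbox tau_nonneg p) auto
  also have "\<dots> \<le> box_chi K (2 * r)" unfolding box_chi_def
    using two_boxes[of r, where 'n = 'n] by (intro sum_mono2 finite_lbox sum_nonneg tau_nonneg p) auto
  finally show ?thesis by (simp add: q_def)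
qed

lemma box_chi_le:
  fixes K :: "int ^ 'n \<Rightarrow> int ^ 'n \<Rightarrow> real"
  assumes K: "long_range a b \<alpha> K"
  shows "box_chi K r \<le> real r ^ (2 * CARD('n))"
proof -
  have "box_chi K r \<le> (\<Sum>x\<in>(lbox 0 r :: (int ^ 'n) set). \<Sum>y\<in>(lbox 0 r :: (int ^ 'n) set). 1)"
    unfolding box_chi_def by (rule sum_mono, rule sum_mono, rule tau_le_1[OF pvalid_pr[OF K] finite_lbox])
  also have "\<dots> = real r ^ (2 * CARD('n))"
    by (simp add: card_lbox power_add[symmetric] mult_2)
  finally show ?thesis .
qed

text \<open>The balls of radius \<open>m\<close> around all points of \<open>nball 0 m\<close> lie
  in a common cube of side \<open>4 * m + 1\<close>. A bound of order r powr (d + \<alpha>) on the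
  sum over pairs thus gives m powr \<alpha> for a single centre.\<close>

lemma ball_chi_le_box_chi:
  fixes K :: "int ^ 'n \<Rightarrow> int ^ 'n \<Rightarrow> real"
  assumes K: "long_range a b \<alpha> K"
  shows "real (2 * m + 1) ^ CARD('n) * ball_chi K m \<le> box_chi K (4 * m + 1)"
proof -
  let ?V = "nball 0 (2 * m) :: (int ^ 'n) set"
  note p = pvalid_pr[OF K]
  have "real (2 * m + 1) ^ CARD('n) * ball_chi K m = (\<Sum>u\<in>(nball 0 m :: (int ^ 'n) set). ball_chi K m)"
    by (simp add: card_nball)
  also have "\<dots> = (\<Sum>u\<in>nball 0 m. \<Sum>y\<in>nball u m. tau (pr K) (nball u m) u y)"
    by (simp add: ball_chi_center[OF K])
  also have "\<dots> \<le> (\<Sum>u\<in>nball 0 m. \<Sum>y\<in>?V. tau (pr K) ?V u y)"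
  proof (intro sum_mono sum_tau_mono p finite_nball)
    fix u :: "int ^ 'n" assume "u \<in> nball 0 m"
    then show "nball u m \<subseteq> ?V"
      using nm_triangle_diff[of _ 0 u] by (auto simp: nball_def intro!: order_trans[OF nm_triangle_diff[of _ 0 u, simplified]])
  qed
  also have "\<dots> \<le> (\<Sum>u\<in>?V. \<Sum>y\<in>?V. tau (pr K) ?V u y)"
    by (intro sum_mono2 finite_nball sum_nonneg tau_nonneg p) (auto simp: nball_def)
  also have "\<dots> = box_chi K (4 * m + 1)"
    using box_chi_translate[OF K, of "0 - (\<chi> i. int (2 * m))" "2 * (2 * m) + 1"]
    unfolding nball_eq_lbox by simp
  finally show ?thesis .
qed

text \<open>After normalisation the recursion reads u (k + 1) \<ge> (u k) ^ 2. Started at 2 or more,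
  \<open>u\<close> grows doubly exponentially, whereas bounding every connection probability by 1
  makes it at most exponential in \<open>k\<close>.\<close>

theorem ball_chi_upper:
  assumes \<alpha>: "0 < \<alpha>" "\<alpha> < real CARD('n::finite)" and a: "0 < a"
  obtains A where "0 < A" "\<And>b (K :: int ^ 'n \<Rightarrow> int ^ 'n \<Rightarrow> real) m. long_range a b \<alpha> K \<Longrightarrow>
    \<not> percolates K \<Longrightarrow> 1 \<le> m \<Longrightarrow> ball_chi K m \<le> A * real m powr \<alpha>"
proof -
  let ?d = "real CARD('n)"
  obtain H where H: "0 < H" "\<And>b (K :: int ^ 'n \<Rightarrow> int ^ 'n \<Rightarrow> real) r. long_range a b \<alpha> K \<Longrightarrow>
    \<not> percolates K \<Longrightarrow> 1 \<le> r \<Longrightarrow>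
    \<exists>l\<ge>1. max_cluster_tail (pr K) (lbox 0 r) l \<le> 1 / 27 \<and> (3 * real l)\<^sup>2 \<le> H * real r powr (?d + \<alpha>)"
    using truncation_level[OF \<alpha> a] by blast
  \<comment> \<open>One power of 2 comes from the edge probability at distance \<open>2 * r\<close>
    in \<open>box_chi_double\<close>, the other from normalising at the doubled scale.\<close>
  define \<kappa> where "\<kappa> = a / (4 * (1 + a * H)) * 2 powr (- ?d - \<alpha>) * 2 powr (- ?d - \<alpha>)"
  have \<kappa>: "0 < \<kappa>" unfolding \<kappa>_def using a H(1) by (intro mult_pos_pos divide_pos_pos add_pos_pos) auto
  have S: "box_chi K r \<le> 2 / \<kappa> * real r powr (?d + \<alpha>)"
    if K: "long_range a b \<alpha> K" "\<not> percolates K" and r: "1 \<le> r" for b r and K :: "int ^ 'n \<Rightarrow> int ^ 'n \<Rightarrow> real"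
  proof (rule ccontr)
    assume neg: "\<not> ?thesis"
    define u where "u = (\<lambda>k. \<kappa> * box_chi K (2 ^ k * r) * real (2 ^ k * r) powr (- ?d - \<alpha>))"
    have bs0: "0 \<le> box_chi K R" for R
      unfolding box_chi_def by (intro sum_nonneg tau_nonneg pvalid_pr[OF K(1)])
    have u0: "0 \<le> u k" for k unfolding u_def using \<kappa> bs0 by (intro mult_nonneg_nonneg) auto
    have ustep: "(u k)\<^sup>2 \<le> u (Suc k)" for k
    proof -
      let ?R = "2 ^ k * r"
      have R: "1 \<le> ?R" using r by simp
      obtain l where l: "1 \<le> l" "max_cluster_tail (pr K) (lbox 0 ?R) l \<le> 1 / 27" "(3 * real l)\<^sup>2 \<le> H * real ?R powr (?d + \<alpha>)"
        using H(2)[OF K R] by blast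
      have p2: "real (2 * ?R) powr (- ?d - \<alpha>) = 2 powr (- ?d - \<alpha>) * real ?R powr (- ?d - \<alpha>)"
        by (simp add: powr_mult)
      have "(u k)\<^sup>2 = \<kappa> * (a / (4 * (1 + a * H)) * real (2 * ?R) powr (- ?d - \<alpha>) * (box_chi K ?R)\<^sup>2)
          * real (2 * ?R) powr (- ?d - \<alpha>)"
        unfolding p2 by (simp add: u_def \<kappa>_def power2_eq_square mult_ac)
      also have "\<dots> \<le> \<kappa> * box_chi K (2 * ?R) * real (2 * ?R) powr (- ?d - \<alpha>)"
        using \<kappa> by (intro mult_right_mono mult_left_mono box_chi_double[OF K(1) \<alpha>(1) R a l]) auto
      finally show ?thesis by (simp add: u_def mult.assoc)
    qed
    have "2 \<le> u 0"
    proof -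
      have "2 / \<kappa> * real r powr (?d + \<alpha>) < box_chi K r" using neg by simp
      then have "2 * real r powr (?d + \<alpha>) \<le> \<kappa> * box_chi K r" using \<kappa> by (simp add: field_simps)
      then have "2 * real r powr (?d + \<alpha>) * real r powr (- ?d - \<alpha>) \<le> \<kappa> * box_chi K r * real r powr (- ?d - \<alpha>)"
        by (intro mult_right_mono) auto
      moreover have "real r powr (?d + \<alpha>) * real r powr (- ?d - \<alpha>) = 1"
        using r by (simp add: powr_add[symmetric])
      ultimately show ?thesis by (simp add: u_def mult.assoc)
    qed
    have low: "2 ^ (2 ^ k) \<le> u k" for k
    proof (induction k)
      case (Suc k)
      have "(2::real) ^ (2 ^ Suc k) = (2 ^ (2 ^ k))\<^sup>2" by (simp add: power_mult[symmetric] mult.commute)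
      also have "\<dots> \<le> (u k)\<^sup>2" using Suc by (intro power_mono) auto
      also have "\<dots> \<le> u (Suc k)" by (rule ustep)
      finally show ?case .
    qed (use \<open>2 \<le> u 0\<close> in simp)
    have up: "u k \<le> \<kappa> * (2 ^ k * real r) ^ (2 * CARD('n))" for k
    proof -
      have "1 \<le> 2 ^ k * r" using r by simp
      then have R: "1 \<le> real (2 ^ k * r)" by (metis of_nat_1 of_nat_le_iff)
      then have "real (2 ^ k * r) powr (- ?d - \<alpha>) \<le> real (2 ^ k * r) powr 0"
        using \<alpha> by (intro powr_mono) auto
      then have "real (2 ^ k * r) powr (- ?d - \<alpha>) \<le> 1" using r by simp
      then have "u k \<le> \<kappa> * box_chi K (2 ^ k * r) * 1"
        unfolding u_def using \<kappa> bs0 by (intro mult_left_mono mult_nonneg_nonneg) auto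
      also have "\<dots> \<le> \<kappa> * real (2 ^ k * r) ^ (2 * CARD('n))"
        using \<kappa> box_chi_le[OF K(1), of "2 ^ k * r"] by (simp add: mult_left_mono)
      finally show ?thesis by simp
    qed
    have e: "0 < 2 * ?d" by simp
    define c where "c = log 2 (\<kappa> * real r ^ (2 * CARD('n)))"
    have "\<forall>\<^sub>F k :: nat in sequentially. c + 2 * ?d * real k < 2 ^ k"
      using e by real_asymp
    then obtain k where k: "c + 2 * ?d * real k < 2 ^ k"
      using eventually_happens' sequentially_bot by blast
    have "\<kappa> * (2 ^ k * real r) ^ (2 * CARD('n)) < 2 ^ (2 ^ k)"
    proof -
      have "0 < \<kappa> * real r ^ (2 * CARD('n))" using \<kappa> r by simp
      then have "\<kappa> * real r ^ (2 * CARD('n)) = 2 powr c" by (simp add: c_def)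
      moreover have "(2 ^ k) ^ (2 * CARD('n)) = 2 powr (2 * ?d * real k)"
        using powr_realpow[of 2 "k * (2 * CARD('n))"] by (simp add: power_mult[symmetric] mult_ac)
      ultimately have "\<kappa> * (2 ^ k * real r) ^ (2 * CARD('n)) = 2 powr (c + 2 * ?d * real k)"
        by (simp add: power_mult_distrib powr_add mult_ac)
      also have "\<dots> < 2 powr (2 ^ k)" using k by simp
      also have "\<dots> = 2 ^ (2 ^ k)" using powr_realpow[of 2 "2 ^ k"] by simp
      finally show ?thesis .
    qed
    then show False using low[of k] up[of k] by linarith
  qed
  define A where "A = 2 / \<kappa> * 5 powr (?d + \<alpha>)"
  have "ball_chi K m \<le> A * real m powr \<alpha>"
    if K: "long_range a b \<alpha> K" "\<not> percolates K" and m: "1 \<le> m" for b m and K :: "int ^ 'n \<Rightarrow> int ^ 'n \<Rightarrow> real"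
  proof -
    have m0: "0 < real m" using m by simp
    have "real m ^ CARD('n) * ball_chi K m \<le> real (2 * m + 1) ^ CARD('n) * ball_chi K m"
      using ball_chi_ge_1[OF K(1), of m] by (intro mult_right_mono power_mono) auto
    also have "\<dots> \<le> box_chi K (4 * m + 1)" by (rule ball_chi_le_box_chi[OF K(1)])
    also have "\<dots> \<le> 2 / \<kappa> * real (4 * m + 1) powr (?d + \<alpha>)" using S[OF K, of "4 * m + 1"] by simp
    also have "\<dots> \<le> 2 / \<kappa> * (5 * real m) powr (?d + \<alpha>)"
      using \<kappa> \<alpha> m by (intro mult_left_mono powr_mono2) auto
    also have "\<dots> = real m ^ CARD('n) * (A * real m powr \<alpha>)"
      using m0 by (simp add: A_def powr_mult powr_add powr_realpow)
    finally show ?thesis using m0 by simp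
  qed
  moreover have "0 < A" using \<kappa> by (simp add: A_def)
  ultimately show ?thesis using that by blast
qed

section \<open>Pointwise upper bound\<close>

text \<open>Exit edges are split at length \<open>g\<close>. For a short edge the inner end is far
  from \<open>x\<close>, so a pointwise bound \<open>T\<close> on reaching it can be used. For a
  long edge the kernel is replaced by its value at \<open>g + 1\<close>, and the double sum factors
  into two susceptibilities.\<close>

lemma exit_two_ranges:
  fixes K :: "int ^ 'n \<Rightarrow> int ^ 'n \<Rightarrow> real"
  assumes K: "long_range a b \<alpha> K" and \<alpha>: "0 < \<alpha>" "\<alpha> < 1" and V: "finite V" "x \<in> V" and h: "1 \<le> h"
    and g: "2 * g \<le> h" and T0: "0 \<le> T"
    and T: "\<And>s u. s \<in> {h<..2 * h} \<Longrightarrow> u \<in> V \<Longrightarrow> nm (u - x) \<le> s \<Longrightarrow> s \<le> 2 * nm (u - x) \<Longrightarrow>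
      tau (pr K) (V \<inter> nball x s) x u \<le> T"
  shows "tau (pr K) V x y \<le> tau (pr K) (V \<inter> nball x (2 * h)) x y
    + (T * b * (shell_const TYPE('n) / (1 - \<alpha>)) * real g powr (1 - \<alpha>) / real h
      + b * real (g + 1) powr (- real CARD('n) - \<alpha>) * ball_chi K (2 * h)) * (\<Sum>v\<in>V. tau (pr K) V v y)"
proof -
  note p = pvalid_pr[OF K]
  let ?V2 = "V \<inter> nball x (2 * h)" and ?d = "real CARD('n)"
  let ?w = "\<lambda>u v. real (nm (v - u)) powr (- ?d - \<alpha>)"
  let ?Y = "\<Sum>v\<in>V. tau (pr K) V v y"
  have b0: "0 \<le> b" using K by (simp add: long_range_def)
  have t0: "0 \<le> tau (pr K) W u v" for W u v by (rule tau_nonneg[OF p])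
  define M where "M = (\<lambda>u v. if nm (v - u) \<le> g then T else tau (pr K) ?V2 x u)"
  define n1 where "n1 = (\<lambda>u v. of_bool (nm (v - u) \<le> g) * T * b * (?w u v * real (nm (v - u))) * tau (pr K) V v y)"
  define n2 where "n2 = (\<lambda>u v. tau (pr K) ?V2 x u * (b * real (g + 1) powr (- ?d - \<alpha>) * real h) * tau (pr K) V v y)"
  have "real h * tau (pr K) V x y \<le> real h * tau (pr K) ?V2 x y
    + (\<Sum>u\<in>?V2. \<Sum>v\<in>V - {u}. M u v * (b * (?w u v * real (min (nm (v - u)) h))) * tau (pr K) V v y)"
  proof (rule averaged_exit[OF K V h])
    show "0 \<le> M u v" for u v using T0 t0 by (simp add: M_def)
    fix s u v assume *: "s \<in> {h<..2 * h}" "u \<in> V" "v \<in> V" "nm (u - x) \<le> s" "s < nm (v - x)"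
    show "tau (pr K) (V \<inter> nball x s) x u \<le> M u v"
    proof (cases "nm (v - u) \<le> g")
      case True
      have "nm (v - x) \<le> nm (v - u) + nm (u - x)" by (rule nm_triangle_diff)
      \<comment> \<open>An edge of length at most h / 2 that crosses a sphere of radius s > h has
        its inner end in the outer half of the ball.\<close>
      then have "s \<le> 2 * nm (u - x)" using True * g by auto
      then show ?thesis using T[OF *(1,2,4)] True by (simp add: M_def)
    next
      case False
      have "tau (pr K) (V \<inter> nball x s) x u \<le> tau (pr K) ?V2 x u"
        using V * by (intro tau_mono p) (auto simp: nball_def)
      then show ?thesis using False by (simp add: M_def)
    qed
  qed
  also have "(\<Sum>u\<in>?V2. \<Sum>v\<in>V - {u}. M u v * (b * (?w u v * real (min (nm (v - u)) h))) * tau (pr K) V v y)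
      \<le> (\<Sum>u\<in>?V2. \<Sum>v\<in>V - {u}. n1 u v + n2 u v)"
  proof (intro sum_mono)
    fix u v assume uv: "u \<in> ?V2" "v \<in> V - {u}"
    have n10: "0 \<le> n1 u v" and n20: "0 \<le> n2 u v" unfolding n1_def n2_def
      by (intro mult_nonneg_nonneg t0 b0 T0; simp)+
    show "M u v * (b * (?w u v * real (min (nm (v - u)) h))) * tau (pr K) V v y \<le> n1 u v + n2 u v"
    proof (cases "nm (v - u) \<le> g")
      case True
      have "M u v * (b * (?w u v * real (min (nm (v - u)) h))) * tau (pr K) V v y \<le> n1 u v"
        unfolding n1_def M_def using True T0 b0 t0
        by (simp add: mult.assoc) (intro mult_left_mono mult_right_mono mult_nonneg_nonneg t0; simp)
      then show ?thesis using n20 by simp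
    next
      case False
      have "?w u v \<le> real (g + 1) powr (- ?d - \<alpha>)"
        using False \<alpha> by (intro powr_mono2') auto
      then have "M u v * (b * (?w u v * real (min (nm (v - u)) h))) * tau (pr K) V v y \<le> n2 u v"
        unfolding n2_def M_def using False b0 t0
        by (simp add: mult.assoc) (intro mult_left_mono mult_mono mult_right_mono mult_nonneg_nonneg t0; simp)
      then show ?thesis using n10 by simp
    qed
  qed
  also have "\<dots> = (\<Sum>u\<in>?V2. \<Sum>v\<in>V - {u}. n1 u v) + (\<Sum>u\<in>?V2. \<Sum>v\<in>V - {u}. n2 u v)"
    by (simp add: sum.distrib)
  also have "(\<Sum>u\<in>?V2. \<Sum>v\<in>V - {u}. n1 u v) \<le> T * b * (shell_const TYPE('n) / (1 - \<alpha>) * real g powr (1 - \<alpha>)) * ?Y"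
  proof -
    have n10: "0 \<le> n1 u v" for u v unfolding n1_def
      by (intro mult_nonneg_nonneg t0 b0 T0; simp)
    have "(\<Sum>u\<in>?V2. \<Sum>v\<in>V - {u}. n1 u v) \<le> (\<Sum>u\<in>V. \<Sum>v\<in>V - {u}. n1 u v)"
      using V by (intro sum_mono2 sum_nonneg n10) auto
    \<comment> \<open>For short edges \<open>T\<close> has removed the dependence on the connection
      from \<open>x\<close> to \<open>u\<close>, so with \<open>v\<close> fixed the sum over
      \<open>u\<close> is the weighted length of the short edges at \<open>v\<close>.\<close>
    also have "\<dots> = (\<Sum>v\<in>V. \<Sum>u\<in>V - {v}. n1 u v)"
    proof -
      have "(\<Sum>u\<in>V. \<Sum>v\<in>V - {u}. n1 u v) = (\<Sum>u\<in>V. \<Sum>v\<in>{v \<in> V. u \<noteq> v}. n1 u v)"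
        by (intro sum.cong) auto
      also have "\<dots> = (\<Sum>v\<in>V. \<Sum>u\<in>{u \<in> V. u \<noteq> v}. n1 u v)"
        using V by (intro sum.swap_restrict) auto
      also have "\<dots> = (\<Sum>v\<in>V. \<Sum>u\<in>V - {v}. n1 u v)"
        by (intro sum.cong) auto
      finally show ?thesis .
    qed
    also have "\<dots> \<le> (\<Sum>v\<in>V. T * b * (shell_const TYPE('n) / (1 - \<alpha>) * real g powr (1 - \<alpha>)) * tau (pr K) V v y)"
    proof (intro sum_mono)
      fix v assume v: "v \<in> V"
      let ?N = "{u \<in> V - {v}. nm (u - v) \<le> g}"
      have pos: "1 \<le> nm (u - v)" if "u \<noteq> v" for u
        using that nm_eq_0_iff[of "u - v"] by (cases "nm (u - v)") auto
      have "(\<Sum>u\<in>V - {v}. n1 u v)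
          = (\<Sum>u\<in>?N. T * b * (real (nm (u - v)) powr (- ?d - \<alpha>) * real (nm (u - v))) * tau (pr K) V v y)"
        using V unfolding n1_def by (intro sum.mono_neutral_cong_right) (auto simp: nm_commute[of v])
      also have "\<dots> = T * b * (\<Sum>u\<in>?N. real (nm (u - v)) powr (- ?d - \<alpha>) * real (nm (u - v))) * tau (pr K) V v y"
        by (simp add: sum_distrib_left sum_distrib_right)
      also have "\<dots> \<le> T * b * (shell_const TYPE('n) / (1 - \<alpha>) * real g powr (1 - \<alpha>)) * tau (pr K) V v y"
        using V \<alpha> T0 b0 pos by (intro mult_right_mono mult_left_mono sum_near_le t0 mult_nonneg_nonneg) auto
      finally show "(\<Sum>u\<in>V - {v}. n1 u v) \<le> \<dots>" .
    qed
    finally show ?thesis by (simp add: sum_distrib_left)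
  qed
  also have "(\<Sum>u\<in>?V2. \<Sum>v\<in>V - {u}. n2 u v) \<le> ball_chi K (2 * h) * (b * real (g + 1) powr (- ?d - \<alpha>) * real h) * ?Y"
  proof -
    have "(\<Sum>u\<in>?V2. \<Sum>v\<in>V - {u}. n2 u v) \<le> (\<Sum>u\<in>?V2. \<Sum>v\<in>V. n2 u v)"
      using V b0 unfolding n2_def by (intro sum_mono sum_mono2 mult_nonneg_nonneg t0) auto
    also have "\<dots> = (\<Sum>u\<in>?V2. tau (pr K) ?V2 x u) * (b * real (g + 1) powr (- ?d - \<alpha>) * real h) * ?Y"
      unfolding n2_def by (simp add: sum_distrib_left[symmetric] sum_distrib_right[symmetric])
    also have "\<dots> \<le> ball_chi K (2 * h) * (b * real (g + 1) powr (- ?d - \<alpha>) * real h) * ?Y"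
      using b0 by (intro mult_right_mono ball_chi_ge[OF K] sum_nonneg t0 mult_nonneg_nonneg) auto
    finally show ?thesis .
  qed
  finally have fin: "real h * tau (pr K) V x y \<le> real h * tau (pr K) ?V2 x y +
      (T * b * (shell_const TYPE('n) / (1 - \<alpha>) * real g powr (1 - \<alpha>)) * ?Y +
       ball_chi K (2 * h) * (b * real (g + 1) powr (- ?d - \<alpha>) * real h) * ?Y)" by simp
  have eq: "k * s + (T * b * (c * gp) * Y + w * (b * q * k) * Y) = k * (s + (T * b * c * gp / k + b * q * w) * Y)"
    if "0 < k" for k s T b c gp q w Y :: real
    using that by (simp add: field_simps)
  have "0 < real h" using h by simp
  with fin show ?thesis by (subst (asm) eq) auto
qed

text \<open>With the cut-off at \<epsilon> * h, the constant \<open>t\<close> of the assumed bound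
  returns with the small factor \<epsilon> powr (1 - \<alpha>), while the term that blows up as
  \<epsilon> decreases does not contain \<open>t\<close>. This is what lets an induction reproduce
  \<open>t\<close>.\<close>

lemma exit_scaled:
  fixes K :: "int ^ 'n \<Rightarrow> int ^ 'n \<Rightarrow> real"
  assumes K: "long_range a b \<alpha> K" and \<alpha>: "0 < \<alpha>" "\<alpha> < 1" and V: "finite V" "x \<in> V" and h: "1 \<le> h"
    and A: "0 \<le> A" "ball_chi K (2 * h) \<le> A * real (2 * h) powr \<alpha>" and \<epsilon>: "0 < \<epsilon>" "\<epsilon> \<le> 1 / 2" and t: "0 \<le> t"
    and T: "\<And>s u. s \<in> {h<..2 * h} \<Longrightarrow> u \<in> V \<Longrightarrow> nm (u - x) \<le> s \<Longrightarrow> s \<le> 2 * nm (u - x) \<Longrightarrow>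
      tau (pr K) (V \<inter> nball x s) x u \<le> t * real h powr (- real CARD('n) + \<alpha>)"
  shows "tau (pr K) V x y \<le> tau (pr K) (V \<inter> nball x (2 * h)) x y
    + (t * b * (shell_const TYPE('n) / (1 - \<alpha>)) * \<epsilon> powr (1 - \<alpha>) + b * A * 2 powr \<alpha> * \<epsilon> powr (- real CARD('n) - \<alpha>))
      * real h powr (- real CARD('n)) * (\<Sum>v\<in>V. tau (pr K) V v y)"
proof -
  let ?d = "real CARD('n)"
  define g where "g = nat \<lfloor>\<epsilon> * real h\<rfloor>"
  have b0: "0 \<le> b" using K by (simp add: long_range_def)
  have h0: "0 < real h" using h by simp
  have g1: "real g \<le> \<epsilon> * real h" "\<epsilon> * real h \<le> real (g + 1)"
    unfolding g_def using \<epsilon> h0 by (auto simp: of_nat_nat) linarith+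
  have "real g \<le> 1 / 2 * real h" using g1(1) \<epsilon>(2) h0 mult_right_mono[of \<epsilon> "1/2" "real h"] by linarith
  then have g2: "2 * g \<le> h" by linarith
  have c0: "0 \<le> shell_const TYPE('n) / (1 - \<alpha>)" using shell_const_pos[where 'n = 'n] \<alpha> by simp
  have "tau (pr K) V x y \<le> tau (pr K) (V \<inter> nball x (2 * h)) x y
    + (t * real h powr (- ?d + \<alpha>) * b * (shell_const TYPE('n) / (1 - \<alpha>)) * real g powr (1 - \<alpha>) / real h
      + b * real (g + 1) powr (- ?d - \<alpha>) * ball_chi K (2 * h)) * (\<Sum>v\<in>V. tau (pr K) V v y)"
    using t T by (intro exit_two_ranges[OF K \<alpha> V h g2]) auto
  also have "\<dots> \<le> tau (pr K) (V \<inter> nball x (2 * h)) x y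
    + ((t * b * (shell_const TYPE('n) / (1 - \<alpha>)) * \<epsilon> powr (1 - \<alpha>) + b * A * 2 powr \<alpha> * \<epsilon> powr (- ?d - \<alpha>))
      * real h powr (- ?d)) * (\<Sum>v\<in>V. tau (pr K) V v y)"
  proof (intro add_left_mono mult_right_mono sum_nonneg tau_nonneg pvalid_pr[OF K])
    have "real g powr (1 - \<alpha>) \<le> (\<epsilon> * real h) powr (1 - \<alpha>)"
      using g1 \<alpha> by (intro powr_mono2) auto
    then have "t * real h powr (- ?d + \<alpha>) * b * (shell_const TYPE('n) / (1 - \<alpha>)) * real g powr (1 - \<alpha>) / real h
      \<le> t * real h powr (- ?d + \<alpha>) * b * (shell_const TYPE('n) / (1 - \<alpha>)) * (\<epsilon> * real h) powr (1 - \<alpha>) / real h"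
      using t b0 c0 by (intro divide_right_mono mult_left_mono mult_nonneg_nonneg) auto
    also have "\<dots> = t * b * (shell_const TYPE('n) / (1 - \<alpha>)) * \<epsilon> powr (1 - \<alpha>) *
        (real h powr (- ?d + \<alpha>) * real h powr (1 - \<alpha>) * real h powr (- 1))"
    proof -
      have 1: "(\<epsilon> * real h) powr (1 - \<alpha>) = \<epsilon> powr (1 - \<alpha>) * real h powr (1 - \<alpha>)"
        using h0 \<epsilon> by (simp add: powr_mult)
      have 2: "r / real h = r * real h powr (- 1)" for r using h0 by (simp add: powr_minus divide_inverse)
      show ?thesis unfolding 1 2[of "_ * _"] by (simp only: mult_ac)
    qed
    also have "real h powr (- ?d + \<alpha>) * real h powr (1 - \<alpha>) * real h powr (- 1) = real h powr (- ?d)"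
      unfolding powr_add[symmetric] by (rule arg_cong[where f = "\<lambda>e. real h powr e"]) simp
    finally have 1: "t * real h powr (- ?d + \<alpha>) * b * (shell_const TYPE('n) / (1 - \<alpha>)) * real g powr (1 - \<alpha>) / real h
      \<le> t * b * (shell_const TYPE('n) / (1 - \<alpha>)) * \<epsilon> powr (1 - \<alpha>) * real h powr (- ?d)" .
    have w0: "0 \<le> ball_chi K (2 * h)" using ball_chi_ge_1[OF K, of "2 * h"] by simp
    have "b * real (g + 1) powr (- ?d - \<alpha>) * ball_chi K (2 * h)
        \<le> b * (\<epsilon> * real h) powr (- ?d - \<alpha>) * (A * real (2 * h) powr \<alpha>)"
      using b0 g1 \<epsilon> h0 \<alpha> A w0 by (intro mult_mono mult_left_mono powr_mono2') auto
    also have "\<dots> = b * A * 2 powr \<alpha> * \<epsilon> powr (- ?d - \<alpha>) * (real h powr (- ?d - \<alpha>) * real h powr \<alpha>)"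
    proof -
      have "(\<epsilon> * real h) powr (- ?d - \<alpha>) = \<epsilon> powr (- ?d - \<alpha>) * real h powr (- ?d - \<alpha>)"
        "real (2 * h) powr \<alpha> = 2 powr \<alpha> * real h powr \<alpha>"
        using \<epsilon> h0 by (simp_all add: powr_mult)
      then show ?thesis by (simp only: mult_ac)
    qed
    also have "real h powr (- ?d - \<alpha>) * real h powr \<alpha> = real h powr (- ?d)"
      by (simp add: powr_add[symmetric])
    finally have 2: "b * real (g + 1) powr (- ?d - \<alpha>) * ball_chi K (2 * h)
        \<le> b * A * 2 powr \<alpha> * \<epsilon> powr (- ?d - \<alpha>) * real h powr (- ?d)" .
    show "t * real h powr (- ?d + \<alpha>) * b * (shell_const TYPE('n) / (1 - \<alpha>)) * real g powr (1 - \<alpha>) / real h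
        + b * real (g + 1) powr (- ?d - \<alpha>) * ball_chi K (2 * h)
      \<le> (t * b * (shell_const TYPE('n) / (1 - \<alpha>)) * \<epsilon> powr (1 - \<alpha>) + b * A * 2 powr \<alpha> * \<epsilon> powr (- ?d - \<alpha>))
        * real h powr (- ?d)"
      using add_mono[OF 1 2] by (simp add: distrib_right)
  qed
  finally show ?thesis by simp
qed

lemma sum_tau_left: "(\<Sum>v\<in>V. tau p V v y) = (\<Sum>v\<in>V. tau p V y v)"
  by (simp add: tau_sym[of p V _ y])

text \<open>The case of a volume whose diameter is comparable to the distance of the two points.
  There the susceptibility of the volume is at most of order s powr \<alpha>, so every term of the
  exit bound has the order s powr (- d + \<alpha>), and strong induction on \<open>s\<close>
  closes.\<close>

lemma local_upper:
  assumes \<alpha>: "0 < \<alpha>" "\<alpha> < 1" "\<alpha> < real CARD('n::finite)" and b: "0 < b" and A: "0 < A"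
  obtains t where "0 < t" "\<And>a (K :: int ^ 'n \<Rightarrow> int ^ 'n \<Rightarrow> real) V x y s. long_range a b \<alpha> K \<Longrightarrow>
    (\<And>m. 1 \<le> m \<Longrightarrow> ball_chi K m \<le> A * real m powr \<alpha>) \<Longrightarrow> finite V \<Longrightarrow> x \<in> V \<Longrightarrow> y \<in> V \<Longrightarrow> 1 \<le> s \<Longrightarrow>
    (\<And>u v. u \<in> V \<Longrightarrow> v \<in> V \<Longrightarrow> nm (u - v) \<le> s) \<Longrightarrow> s \<le> 4 * nm (y - x) \<Longrightarrow>
    tau (pr K) V x y \<le> t * real s powr (- real CARD('n) + \<alpha>)"
proof -
  let ?d = "real CARD('n)"
  define c1 where "c1 = b * (shell_const TYPE('n) / (1 - \<alpha>))"
  have c1: "0 < c1" using b \<alpha> shell_const_pos[where 'n = 'n] by (simp add: c1_def)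
  \<comment> \<open>Makes the part proportional to \<open>t\<close> at most \<open>t / 2\<close>;
    \<open>A\<close> comes from the susceptibility of the volume and 32 from s \<le> 32 * h.\<close>
  define \<epsilon> where "\<epsilon> = min (1 / 2) ((1 / (2 * c1 * A * 32 powr ?d)) powr (1 / (1 - \<alpha>)))"
  have \<epsilon>: "0 < \<epsilon>" "\<epsilon> \<le> 1 / 2" using c1 A by (auto simp: \<epsilon>_def)
  have \<epsilon>c: "c1 * \<epsilon> powr (1 - \<alpha>) * A * 32 powr ?d \<le> 1 / 2"
  proof -
    have pos: "0 < 2 * c1 * A * 32 powr ?d" using c1 A by simp
    have "\<epsilon> powr (1 - \<alpha>) \<le> ((1 / (2 * c1 * A * 32 powr ?d)) powr (1 / (1 - \<alpha>))) powr (1 - \<alpha>)"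
      using \<epsilon> \<alpha> by (intro powr_mono2) (auto simp: \<epsilon>_def)
    also have "\<dots> = 1 / (2 * c1 * A * 32 powr ?d)" using \<alpha> pos by (simp add: powr_powr)
    finally have "c1 * A * 32 powr ?d * \<epsilon> powr (1 - \<alpha>) \<le> c1 * A * 32 powr ?d * (1 / (2 * c1 * A * 32 powr ?d))"
      using c1 A by (intro mult_left_mono) auto
    also have "\<dots> = 1 / 2" using c1 A by simp
    finally show ?thesis by (simp add: mult_ac)
  qed
  define c2 where "c2 = b * A * 2 powr \<alpha> * \<epsilon> powr (- ?d - \<alpha>) * A * 32 powr ?d"
  have c2: "0 < c2" using b A \<epsilon> by (simp add: c2_def)
  \<comment> \<open>\<open>2 * c2\<close> makes the remaining part fit into the other half of
    \<open>t\<close>. The power of 16 settles distances up to 4, where s \<le> 16 and the bound by 1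
    suffices.\<close>
  define t where "t = max (2 * c2) (16 powr (?d - \<alpha>))"
  have t: "0 < t" "c2 \<le> t / 2" "16 powr (?d - \<alpha>) \<le> t" using c2 by (auto simp: t_def)
  have "tau (pr K) V x y \<le> t * real s powr (- ?d + \<alpha>)"
    if K: "long_range a b \<alpha> K" and W: "\<And>m. 1 \<le> m \<Longrightarrow> ball_chi K m \<le> A * real m powr \<alpha>"
      and V: "finite V" "x \<in> V" "y \<in> V" and s: "1 \<le> s" "\<And>u v. u \<in> V \<Longrightarrow> v \<in> V \<Longrightarrow> nm (u - v) \<le> s"
        "s \<le> 4 * nm (y - x)" for a s V x y and K :: "int ^ 'n \<Rightarrow> int ^ 'n \<Rightarrow> real"
    using V s
  proof (induction s arbitrary: V x y rule: less_induct)
    case (less s)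
    let ?n = "nm (y - x)"
    have ns: "?n \<le> s" using less.prems by blast
    show ?case
    proof (cases "?n \<le> 4")
      case True
      then have "s \<le> 16" using less.prems(6) by simp
      then have "16 powr (- ?d + \<alpha>) \<le> real s powr (- ?d + \<alpha>)"
        using less.prems(4) \<alpha> by (intro powr_mono2') auto
      moreover have "1 = 16 powr (?d - \<alpha>) * 16 powr (- ?d + \<alpha>)" by (simp add: powr_add[symmetric])
      ultimately have "1 \<le> t * real s powr (- ?d + \<alpha>)"
        using t mult_mono[of "16 powr (?d - \<alpha>)" t "16 powr (- ?d + \<alpha>)" "real s powr (- ?d + \<alpha>)"] by simp
      then show ?thesis using tau_le_1[OF pvalid_pr[OF K] less.prems(1), of x y] by linarith
    next
      case False
      \<comment> \<open>Then \<open>y\<close> lies outside the ball of radius \<open>2 * h\<close>,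
        and balls of radius q \<le> 2 * h have diameter at most 4 * h < s, so the induction
        hypothesis covers them. Conversely s \<le> 4 * (4 * h + 4) \<le> 32 * h.\<close>
      define h where "h = (?n - 1) div 4"
      have h: "1 \<le> h" "4 * h < ?n" "?n \<le> 4 * h + 4" unfolding h_def using False by auto
      have s32: "s \<le> 32 * h" using less.prems(6) h by linarith
      have h0: "0 < real h" using h by simp
      have "tau (pr K) V x y \<le> tau (pr K) (V \<inter> nball x (2 * h)) x y
        + (t * b * (shell_const TYPE('n) / (1 - \<alpha>)) * \<epsilon> powr (1 - \<alpha>) + b * A * 2 powr \<alpha> * \<epsilon> powr (- ?d - \<alpha>))
          * real h powr (- ?d) * (\<Sum>v\<in>V. tau (pr K) V v y)"
      proof (rule exit_scaled[OF K \<alpha>(1,2) less.prems(1,2) h(1) _ _ \<epsilon>])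
        show "ball_chi K (2 * h) \<le> A * real (2 * h) powr \<alpha>" using W[of "2 * h"] h by simp
        fix q u assume q: "q \<in> {h<..2 * h}" "u \<in> V" "nm (u - x) \<le> q" "q \<le> 2 * nm (u - x)"
        have "tau (pr K) (V \<inter> nball x q) x u \<le> t * real (2 * q) powr (- ?d + \<alpha>)"
        proof (rule less.IH)
          show "2 * q < s" using q h ns by auto
          show "nm (v - v') \<le> 2 * q" if "v \<in> V \<inter> nball x q" "v' \<in> V \<inter> nball x q" for v v'
            using that nm_triangle_diff[of v v' x] nm_commute[of x v'] by (auto simp: nball_def)
        qed (use q less.prems in \<open>auto simp: nball_def\<close>)
        also have "\<dots> \<le> t * real h powr (- ?d + \<alpha>)"
          using q h0 t \<alpha> by (intro mult_left_mono powr_mono2') auto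
        finally show "tau (pr K) (V \<inter> nball x q) x u \<le> t * real h powr (- ?d + \<alpha>)" .
      qed (use A t in auto)
      also have "tau (pr K) (V \<inter> nball x (2 * h)) x y = 0"
        using less.prems h by (intro tau_outside) (auto simp: nball_def)
      also have "0 + (t * b * (shell_const TYPE('n) / (1 - \<alpha>)) * \<epsilon> powr (1 - \<alpha>) + b * A * 2 powr \<alpha> * \<epsilon> powr (- ?d - \<alpha>))
          * real h powr (- ?d) * (\<Sum>v\<in>V. tau (pr K) V v y)
        \<le> (t * c1 * \<epsilon> powr (1 - \<alpha>) + b * A * 2 powr \<alpha> * \<epsilon> powr (- ?d - \<alpha>))
          * (32 powr ?d * real s powr (- ?d)) * (A * real s powr \<alpha>)"
      proof -
        have "(\<Sum>v\<in>V. tau (pr K) V v y) \<le> ball_chi K s"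
          unfolding sum_tau_left using less.prems by (intro ball_chi_ge[OF K]) (auto simp: nball_def)
        also have "\<dots> \<le> A * real s powr \<alpha>" using W less.prems by simp
        finally have 1: "(\<Sum>v\<in>V. tau (pr K) V v y) \<le> A * real s powr \<alpha>" .
        have 2: "real h powr (- ?d) \<le> 32 powr ?d * real s powr (- ?d)"
        proof -
          have "(32 * real h) powr (- ?d) \<le> real s powr (- ?d)"
            using s32 less.prems(4) by (intro powr_mono2') auto
          then have "32 powr ?d * (32 powr (- ?d) * real h powr (- ?d)) \<le> 32 powr ?d * real s powr (- ?d)"
            using h0 by (intro mult_left_mono) (auto simp: powr_mult)
          moreover have "32 powr ?d * 32 powr (- ?d) = (1::real)" by (simp add: powr_add[symmetric])
          ultimately show ?thesis by (simp add: mult.assoc[symmetric])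
        qed
        have 3: "0 \<le> t * c1 * \<epsilon> powr (1 - \<alpha>) + b * A * 2 powr \<alpha> * \<epsilon> powr (- ?d - \<alpha>)"
          using t c1 b A by (intro add_nonneg_nonneg mult_nonneg_nonneg) auto
        have tc: "t * b * (shell_const TYPE('n) / (1 - \<alpha>)) = t * c1" by (simp only: c1_def mult.assoc)
        have 4: "0 \<le> (\<Sum>v\<in>V. tau (pr K) V v y)" by (intro sum_nonneg tau_nonneg pvalid_pr[OF K])
        have 5: "P * q * Y \<le> P * q' * Y'" if "0 \<le> P" "0 \<le> q" "q \<le> q'" "0 \<le> Y" "Y \<le> Y'" for P q q' Y Y' :: real
          using that by (intro mult_mono mult_left_mono mult_nonneg_nonneg) auto
        show ?thesis unfolding tc add_0 by (rule 5[OF 3 _ 2 4 1]) simp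
      qed
      also have "\<dots> = (t * (c1 * \<epsilon> powr (1 - \<alpha>) * A * 32 powr ?d) + c2) * real s powr (- ?d + \<alpha>)"
        unfolding powr_add[of "real s"] c2_def by (simp only: distrib_left distrib_right mult_ac)
      also have "\<dots> \<le> (t * (1 / 2) + t / 2) * real s powr (- ?d + \<alpha>)"
        using t \<epsilon>c by (intro mult_right_mono add_mono mult_left_mono) auto
      finally show ?thesis by simp
    qed
  qed
  then show ?thesis using t(1) that by blast
qed

text \<open>Starting from a ball of radius twice the distance, which \<open>local_upper\<close>
  controls, the volume is enlarged by doubling the radius. Each enlargement adds a term of order R
  powr (- d + \<alpha>), and these sum geometrically because \<alpha> < d.\<close>

theorem pointwise_upper:
  assumes \<alpha>: "0 < \<alpha>" "\<alpha> < 1" "\<alpha> < real CARD('n::finite)" and b: "0 < b" and A: "0 < A"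
  obtains D where "0 < D" "\<And>a (K :: int ^ 'n \<Rightarrow> int ^ 'n \<Rightarrow> real) V x y. long_range a b \<alpha> K \<Longrightarrow>
    (\<And>m. 1 \<le> m \<Longrightarrow> ball_chi K m \<le> A * real m powr \<alpha>) \<Longrightarrow> finite V \<Longrightarrow> x \<in> V \<Longrightarrow> y \<in> V \<Longrightarrow> x \<noteq> y \<Longrightarrow>
    tau (pr K) V x y \<le> D * real (nm (y - x)) powr (- real CARD('n) + \<alpha>)"
proof -
  let ?d = "real CARD('n)"
  obtain t where t: "0 < t" "\<And>a (K :: int ^ 'n \<Rightarrow> int ^ 'n \<Rightarrow> real) V x y s. long_range a b \<alpha> K \<Longrightarrow>
    (\<And>m. 1 \<le> m \<Longrightarrow> ball_chi K m \<le> A * real m powr \<alpha>) \<Longrightarrow> finite V \<Longrightarrow> x \<in> V \<Longrightarrow> y \<in> V \<Longrightarrow> 1 \<le> s \<Longrightarrow>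
    (\<And>u v. u \<in> V \<Longrightarrow> v \<in> V \<Longrightarrow> nm (u - v) \<le> s) \<Longrightarrow> s \<le> 4 * nm (y - x) \<Longrightarrow>
    tau (pr K) V x y \<le> t * real s powr (- ?d + \<alpha>)"
    using local_upper[OF \<alpha> b A] by blast
  define C where "C = (t * b * (shell_const TYPE('n) / (1 - \<alpha>)) * (1 / 2) powr (1 - \<alpha>)
    + b * A * 2 powr \<alpha> * (1 / 2) powr (- ?d - \<alpha>)) * (A * 8 powr \<alpha>)"
  have C0: "0 \<le> C" unfolding C_def
    using t b A \<alpha> shell_const_pos[where 'n = 'n]
    by (intro mult_nonneg_nonneg add_nonneg_nonneg divide_nonneg_nonneg) auto
  define z where "z = (2::real) powr (- ?d + \<alpha>)"
  have z: "0 < z" "z < 1" using \<alpha> by (auto simp: z_def powr_less_one)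
  define D where "D = t + C / (1 - z)"
  have main: "tau (pr K) V x y \<le> D * real (nm (y - x)) powr (- ?d + \<alpha>)"
    if K: "long_range a b \<alpha> K" and W: "\<And>m. 1 \<le> m \<Longrightarrow> ball_chi K m \<le> A * real m powr \<alpha>"
      and V: "finite V" "x \<in> V" "y \<in> V" "x \<noteq> y" for a V x y and K :: "int ^ 'n \<Rightarrow> int ^ 'n \<Rightarrow> real"
  proof -
    let ?n = "nm (y - x)"
    have n1: "1 \<le> ?n" using V nm_eq_0_iff[of "y - x"] by (cases ?n) auto
    define B where "B = (\<lambda>j. V \<inter> nball x (2 ^ Suc j * ?n))"
    have ball_diam: "nm (u - v) \<le> 2 * q" if "u \<in> nball x q" "v \<in> nball x q" for u v q
      using that nm_triangle_diff[of u v x] nm_commute[of x v] by (auto simp: nball_def)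
    have yn: "y \<in> nball x q" if "?n \<le> q" for q using that by (simp add: nball_def)
    have base: "tau (pr K) (B 0) x y \<le> t * real ?n powr (- ?d + \<alpha>)"
    proof -
      have "tau (pr K) (B 0) x y \<le> t * real (4 * ?n) powr (- ?d + \<alpha>)"
        using V n1 ball_diam[of _ "2 * ?n"] yn[of "2 * ?n"]
        by (intro t(2)[OF K W]) (auto simp: B_def nball_def)
      also have "\<dots> \<le> t * real ?n powr (- ?d + \<alpha>)"
        using t n1 \<alpha> by (intro mult_left_mono powr_mono2') auto
      finally show ?thesis .
    qed
    have step: "tau (pr K) (B (Suc j)) x y \<le> tau (pr K) (B j) x y + C * z ^ j * real ?n powr (- ?d + \<alpha>)" for j
    proof -
      define h where "h = 2 ^ j * ?n"
      have h: "1 \<le> h" using n1 by (simp add: h_def)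
      have Bj: "B (Suc j) \<inter> nball x (2 * h) = B j"
        unfolding B_def h_def by (auto simp: nball_def)
      have B8: "B (Suc j) = V \<inter> nball x (4 * h)" by (simp add: B_def h_def mult.assoc)
      have nh: "?n \<le> h" by (simp add: h_def)
      have "tau (pr K) (B (Suc j)) x y \<le> tau (pr K) (B (Suc j) \<inter> nball x (2 * h)) x y
        + (t * b * (shell_const TYPE('n) / (1 - \<alpha>)) * (1 / 2) powr (1 - \<alpha>) + b * A * 2 powr \<alpha> * (1 / 2) powr (- ?d - \<alpha>))
          * real h powr (- ?d) * (\<Sum>v\<in>B (Suc j). tau (pr K) (B (Suc j)) v y)"
      proof (rule exit_scaled[OF K \<alpha>(1,2) _ _ h])
        show "finite (B (Suc j))" "x \<in> B (Suc j)" using V by (auto simp: B_def nball_def)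
        show "ball_chi K (2 * h) \<le> A * real (2 * h) powr \<alpha>" using W[of "2 * h"] h by simp
        fix q u assume q: "q \<in> {h<..2 * h}" "u \<in> B (Suc j)" "nm (u - x) \<le> q" "q \<le> 2 * nm (u - x)"
        have "tau (pr K) (B (Suc j) \<inter> nball x q) x u \<le> t * real (2 * q) powr (- ?d + \<alpha>)"
          using q V h ball_diam[of _ q] by (intro t(2)[OF K W]) (auto simp: B_def nball_def)
        also have "\<dots> \<le> t * real h powr (- ?d + \<alpha>)"
          using q h t \<alpha> by (intro mult_left_mono powr_mono2') auto
        finally show "tau (pr K) (B (Suc j) \<inter> nball x q) x u \<le> t * real h powr (- ?d + \<alpha>)" .
      qed (use A t in auto)
      also have "\<dots> \<le> tau (pr K) (B j) x y
        + (t * b * (shell_const TYPE('n) / (1 - \<alpha>)) * (1 / 2) powr (1 - \<alpha>) + b * A * 2 powr \<alpha> * (1 / 2) powr (- ?d - \<alpha>))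
          * real h powr (- ?d) * (A * real (8 * h) powr \<alpha>)"
      proof -
        have "(\<Sum>v\<in>B (Suc j). tau (pr K) (B (Suc j)) v y) \<le> ball_chi K (8 * h)"
        proof -
          have "nm (v - y) \<le> 8 * h" if "v \<in> B (Suc j)" for v
            using ball_diam[of v "4 * h" y] that yn[of "4 * h"] nh by (auto simp: B8)
          then show ?thesis unfolding sum_tau_left by (intro ball_chi_ge[OF K]) (auto simp: nball_def)
        qed
        also have "\<dots> \<le> A * real (8 * h) powr \<alpha>" using W[of "8 * h"] h by simp
        finally show ?thesis unfolding Bj using t b A \<alpha> shell_const_pos[where 'n = 'n]
          by (intro add_left_mono mult_left_mono mult_nonneg_nonneg add_nonneg_nonneg divide_nonneg_nonneg) auto
      qed
      also have "\<dots> = tau (pr K) (B j) x y + C * (real h powr (- ?d) * real h powr \<alpha>)"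
        by (simp add: C_def powr_mult mult_ac)
      also have "real h powr (- ?d) * real h powr \<alpha> = real h powr (- ?d + \<alpha>)" by (rule powr_add[symmetric])
      also have "\<dots> = z ^ j * real ?n powr (- ?d + \<alpha>)"
      proof -
        have "(2 ^ j) powr (- ?d + \<alpha>) = z ^ j"
          by (simp add: z_def powr_realpow[symmetric] powr_powr powr_power mult.commute)
        then show ?thesis by (simp add: h_def powr_mult)
      qed
      finally show ?thesis by (simp add: mult.assoc)
    qed
    have all: "tau (pr K) (B j) x y \<le> (t + C * (\<Sum>i<j. z ^ i)) * real ?n powr (- ?d + \<alpha>)" for j
    proof (induction j)
      case 0
      then show ?case using base by simp
    next
      case (Suc j)
      then show ?case using step[of j] by (simp add: algebra_simps)
    qed
    have geo: "(\<Sum>i<j. z ^ i) \<le> 1 / (1 - z)" for j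
    proof -
      have "(\<Sum>i<j. z ^ i) \<le> (\<Sum>i. z ^ i)" using z by (intro sum_le_suminf) (auto intro: summable_geometric)
      then show ?thesis using z by (simp add: suminf_geometric)
    qed
    define J where "J = Max ((\<lambda>v. nm (v - x)) ` V)"
    have "V \<subseteq> nball x (2 ^ Suc J * ?n)"
    proof
      fix v assume "v \<in> V"
      then have "nm (v - x) \<le> J" unfolding J_def using V by (intro Max_ge) auto
      also have "\<dots> \<le> 2 ^ Suc J" using less_exp[of "Suc J"] by linarith
      also have "\<dots> \<le> 2 ^ Suc J * ?n" using n1 by simp
      finally show "v \<in> nball x (2 ^ Suc J * ?n)" by (simp add: nball_def)
    qed
    then have "B J = V" by (auto simp: B_def)
    then have "tau (pr K) V x y \<le> (t + C * (\<Sum>i<J. z ^ i)) * real ?n powr (- ?d + \<alpha>)" using all[of J] by simp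
    also have "\<dots> \<le> (t + C * (1 / (1 - z))) * real ?n powr (- ?d + \<alpha>)"
      by (intro mult_right_mono add_left_mono mult_left_mono geo C0) auto
    finally show ?thesis by (simp add: D_def)
  qed
  have "0 < D" unfolding D_def using t C0 z by (intro add_pos_nonneg divide_nonneg_nonneg) auto
  then show ?thesis using main that by blast
qed

section \<open>Susceptibility and the regime beyond the correlation length\<close>

definition exit_const :: "'n itself \<Rightarrow> real \<Rightarrow> real" where
  "exit_const _ \<alpha> = shell_const TYPE('n) * (1 + 1 / \<alpha> + 1 / (1 - \<alpha>))"

lemma exit_const_pos: "0 < \<alpha> \<Longrightarrow> \<alpha> < 1 \<Longrightarrow> 0 < exit_const TYPE('n::finite) \<alpha>"
  unfolding exit_const_def by (intro mult_pos_pos shell_const_pos add_pos_pos) auto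

lemma averaged_exit_tau:
  fixes K :: "int ^ 'n \<Rightarrow> int ^ 'n \<Rightarrow> real"
  assumes K: "long_range a b \<alpha> K" and V: "finite V" "x \<in> V" and h: "1 \<le> h"
  shows "real h * tau (pr K) V x y \<le> real h * tau (pr K) (V \<inter> nball x (2 * h)) x y
    + (\<Sum>u\<in>V \<inter> nball x (2 * h). tau (pr K) (V \<inter> nball x (2 * h)) x u * (b * (\<Sum>v\<in>V - {u}.
        real (nm (v - u)) powr (- real CARD('n) - \<alpha>) * real (min (nm (v - u)) h) * tau (pr K) V v y)))"
proof -
  have "real h * tau (pr K) V x y \<le> real h * tau (pr K) (V \<inter> nball x (2 * h)) x y
    + (\<Sum>u\<in>V \<inter> nball x (2 * h). \<Sum>v\<in>V - {u}. tau (pr K) (V \<inter> nball x (2 * h)) x u *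
        (b * (real (nm (v - u)) powr (- real CARD('n) - \<alpha>) * real (min (nm (v - u)) h))) * tau (pr K) V v y)"
  proof (rule averaged_exit[OF K V h])
    fix s u v assume "s \<in> {h<..2 * h}"
    then have "V \<inter> nball x s \<subseteq> V \<inter> nball x (2 * h)" by (auto simp: nball_def)
    then show "tau (pr K) (V \<inter> nball x s) x u \<le> tau (pr K) (V \<inter> nball x (2 * h)) x u"
      using V by (intro tau_mono pvalid_pr[OF K]) auto
  qed (rule tau_nonneg[OF pvalid_pr[OF K]])
  then show ?thesis by (simp add: sum_distrib_left mult.assoc)
qed

lemma sum_min_le_exit_const:
  fixes V :: "(int ^ 'n) set"
  assumes "finite V" "1 \<le> h" "0 < \<alpha>" "\<alpha> < 1"
  shows "(\<Sum>v\<in>V - {u}. real (nm (v - u)) powr (- real CARD('n) - \<alpha>) * real (min (nm (v - u)) h))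
    \<le> exit_const TYPE('n) \<alpha> * real h powr (1 - \<alpha>)"
  unfolding exit_const_def using assms by (intro sum_min_le) auto

definition vol_chi :: "(int ^ 'n \<Rightarrow> int ^ 'n \<Rightarrow> real) \<Rightarrow> (int ^ 'n) set \<Rightarrow> int ^ 'n \<Rightarrow> real" where
  "vol_chi K V x = (\<Sum>y\<in>V. tau (pr K) V x y)"

text \<open>A finite volume is not translation invariant. Starting from a maximising vertex replaces
  this: the right side of an exit inequality is then bounded by the quantity being estimated and can
  be absorbed.\<close>

lemma vol_chi_max:
  fixes V :: "(int ^ 'n) set"
  assumes "finite V" "V \<noteq> {}"
  obtains x where "x \<in> V" "\<And>v. v \<in> V \<Longrightarrow> vol_chi K V v \<le> vol_chi K V x"
proof -
  have "Max (vol_chi K V ` V) \<in> vol_chi K V ` V" using assms by (intro Max_in) auto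
  then obtain x where "x \<in> V" "Max (vol_chi K V ` V) = vol_chi K V x" by auto
  then show ?thesis using that Max_ge[of "vol_chi K V ` V"] assms by (metis finite_imageI imageI)
qed

text \<open>The exit bound with the singleton \<open>{x}\<close>: the expected number of open edges
  at a vertex is at most 1 / 2, so the maximum is at most 1 plus half of itself.\<close>

lemma vol_chi_small:
  fixes K :: "int ^ 'n \<Rightarrow> int ^ 'n \<Rightarrow> real"
  assumes K: "long_range a b \<alpha> K" "0 < \<alpha>" and b: "b * (shell_const TYPE('n) * (1 + 1 / \<alpha>)) \<le> 1 / 2"
    and V: "finite V" "z \<in> V"
  shows "vol_chi K V z \<le> 2"
proof -
  note p = pvalid_pr[OF K(1)]
  have b0: "0 \<le> b" using K by (simp add: long_range_def)
  have "V \<noteq> {}" using V by auto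
  then obtain x where x: "x \<in> V" "\<And>v. v \<in> V \<Longrightarrow> vol_chi K V v \<le> vol_chi K V x" using vol_chi_max[OF V(1)] by blast
  have sx0: "0 \<le> vol_chi K V x" unfolding vol_chi_def by (intro sum_nonneg tau_nonneg p)
  have "tau (pr K) V x y \<le> of_bool (y = x) + (\<Sum>v\<in>V - {x}. pr K {x, v} * tau (pr K) V v y)" for y
  proof -
    have "tau (pr K) V x y \<le> tau (pr K) {x} x y
        + (\<Sum>u\<in>{x}. \<Sum>v\<in>V - {x}. tau (pr K) {x} x u * pr K {u, v} * tau (pr K) V v y)"
      using V x by (intro tau_exit p) auto
    moreover have "tau (pr K) {x} x y = of_bool (y = x)"
      by (cases "y = x") (simp_all add: tau_self tau_outside)
    ultimately show ?thesis by (simp add: tau_self)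
  qed
  then have "vol_chi K V x \<le> (\<Sum>y\<in>V. of_bool (y = x) + (\<Sum>v\<in>V - {x}. pr K {x, v} * tau (pr K) V v y))"
    unfolding vol_chi_def by (intro sum_mono)
  also have "\<dots> = 1 + (\<Sum>v\<in>V - {x}. pr K {x, v} * vol_chi K V v)"
  proof -
    have "(\<Sum>y\<in>V. \<Sum>v\<in>V - {x}. pr K {x, v} * tau (pr K) V v y) = (\<Sum>v\<in>V - {x}. pr K {x, v} * vol_chi K V v)"
      unfolding vol_chi_def by (subst sum.swap) (simp add: sum_distrib_left)
    moreover have "(\<Sum>y\<in>V. of_bool (y = x) :: real) = 1" using V x by (simp add: of_bool_def)
    ultimately show ?thesis by (simp add: sum.distrib)
  qed
  also have "(\<Sum>v\<in>V - {x}. pr K {x, v} * vol_chi K V v)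
      \<le> (\<Sum>v\<in>V - {x}. (b * real (nm (v - x)) powr (- real CARD('n) - \<alpha>)) * vol_chi K V x)"
    using x p b0 by (intro sum_mono mult_mono pr_le[OF K(1)])
      (auto simp: pvalid_def vol_chi_def intro!: sum_nonneg tau_nonneg p)
  also have "\<dots> = b * (\<Sum>v\<in>V - {x}. real (nm (v - x)) powr (- real CARD('n) - \<alpha>)) * vol_chi K V x"
    by (simp add: sum_distrib_left sum_distrib_right)
  also have "\<dots> \<le> b * (shell_const TYPE('n) * (1 + 1 / \<alpha>) * real 1 powr (- \<alpha>)) * vol_chi K V x"
  proof (intro mult_right_mono mult_left_mono sum_far_le)
    fix v assume "v \<in> V - {x}"
    then show "1 \<le> nm (v - x)" using nm_eq_0_iff[of "v - x"] by (cases "nm (v - x)") auto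
  qed (use V K b0 sx0 in auto)
  also have "\<dots> \<le> 1 / 2 * vol_chi K V x" using b sx0 by (intro mult_right_mono) auto
  finally have "vol_chi K V x \<le> 2" by simp
  then show ?thesis using x(2)[OF V(2)] by linarith
qed

text \<open>If the boxes of radius between \<open>h\<close> and \<open>2 * h\<close> have on average few open edges at the boundary of
  the cluster of their centre, then the susceptibility is finite and carried by the box of radius \<open>2 * h\<close>.\<close>

lemma vol_chi_le_ball_chi:
  fixes K :: "int ^ 'n \<Rightarrow> int ^ 'n \<Rightarrow> real"
  assumes K: "long_range a b \<alpha> K" and \<alpha>: "0 < \<alpha>" "\<alpha> < 1" and h: "1 \<le> h"
    and W: "4 * b * exit_const TYPE('n) \<alpha> * ball_chi K (2 * h) \<le> real h powr \<alpha>" and V: "finite V" "z \<in> V"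
  shows "vol_chi K V z \<le> 4 / 3 * ball_chi K (2 * h)"
proof -
  note p = pvalid_pr[OF K(1)]
  have b0: "0 \<le> b" using K by (simp add: long_range_def)
  have h0: "0 < real h" using h by simp
  have "V \<noteq> {}" using V by auto
  then obtain x where x: "x \<in> V" "\<And>v. v \<in> V \<Longrightarrow> vol_chi K V v \<le> vol_chi K V x" using vol_chi_max[OF V(1)] by blast
  have s0: "0 \<le> vol_chi K V v" for v unfolding vol_chi_def by (intro sum_nonneg tau_nonneg p)
  let ?V2 = "V \<inter> nball x (2 * h)" and ?d = "real CARD('n)"
  let ?w = "\<lambda>u v. real (nm (v - u)) powr (- ?d - \<alpha>) * real (min (nm (v - u)) h)"
  have "real h * vol_chi K V x = (\<Sum>y\<in>V. real h * tau (pr K) V x y)"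
    by (simp add: vol_chi_def sum_distrib_left)
  also have "\<dots> \<le> (\<Sum>y\<in>V. real h * tau (pr K) ?V2 x y
    + (\<Sum>u\<in>?V2. tau (pr K) ?V2 x u * (b * (\<Sum>v\<in>V - {u}. ?w u v * tau (pr K) V v y))))"
    by (intro sum_mono averaged_exit_tau[OF K V(1) x(1) h])
  also have "\<dots> = real h * (\<Sum>y\<in>V. tau (pr K) ?V2 x y)
    + (\<Sum>u\<in>?V2. tau (pr K) ?V2 x u * (b * (\<Sum>v\<in>V - {u}. ?w u v * vol_chi K V v)))"
  proof -
    have 1: "(\<Sum>y\<in>V. \<Sum>v\<in>V - {u}. ?w u v * tau (pr K) V v y) = (\<Sum>v\<in>V - {u}. ?w u v * vol_chi K V v)" for u
      unfolding vol_chi_def by (subst sum.swap) (simp add: sum_distrib_left)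
    have "(\<Sum>y\<in>V. \<Sum>u\<in>?V2. tau (pr K) ?V2 x u * (b * (\<Sum>v\<in>V - {u}. ?w u v * tau (pr K) V v y)))
      = (\<Sum>u\<in>?V2. tau (pr K) ?V2 x u * (b * (\<Sum>v\<in>V - {u}. ?w u v * vol_chi K V v)))"
      by (subst sum.swap) (simp only: sum_distrib_left[symmetric] 1)
    then show ?thesis by (simp add: sum.distrib sum_distrib_left)
  qed
  also have "(\<Sum>y\<in>V. tau (pr K) ?V2 x y) = (\<Sum>y\<in>?V2. tau (pr K) ?V2 x y)"
    using V x by (intro sum.mono_neutral_right) (auto intro: tau_outside simp: nball_def)
  also have "\<dots> \<le> ball_chi K (2 * h)" by (intro ball_chi_ge[OF K]) auto
  also have "(\<Sum>u\<in>?V2. tau (pr K) ?V2 x u * (b * (\<Sum>v\<in>V - {u}. ?w u v * vol_chi K V v)))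
      \<le> (\<Sum>u\<in>?V2. tau (pr K) ?V2 x u * (b * (exit_const TYPE('n) \<alpha> * real h powr (1 - \<alpha>) * vol_chi K V x)))"
  proof (intro sum_mono mult_left_mono b0 tau_nonneg p)
    fix u
    have "(\<Sum>v\<in>V - {u}. ?w u v * vol_chi K V v) \<le> (\<Sum>v\<in>V - {u}. ?w u v * vol_chi K V x)"
      using x by (intro sum_mono mult_left_mono) auto
    also have "\<dots> = (\<Sum>v\<in>V - {u}. ?w u v) * vol_chi K V x" by (simp add: sum_distrib_right)
    also have "\<dots> \<le> exit_const TYPE('n) \<alpha> * real h powr (1 - \<alpha>) * vol_chi K V x"
      by (intro mult_right_mono sum_min_le_exit_const V h \<alpha> s0)
    finally show "(\<Sum>v\<in>V - {u}. ?w u v * vol_chi K V v) \<le> exit_const TYPE('n) \<alpha> * real h powr (1 - \<alpha>) * vol_chi K V x" .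
  qed
  also have "\<dots> = (\<Sum>u\<in>?V2. tau (pr K) ?V2 x u) * (b * (exit_const TYPE('n) \<alpha> * real h powr (1 - \<alpha>) * vol_chi K V x))"
    by (rule sum_distrib_right[symmetric])
  also have "\<dots> \<le> ball_chi K (2 * h) * (b * (exit_const TYPE('n) \<alpha> * real h powr (1 - \<alpha>) * vol_chi K V x))"
    using b0 s0 exit_const_pos[OF \<alpha>, where 'n = 'n]
    by (intro mult_right_mono ball_chi_ge[OF K] mult_nonneg_nonneg) auto
  also have "\<dots> = (4 * b * exit_const TYPE('n) \<alpha> * ball_chi K (2 * h)) * (real h powr (1 - \<alpha>) * vol_chi K V x / 4)" by simp
  also have "\<dots> \<le> real h powr \<alpha> * (real h powr (1 - \<alpha>) * vol_chi K V x / 4)"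
    using s0 by (intro mult_right_mono W) auto
  also have "\<dots> = real h * (vol_chi K V x / 4)"
  proof -
    have "real h powr \<alpha> * real h powr (1 - \<alpha>) = real h" using h0 by (simp add: powr_add[symmetric])
    then show ?thesis by (simp add: mult.assoc[symmetric])
  qed
  finally have "real h * vol_chi K V x \<le> real h * (ball_chi K (2 * h) + vol_chi K V x / 4)"
    using h0 by (simp add: distrib_left)
  \<comment> \<open>Absorbing the quarter gives the factor 4 / 3. That it is below 2 is what allows
    the comparison with half of the susceptibility in the correlation length.\<close>
  then have "vol_chi K V x \<le> ball_chi K (2 * h) + vol_chi K V x / 4" using h0 by simp
  then show ?thesis using x(2)[OF V(2)] by simp
qed

text \<open>The balls of radius \<open>r\<close> around 0 and \<open>x\<close> are disjoint, edges
  between them have length at most \<open>2 * nm x\<close>, and they are cubes of side 2 * r + 1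
  \<le> nm x. So clusters truncated in these cubes are still in the linear regime of merging at
  distance \<open>nm x\<close>.\<close>

lemma pointwise_lower:
  assumes \<alpha>: "0 < \<alpha>" "\<alpha> < real CARD('n::finite)" and a: "0 < a"
  obtains \<kappa> where "0 < \<kappa>" "\<And>b (K :: int ^ 'n \<Rightarrow> int ^ 'n \<Rightarrow> real) x r. long_range a b \<alpha> K \<Longrightarrow> \<not> percolates K \<Longrightarrow>
    2 * r < nm x \<Longrightarrow>
    \<kappa> * real (nm x) powr (- real CARD('n) - \<alpha>) * (ball_chi K r)\<^sup>2 \<le> tau (pr K) (nball 0 (2 * nm x)) 0 x"
proof -
  let ?d = "real CARD('n)"
  obtain H where H: "0 < H" "\<And>b (K :: int ^ 'n \<Rightarrow> int ^ 'n \<Rightarrow> real) r. long_range a b \<alpha> K \<Longrightarrow>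
    \<not> percolates K \<Longrightarrow> 1 \<le> r \<Longrightarrow>
    \<exists>l\<ge>1. max_cluster_tail (pr K) (lbox 0 r) l \<le> 1 / 27 \<and> (3 * real l)\<^sup>2 \<le> H * real r powr (?d + \<alpha>)"
    using truncation_level[OF \<alpha> a] by blast
  define \<kappa> where "\<kappa> = a * 2 powr (- ?d - \<alpha>) / (4 * (1 + a * H))"
  have \<kappa>: "0 < \<kappa>" unfolding \<kappa>_def using a H(1) by (intro divide_pos_pos mult_pos_pos add_pos_pos) auto
  have "\<kappa> * real (nm x) powr (- ?d - \<alpha>) * (ball_chi K r)\<^sup>2 \<le> tau (pr K) (nball 0 (2 * nm x)) 0 x"
    if K: "long_range a b \<alpha> K" "\<not> percolates K" and r: "2 * r < nm x"
    for b x r and K :: "int ^ 'n \<Rightarrow> int ^ 'n \<Rightarrow> real"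
  proof -
    let ?n = "nm x"
    have n0: "0 < real ?n" using r by simp
    obtain l where l: "1 \<le> l" "max_cluster_tail (pr K) (lbox 0 (2 * r + 1)) l \<le> 1 / 27"
      "(3 * real l)\<^sup>2 \<le> H * real (2 * r + 1) powr (?d + \<alpha>)"
      using H(2)[OF K, of "2 * r + 1"] by auto
    have pm: "max_cluster_tail (pr K) (nball u r) l \<le> 1 / 27" for u
      unfolding nball_eq_lbox max_cluster_tail_lbox[OF K(1), of "u - (\<chi> i. int r)"] by (rule l(2))
    define q where "q = a * real (2 * ?n) powr (- ?d - \<alpha>)"
    have q0: "0 \<le> q" using a by (simp add: q_def)
    have qH: "q * (3 * real l)\<^sup>2 \<le> a * H"
    proof -
      have "q * (3 * real l)\<^sup>2 \<le> (a * real ?n powr (- ?d - \<alpha>)) * (H * real ?n powr (?d + \<alpha>))"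
      proof (intro mult_mono)
        show "q \<le> a * real ?n powr (- ?d - \<alpha>)"
          unfolding q_def using a n0 \<alpha> by (intro mult_left_mono powr_mono2') auto
        have "real (2 * r + 1) powr (?d + \<alpha>) \<le> real ?n powr (?d + \<alpha>)"
          using r \<alpha> by (intro powr_mono2) auto
        then show "(3 * real l)\<^sup>2 \<le> H * real ?n powr (?d + \<alpha>)"
          using l(3) H(1) by (meson mult_left_mono order_trans less_imp_le)
      qed (use a in auto)
      also have "\<dots> = a * H * (real ?n powr (- ?d - \<alpha>) * real ?n powr (?d + \<alpha>))" by simp
      also have "real ?n powr (- ?d - \<alpha>) * real ?n powr (?d + \<alpha>) = 1"
        using n0 by (simp add: powr_add[symmetric])
      finally show ?thesis by simp
    qed
    have "\<kappa> * real ?n powr (- ?d - \<alpha>) = q / (4 * (1 + a * H))"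
      by (simp add: q_def \<kappa>_def powr_mult)
    also have "\<dots> \<le> q / (4 * (1 + q * (3 * real l)\<^sup>2))"
      using q0 qH by (intro divide_left_mono mult_left_mono add_left_mono mult_pos_pos)
        (auto intro!: add_pos_nonneg mult_nonneg_nonneg order_trans[OF _ qH])
    finally have "\<kappa> * real ?n powr (- ?d - \<alpha>) * (ball_chi K r)\<^sup>2
        \<le> q / (4 * (1 + q * (3 * real l)\<^sup>2)) * (ball_chi K r)\<^sup>2" by (intro mult_right_mono) auto
    also have "\<dots> = q / (4 * (1 + q * (3 * real l)\<^sup>2)) * (\<Sum>z\<in>nball 0 r. tau (pr K) (nball 0 r) 0 z)
        * (\<Sum>z\<in>nball x r. tau (pr K) (nball x r) x z)"
      by (simp only: ball_chi_center[OF K(1)] power2_eq_square mult.assoc)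
    also have "\<dots> \<le> tau (pr K) (nball 0 (2 * ?n)) 0 x"
    proof (rule tau_merge_truncated[OF pvalid_pr[OF K(1)] finite_nball])
      have tri: "nm u \<le> ?n + nm (u - x)" "?n \<le> nm (u - x) + nm u" for u
        using nm_triangle[of "u - x" x] nm_triangle[of "x - u" u] nm_commute[of x u] by auto
      show "nball 0 r \<subseteq> nball 0 (2 * ?n)" using r by (intro nball_mono) simp
      show "nball x r \<subseteq> nball 0 (2 * ?n)"
      proof
        fix u assume "u \<in> nball x r"
        then have "nm u \<le> 2 * ?n" using tri(1)[of u] r by (simp add: nball_def)
        then show "u \<in> nball 0 (2 * ?n)" by (simp add: nball_def)
      qed
      have sep: False if "u \<in> nball 0 r" "u \<in> nball x r" for u
        using that tri(2)[of u] r by (auto simp: nball_def)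
      then show "nball 0 r \<inter> nball x r = {}" by blast
      fix u v :: "int ^ 'n" assume uv: "u \<in> nball 0 r" "v \<in> nball x r"
      have "nm (v - u) \<le> nm v + nm u" using nm_triangle[of v "- u"] by (simp add: nm_minus)
      then have "nm (v - u) \<le> 2 * ?n" using uv tri(1)[of v] r by (auto simp: nball_def)
      moreover have "u \<noteq> v" using sep uv by blast
      ultimately show "1 - exp (- q) \<le> pr K {u, v}"
        unfolding q_def by (intro pr_ge[OF K(1) \<alpha>(1)])
    qed (use pm q0 l(1) in \<open>auto simp: mem_nball\<close>)
    finally show ?thesis .
  qed
  then show ?thesis using \<kappa> that by blast
qed

text \<open>Up to a multiple of \<xi> the near bound suffices, because n powr (2 * \<alpha>) is at
  most of order \<open>X\<^sup>2\<close> there. Farther out, a short exit edge leads back to the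
  same bound at a fixed fraction of the distance, with a coefficient proportional to X * n powr (-
  \<alpha>) that is small beyond \<xi>. A long exit edge costs its own probability and a
  susceptibility on each side.\<close>

theorem upper_beyond:
  assumes \<alpha>: "0 < \<alpha>" "\<alpha> < 1" "\<alpha> < real CARD('n::finite)" and b: "0 < b" and D: "0 < D" and c: "0 < c5" "0 < C5"
  obtains G where "0 < G" "\<And>a (K :: int ^ 'n \<Rightarrow> int ^ 'n \<Rightarrow> real) X \<xi> V x y. long_range a b \<alpha> K \<Longrightarrow>
    (\<And>V x y. finite V \<Longrightarrow> x \<in> V \<Longrightarrow> y \<in> V \<Longrightarrow> x \<noteq> y \<Longrightarrow>
      tau (pr K) V x y \<le> D * real (nm (y - x)) powr (- real CARD('n) + \<alpha>)) \<Longrightarrow>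
    (\<And>V x. finite V \<Longrightarrow> x \<in> V \<Longrightarrow> vol_chi K V x \<le> X) \<Longrightarrow> 1 \<le> \<xi> \<Longrightarrow>
    c5 * \<xi> powr \<alpha> \<le> X \<Longrightarrow> X \<le> C5 * \<xi> powr \<alpha> \<Longrightarrow> finite V \<Longrightarrow> x \<in> V \<Longrightarrow> y \<in> V \<Longrightarrow> x \<noteq> y \<Longrightarrow>
    tau (pr K) V x y \<le> G * X\<^sup>2 * real (nm (y - x)) powr (- real CARD('n) - \<alpha>)"
proof -
  let ?d = "real CARD('n)"
  define c1 where "c1 = b * exit_const TYPE('n) \<alpha> * 8 powr \<alpha> * 4 powr (?d + \<alpha>) * C5"
  have c1: "0 < c1" using b c exit_const_pos[OF \<alpha>(1,2), where 'n = 'n] by (simp add: c1_def)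
  \<comment> \<open>The power makes the coefficient of the recursive term small enough beyond
    \<open>B * \<xi>\<close>; the 4 ensures n \<ge> 4 there, hence h \<ge> 1.\<close>
  define B where "B = max 4 ((2 * c1) powr (1 / \<alpha>))"
  have B4: "4 \<le> B" by (simp add: B_def)
  have Bc: "c1 * B powr (- \<alpha>) \<le> 1 / 2"
  proof -
    have "2 * c1 = ((2 * c1) powr (1 / \<alpha>)) powr \<alpha>" using \<alpha> c1 by (simp add: powr_powr)
    also have "\<dots> \<le> B powr \<alpha>" using \<alpha> by (intro powr_mono2) (auto simp: B_def)
    finally have "2 * c1 * B powr (- \<alpha>) \<le> B powr \<alpha> * B powr (- \<alpha>)" by (intro mult_right_mono) auto
    also have "\<dots> = 1" using B4 by (simp add: powr_add[symmetric])
    finally show ?thesis by simp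
  qed
  define G where "G = max (2 * b * 8 powr (?d + \<alpha>)) (D * B powr (2 * \<alpha>) / c5\<^sup>2)"
  have G: "0 < G" "b * 8 powr (?d + \<alpha>) \<le> G / 2" "D * B powr (2 * \<alpha>) / c5\<^sup>2 \<le> G"
    using b by (auto simp: G_def intro: less_le_trans[of _ "2 * b * 8 powr (?d + \<alpha>)"])
  have main: "tau (pr K) V x y \<le> G * X\<^sup>2 * real (nm (y - x)) powr (- ?d - \<alpha>)"
    if K: "long_range a b \<alpha> K" and
      U: "\<And>V x y. finite V \<Longrightarrow> x \<in> V \<Longrightarrow> y \<in> V \<Longrightarrow> x \<noteq> y \<Longrightarrow>
        tau (pr K) V x y \<le> D * real (nm (y - x)) powr (- ?d + \<alpha>)" and
      X: "\<And>V x. finite V \<Longrightarrow> x \<in> V \<Longrightarrow> vol_chi K V x \<le> X" and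
      \<xi>: "1 \<le> \<xi>" "c5 * \<xi> powr \<alpha> \<le> X" "X \<le> C5 * \<xi> powr \<alpha>" and
      V: "finite V" "x \<in> V" "y \<in> V" "x \<noteq> y"
    for a X \<xi> V x y and K :: "int ^ 'n \<Rightarrow> int ^ 'n \<Rightarrow> real"
  proof -
    note p = pvalid_pr[OF K]
    have t0: "0 \<le> tau (pr K) W u v" for W u v by (rule tau_nonneg[OF p])
    have X0: "0 < X"
    proof -
      have "0 < c5 * \<xi> powr \<alpha>" using c \<xi> by simp
      then show ?thesis using \<xi>(2) by linarith
    qed
    \<comment> \<open>Stated for pairs at distance at least \<open>n\<close>, because after a short
      exit edge the remaining distance is only bounded below.\<close>
    have claim: "\<forall>x\<in>V. \<forall>y\<in>V. n \<le> nm (y - x) \<longrightarrow> tau (pr K) V x y \<le> G * X\<^sup>2 * real n powr (- ?d - \<alpha>)"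
      if "1 \<le> n" for n using that
    proof (induction n rule: less_induct)
      case (less n)
      show ?case
      proof (intro ballI impI)
        fix x y assume xy: "x \<in> V" "y \<in> V" "n \<le> nm (y - x)"
        have n0: "0 < real n" using less.prems by simp
        show "tau (pr K) V x y \<le> G * X\<^sup>2 * real n powr (- ?d - \<alpha>)"
        proof (cases "real n \<le> B * \<xi>")
          case True
          have "x \<noteq> y" using xy less.prems by auto
          then have "tau (pr K) V x y \<le> D * real (nm (y - x)) powr (- ?d + \<alpha>)"
            using U V(1) xy by blast
          also have "\<dots> \<le> D * real n powr (- ?d + \<alpha>)"
            using D n0 xy \<alpha> by (intro mult_left_mono powr_mono2') auto
          also have "real n powr (- ?d + \<alpha>) = real n powr (2 * \<alpha>) * real n powr (- ?d - \<alpha>)"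
            by (simp add: powr_add[symmetric])
          also have "D * (real n powr (2 * \<alpha>) * real n powr (- ?d - \<alpha>))
              \<le> D * ((B * \<xi>) powr (2 * \<alpha>) * real n powr (- ?d - \<alpha>))"
            using D True \<alpha> by (intro mult_left_mono mult_right_mono powr_mono2) auto
          also have "\<dots> = D * B powr (2 * \<alpha>) / c5\<^sup>2 * (c5 * \<xi> powr \<alpha>)\<^sup>2 * real n powr (- ?d - \<alpha>)"
          proof -
            have "\<xi> powr (2 * \<alpha>) = (\<xi> powr \<alpha>)\<^sup>2" using \<xi> by (simp add: powr_power mult.commute)
            then show ?thesis using B4 \<xi> c by (simp add: powr_mult power_mult_distrib)
          qed
          also have "\<dots> \<le> G * X\<^sup>2 * real n powr (- ?d - \<alpha>)"
            using G c \<xi> by (intro mult_right_mono mult_mono power_mono) auto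
          finally show ?thesis .
        next
          case False
          have nB: "B * \<xi> \<le> real n" using False by simp
          have "4 \<le> B * \<xi>" using mult_mono[OF B4 \<xi>(1)] B4 by simp
          then have n4: "4 \<le> n" using nB by linarith
          define h where "h = n div 4"
          have h: "1 \<le> h" "4 * h \<le> n" "n < 4 * h + 4" unfolding h_def using n4 by auto
          have h0: "0 < real h" using h by simp
          \<comment> \<open>What remains of the distance after leaving from within radius
            \<open>2 * h\<close> by an edge of length at most \<open>h\<close>.\<close>
          define m where "m = n - 3 * h"
          have m: "1 \<le> m" "m < n" "n \<le> 4 * m" using h by (auto simp: m_def)
          let ?V2 = "V \<inter> nball x (2 * h)"
          let ?w = "\<lambda>u v. real (nm (v - u)) powr (- ?d - \<alpha>) * real (min (nm (v - u)) h)"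
          define Q where "Q = G * X\<^sup>2 * real m powr (- ?d - \<alpha>)"
          have Q0: "0 \<le> Q" unfolding Q_def using G X0 by (intro mult_nonneg_nonneg) auto
          have Q4: "Q \<le> G * X\<^sup>2 * (4 powr (?d + \<alpha>) * real n powr (- ?d - \<alpha>))"
          proof -
            have "(4 * real m) powr (- ?d - \<alpha>) \<le> real n powr (- ?d - \<alpha>)"
              using m n0 \<alpha> by (intro powr_mono2') auto
            then have "4 powr (?d + \<alpha>) * (4 powr (- ?d - \<alpha>) * real m powr (- ?d - \<alpha>))
                \<le> 4 powr (?d + \<alpha>) * real n powr (- ?d - \<alpha>)"
              by (intro mult_left_mono) (auto simp: powr_mult)
            moreover have "4 powr (?d + \<alpha>) * 4 powr (- ?d - \<alpha>) = (1::real)" by (simp add: powr_add[symmetric])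
            ultimately have "real m powr (- ?d - \<alpha>) \<le> 4 powr (?d + \<alpha>) * real n powr (- ?d - \<alpha>)"
              by (simp add: mult.assoc[symmetric])
            then show ?thesis unfolding Q_def using G by (intro mult_left_mono mult_nonneg_nonneg) auto
          qed
          have inner: "(\<Sum>v\<in>V - {u}. ?w u v * tau (pr K) V v y)
              \<le> exit_const TYPE('n) \<alpha> * real h powr (1 - \<alpha>) * Q + real h powr (- ?d - \<alpha>) * real h * X"
            if u: "u \<in> ?V2" for u
          proof -
            have "(\<Sum>v\<in>V - {u}. ?w u v * tau (pr K) V v y)
                \<le> (\<Sum>v\<in>V - {u}. ?w u v * Q + real h powr (- ?d - \<alpha>) * real h * tau (pr K) V v y)"
            proof (intro sum_mono)
              fix v assume v: "v \<in> V - {u}"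
              show "?w u v * tau (pr K) V v y \<le> ?w u v * Q + real h powr (- ?d - \<alpha>) * real h * tau (pr K) V v y"
              proof (cases "nm (v - u) \<le> h")
                case True
                have "nm (y - x) \<le> nm (y - v) + (nm (v - u) + nm (u - x))"
                  using nm_triangle_diff[of y x v] nm_triangle_diff[of v x u] by linarith
                then have "m \<le> nm (y - v)" using u xy(3) True by (auto simp: m_def nball_def)
                then have "tau (pr K) V v y \<le> Q"
                  using less.IH[OF m(2,1)] v xy by (auto simp: Q_def)
                then have "?w u v * tau (pr K) V v y \<le> ?w u v * Q" by (intro mult_left_mono) auto
                moreover have "0 \<le> real h powr (- ?d - \<alpha>) * real h * tau (pr K) V v y"
                  by (intro mult_nonneg_nonneg t0) auto
                ultimately show ?thesis by linarith
              next
                case False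
                then have "real (nm (v - u)) powr (- ?d - \<alpha>) \<le> real h powr (- ?d - \<alpha>)"
                  using h0 \<alpha> by (intro powr_mono2') auto
                then have "?w u v * tau (pr K) V v y \<le> real h powr (- ?d - \<alpha>) * real h * tau (pr K) V v y"
                  by (intro mult_right_mono mult_mono t0) auto
                moreover have "0 \<le> ?w u v * Q" using Q0 by simp
                ultimately show ?thesis by linarith
              qed
            qed
            also have "\<dots> = (\<Sum>v\<in>V - {u}. ?w u v) * Q + real h powr (- ?d - \<alpha>) * real h * (\<Sum>v\<in>V - {u}. tau (pr K) V v y)"
              by (simp add: sum.distrib sum_distrib_left sum_distrib_right)
            also have "\<dots> \<le> exit_const TYPE('n) \<alpha> * real h powr (1 - \<alpha>) * Q + real h powr (- ?d - \<alpha>) * real h * X"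
            proof (intro add_mono mult_right_mono mult_left_mono Q0 sum_min_le_exit_const V h \<alpha>)
              have "(\<Sum>v\<in>V - {u}. tau (pr K) V v y) \<le> (\<Sum>v\<in>V. tau (pr K) V v y)"
                using V by (intro sum_mono2 t0) auto
              also have "\<dots> = vol_chi K V y" unfolding sum_tau_left vol_chi_def ..
              also have "\<dots> \<le> X" using X V xy by blast
              finally show "(\<Sum>v\<in>V - {u}. tau (pr K) V v y) \<le> X" .
            qed auto
            finally show ?thesis .
          qed
          define Z where "Z = exit_const TYPE('n) \<alpha> * real h powr (1 - \<alpha>) * Q + real h powr (- ?d - \<alpha>) * real h * X"
          have Z0: "0 \<le> Z" unfolding Z_def using exit_const_pos[OF \<alpha>(1,2), where 'n = 'n] Q0 X0
            by (intro add_nonneg_nonneg mult_nonneg_nonneg) auto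
          have "real h * tau (pr K) V x y \<le> real h * tau (pr K) ?V2 x y
            + (\<Sum>u\<in>?V2. tau (pr K) ?V2 x u * (b * (\<Sum>v\<in>V - {u}. ?w u v * tau (pr K) V v y)))"
            by (rule averaged_exit_tau[OF K V(1) xy(1) h(1)])
          also have "tau (pr K) ?V2 x y = 0"
            using V xy h by (intro tau_outside) (auto simp: nball_def)
          also have "(\<Sum>u\<in>?V2. tau (pr K) ?V2 x u * (b * (\<Sum>v\<in>V - {u}. ?w u v * tau (pr K) V v y)))
              \<le> (\<Sum>u\<in>?V2. tau (pr K) ?V2 x u * (b * Z))"
            using b inner unfolding Z_def by (intro sum_mono mult_left_mono t0) auto
          also have "\<dots> = vol_chi K ?V2 x * (b * Z)" by (simp add: vol_chi_def sum_distrib_right)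
          also have "\<dots> \<le> X * (b * Z)"
            using V xy b Z0 by (intro mult_right_mono X) (auto simp: nball_def)
          also have "\<dots> = real h * ((b * exit_const TYPE('n) \<alpha> * (X * real h powr (- \<alpha>))) * Q + b * real h powr (- ?d - \<alpha>) * X\<^sup>2)"
          proof -
            have "real h powr (1 - \<alpha>) = real h * real h powr (- \<alpha>)"
              using h0 powr_add[of "real h" 1 "- \<alpha>"] by simp
            then show ?thesis unfolding Z_def by (simp add: power2_eq_square algebra_simps)
          qed
          finally have "real h * tau (pr K) V x y \<le>
            real h * ((b * exit_const TYPE('n) \<alpha> * (X * real h powr (- \<alpha>))) * Q + b * real h powr (- ?d - \<alpha>) * X\<^sup>2)" by simp
          then have "tau (pr K) V x y \<le>
            (b * exit_const TYPE('n) \<alpha> * (X * real h powr (- \<alpha>))) * Q + b * real h powr (- ?d - \<alpha>) * X\<^sup>2"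
            using h0 by simp
          \<comment> \<open>The constant \<open>c1\<close> contains the loss 4 powr (d + \<alpha>)
            from applying the hypothesis at distance \<open>m\<close> instead of \<open>n\<close>,
            so the recursive term takes only half of \<open>G\<close>. The other half is reserved
            for the long edges.\<close>
          also have "\<dots> \<le> (1 / 2 / 4 powr (?d + \<alpha>)) * (G * X\<^sup>2 * (4 powr (?d + \<alpha>) * real n powr (- ?d - \<alpha>)))
              + b * (8 powr (?d + \<alpha>) * real n powr (- ?d - \<alpha>)) * X\<^sup>2"
          proof (intro add_mono mult_mono Q4 mult_right_mono mult_left_mono)
            have n8: "real n \<le> 8 * real h" using h by simp
            have hn: "real h powr (- s) \<le> 8 powr s * real n powr (- s)" if "0 < s" for s
            proof -
              have "(8 * real h) powr (- s) \<le> real n powr (- s)"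
                using n8 n0 that by (intro powr_mono2') auto
              then have "8 powr s * (8 powr (- s) * real h powr (- s)) \<le> 8 powr s * real n powr (- s)"
                by (intro mult_left_mono) (auto simp: powr_mult)
              moreover have "8 powr s * 8 powr (- s) = (1::real)" by (simp add: powr_add[symmetric])
              ultimately show ?thesis by (simp add: mult.assoc[symmetric])
            qed
            show "real h powr (- ?d - \<alpha>) \<le> 8 powr (?d + \<alpha>) * real n powr (- ?d - \<alpha>)"
              using hn[of "?d + \<alpha>"] \<alpha> by simp
            have "X * real h powr (- \<alpha>) \<le> (C5 * \<xi> powr \<alpha>) * (8 powr \<alpha> * real n powr (- \<alpha>))"
              using hn[OF \<alpha>(1)] \<xi> X0 by (intro mult_mono) auto
            also have "\<dots> \<le> (C5 * \<xi> powr \<alpha>) * (8 powr \<alpha> * (B * \<xi>) powr (- \<alpha>))"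
              using nB B4 \<xi> c \<alpha> by (intro mult_left_mono powr_mono2' mult_nonneg_nonneg) auto
            also have "\<dots> = C5 * 8 powr \<alpha> * B powr (- \<alpha>) * (\<xi> powr \<alpha> * \<xi> powr (- \<alpha>))"
              using B4 \<xi> by (simp add: powr_mult)
            also have "\<xi> powr \<alpha> * \<xi> powr (- \<alpha>) = 1" using \<xi> by (simp add: powr_add[symmetric])
            finally have "b * exit_const TYPE('n) \<alpha> * (X * real h powr (- \<alpha>))
                \<le> b * exit_const TYPE('n) \<alpha> * (C5 * 8 powr \<alpha> * B powr (- \<alpha>))"
              using b exit_const_pos[OF \<alpha>(1,2), where 'n = 'n] by (intro mult_left_mono) auto
            also have "\<dots> = c1 * B powr (- \<alpha>) / 4 powr (?d + \<alpha>)" by (simp add: c1_def)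
            also have "\<dots> \<le> 1 / 2 / 4 powr (?d + \<alpha>)" by (intro divide_right_mono Bc) auto
            finally show "b * exit_const TYPE('n) \<alpha> * (X * real h powr (- \<alpha>)) \<le> 1 / 2 / 4 powr (?d + \<alpha>)" .
          qed (use b Q0 in auto)
          also have "\<dots> = (G / 2 + b * 8 powr (?d + \<alpha>)) * (X\<^sup>2 * real n powr (- ?d - \<alpha>))"
            by (simp add: algebra_simps)
          also have "\<dots> \<le> (G / 2 + G / 2) * (X\<^sup>2 * real n powr (- ?d - \<alpha>))"
            using G by (intro mult_right_mono add_left_mono) auto
          finally show ?thesis by simp
        qed
      qed
    qed
    have "1 \<le> nm (y - x)" using V nm_eq_0_iff[of "y - x"] by (cases "nm (y - x)") auto
    then show ?thesis using claim V by blast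
  qed
  then show ?thesis using G(1) that by blast
qed

section \<open>From finite volume to the infinite model\<close>

text \<open>The link between \<open>bex\<close> and the product measure: an event about finitely
  many edges is the disjoint union of the cylinders of its configurations.\<close>

lemma perc_cylinder:
  assumes K: "long_range a b \<alpha> K" and E: "finite E" "E \<subseteq> edges"
  shows "{\<omega> \<in> space (perc K 1). F {e \<in> E. \<omega> e}} \<in> sets (perc K 1)"
    and "measure (perc K 1) {\<omega> \<in> space (perc K 1). F {e \<in> E. \<omega> e}} = bex (pr K) E (\<lambda>w. of_bool (F w))"
proof -
  let ?M = "\<lambda>e. measure_pmf (bernoulli_pmf (edge_prob K 1 e))"
  interpret product_prob_space ?M edges
    by (intro product_prob_spaceI measure_pmf.prob_space_axioms)
  have pK: "perc K 1 = PiM edges ?M" by (simp add: perc_def)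
  define A where "A = (\<lambda>w. {\<omega> \<in> space (perc K 1). \<forall>e\<in>E. \<omega> e \<in> {e \<in> w}})"
  have Am: "A w \<in> sets (perc K 1)" for w
    unfolding A_def pK using E
    by (intro sets.sets_Collect_finite_All sets_Collect_single) auto
  have mA: "measure (perc K 1) (A w) = bwt (pr K) E w" if w: "w \<subseteq> E" for w
  proof -
    have "emeasure (perc K 1) (A w) = (\<Prod>e\<in>E. emeasure (?M e) {e \<in> w})"
      unfolding A_def pK using E by (intro emeasure_PiM_Collect) auto
    also have "\<dots> = (\<Prod>e\<in>E. ennreal (if e \<in> w then pr K e else 1 - pr K e))"
    proof (intro prod.cong refl)
      fix e assume "e \<in> E"
      then have "pr K e = edge_prob K 1 e" using E by (auto simp: pr_def)
      moreover have "0 \<le> pr K e" "pr K e \<le> 1" using pvalid_pr[OF K] by (auto simp: pvalid_def)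
      ultimately show "emeasure (?M e) {e \<in> w} = ennreal (if e \<in> w then pr K e else 1 - pr K e)"
        by (simp add: emeasure_pmf_single)
    qed
    also have "\<dots> = ennreal (\<Prod>e\<in>E. if e \<in> w then pr K e else 1 - pr K e)"
      using pvalid_pr[OF K] by (intro prod_ennreal) (auto simp: pvalid_def)
    also have "(\<Prod>e\<in>E. if e \<in> w then pr K e else 1 - pr K e) = bwt (pr K) E w"
    proof -
      have "{e \<in> E. e \<in> w} = w" "{e \<in> E. e \<notin> w} = E - w" using w by auto
      then show ?thesis using E by (simp add: bwt_def prod.If_cases Int_def)
    qed
    finally show ?thesis using bwt_nonneg[OF pvalid_pr[OF K], of E w] by (simp add: measure_def)
  qed
  have eq: "{\<omega> \<in> space (perc K 1). F {e \<in> E. \<omega> e}} = (\<Union>w\<in>{w. w \<subseteq> E \<and> F w}. A w)"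
  proof (intro equalityI subsetI)
    fix \<omega> assume "\<omega> \<in> {\<omega> \<in> space (perc K 1). F {e \<in> E. \<omega> e}}"
    then show "\<omega> \<in> (\<Union>w\<in>{w. w \<subseteq> E \<and> F w}. A w)"
      by (intro UN_I[of "{e \<in> E. \<omega> e}"]) (auto simp: A_def)
  next
    fix \<omega> assume "\<omega> \<in> (\<Union>w\<in>{w. w \<subseteq> E \<and> F w}. A w)"
    then obtain w where w: "w \<subseteq> E" "F w" "\<omega> \<in> A w" by blast
    then have "{e \<in> E. \<omega> e} = w" by (auto simp: A_def)
    then show "\<omega> \<in> {\<omega> \<in> space (perc K 1). F {e \<in> E. \<omega> e}}" using w by (simp add: A_def)
  qed
  have fin: "finite {w. w \<subseteq> E \<and> F w}" using E by (auto intro: finite_subset[of _ "Pow E"])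
  show "{\<omega> \<in> space (perc K 1). F {e \<in> E. \<omega> e}} \<in> sets (perc K 1)"
    unfolding eq using fin Am by (intro sets.finite_UN) auto
  interpret Q: prob_space "perc K 1" by (rule prob_space_perc)
  have "measure (perc K 1) {\<omega> \<in> space (perc K 1). F {e \<in> E. \<omega> e}} = (\<Sum>w\<in>{w. w \<subseteq> E \<and> F w}. measure (perc K 1) (A w))"
    unfolding eq
  proof (intro Q.finite_measure_finite_Union fin)
    show "disjoint_family_on A {w. w \<subseteq> E \<and> F w}"
      unfolding disjoint_family_on_def
    proof (intro ballI impI)
      fix w w' assume "w \<in> {w. w \<subseteq> E \<and> F w}" "w' \<in> {w. w \<subseteq> E \<and> F w}" "w \<noteq> w'"
      moreover have "w = {e \<in> E. \<omega> e}" if "\<omega> \<in> A w" "w \<subseteq> E" for \<omega> w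
        using that by (auto simp: A_def)
      ultimately show "A w \<inter> A w' = {}" by blast
    qed
  qed (use Am in auto)
  also have "\<dots> = (\<Sum>w\<in>{w. w \<subseteq> E \<and> F w}. bwt (pr K) E w)" using mA by (intro sum.cong) auto
  also have "\<dots> = bex (pr K) E (\<lambda>w. of_bool (F w))"
    unfolding bex_def using E by (intro sum.mono_neutral_cong_left) auto
  finally show "measure (perc K 1) {\<omega> \<in> space (perc K 1). F {e \<in> E. \<omega> e}} = bex (pr K) E (\<lambda>w. of_bool (F w))" .
qed

definition open_edges :: "('v set \<Rightarrow> bool) \<Rightarrow> 'v set \<Rightarrow> 'v set set" where
  "open_edges \<omega> V = {e \<in> ed V. \<omega> e}"

lemma ed_subset_edges: "ed V \<subseteq> edges"
  by (auto simp: ed_def edges_def)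

lemma open_edges_mono: "V \<subseteq> W \<Longrightarrow> open_edges \<omega> V \<subseteq> open_edges \<omega> W"
  using ed_mono by (auto simp: open_edges_def)

lemma cl_open_edges_mono: "V \<subseteq> W \<Longrightarrow> cl (open_edges \<omega> V) x \<subseteq> cl (open_edges \<omega> W) x"
  by (intro cl_mono open_edges_mono)

lemma cl_open_edges_subset: "cl (open_edges \<omega> V) x \<subseteq> cluster \<omega> x"
proof
  fix y assume "y \<in> cl (open_edges \<omega> V) x"
  then show "y \<in> cluster \<omega> x"
  proof (induction rule: cl_induct)
    case (step y z)
    then have "(y, z) \<in> open_adj \<omega>" by (auto simp: open_edges_def open_adj_def dest: mem_edD)
    then show ?case using step by (auto simp: cluster_def intro: rtrancl_into_rtrancl)
  qed (simp add: cluster_def)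
qed

text \<open>A path is finite, hence contained in some ball; the union is increasing, so
  probabilities pass to the limit.\<close>

lemma cluster_eq_UN: "cluster \<omega> x = (\<Union>N. cl (open_edges \<omega> (nball 0 N)) x)"
proof
  show "cluster \<omega> x \<subseteq> (\<Union>N. cl (open_edges \<omega> (nball 0 N)) x)"
  proof
    fix y assume "y \<in> cluster \<omega> x"
    then have "(x, y) \<in> (open_adj \<omega>)\<^sup>*" by (simp add: cluster_def)
    then show "y \<in> (\<Union>N. cl (open_edges \<omega> (nball 0 N)) x)"
    proof (induction rule: rtrancl_induct)
      case (step y z)
      then obtain N where N: "y \<in> cl (open_edges \<omega> (nball 0 N)) x" by blast
      define M where "M = max N (max (nm y) (nm z))"
      have "nball 0 N \<subseteq> (nball 0 M :: (int ^ 'a) set)" by (intro nball_mono) (simp add: M_def)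
      then have y: "y \<in> cl (open_edges \<omega> (nball 0 M)) x" using N cl_open_edges_mono[of "nball 0 N" "nball 0 M" \<omega> x] by blast
      moreover have "{y, z} \<in> open_edges \<omega> (nball 0 M)"
        using step(2) by (auto simp: open_edges_def open_adj_def nball_def M_def intro!: mem_edI)
      ultimately have "z \<in> cl (open_edges \<omega> (nball 0 M)) x" by (rule cl_step)
      then show ?case by blast
    qed simp
  qed
  show "(\<Union>N. cl (open_edges \<omega> (nball 0 N)) x) \<subseteq> cluster \<omega> x"
    by (intro UN_least cl_open_edges_subset)
qed

lemma perc_event:
  assumes K: "long_range a b \<alpha> K" and V: "finite V"
  shows "{\<omega> \<in> space (perc K 1). F (open_edges \<omega> V)} \<in> sets (perc K 1)"
    and "measure (perc K 1) {\<omega> \<in> space (perc K 1). F (open_edges \<omega> V)} = bex (pr K) (ed V) (\<lambda>w. of_bool (F w))"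
  unfolding open_edges_def using perc_cylinder[OF K finite_ed[OF V] ed_subset_edges] by auto

lemma two_point_LIMSEQ:
  assumes K: "long_range a b \<alpha> K"
  shows "(\<lambda>N. tau (pr K) (nball 0 N) x y) \<longlonglongrightarrow> two_point K 1 x y"
proof -
  interpret P: prob_space "perc K 1" by (rule prob_space_perc)
  define A where "A = (\<lambda>N. {\<omega> \<in> space (perc K 1). y \<in> cl (open_edges \<omega> (nball 0 N)) x})"
  have "(\<lambda>N. measure (perc K 1) (A N)) \<longlonglongrightarrow> measure (perc K 1) (\<Union>N. A N)"
  proof (intro P.finite_Lim_measure_incseq)
    show "range A \<subseteq> sets (perc K 1)"
      unfolding A_def using perc_event(1)[OF K finite_nball, of "\<lambda>w. y \<in> cl w x"] by blast
    show "incseq A"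
    proof (rule incseq_SucI)
      fix N
      have "cl (open_edges \<omega> (nball 0 N)) x \<subseteq> cl (open_edges \<omega> (nball 0 (Suc N))) x" for \<omega>
        by (intro cl_open_edges_mono nball_mono) simp
      then show "A N \<subseteq> A (Suc N)" unfolding A_def by blast
    qed
  qed
  moreover have "measure (perc K 1) (A N) = tau (pr K) (nball 0 N) x y" for N
    unfolding A_def tau_def using perc_event(2)[OF K finite_nball, of "\<lambda>w. y \<in> cl w x"] by simp
  moreover have "measure (perc K 1) (\<Union>N. A N) = two_point K 1 x y"
    unfolding two_point_def A_def cluster_eq_UN by (rule arg_cong[where f = "measure (perc K 1)"]) auto
  ultimately show ?thesis by simp
qed

lemma tau_le_two_point:
  assumes K: "long_range a b \<alpha> K" and V: "finite V"
  shows "tau (pr K) V x y \<le> two_point K 1 x y"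
proof -
  define R where "R = Max (nm ` V)"
  have VR: "V \<subseteq> nball 0 N" if "R \<le> N" for N
  proof
    fix v assume "v \<in> V"
    then have "nm v \<le> R" unfolding R_def using V by (intro Max_ge) auto
    then show "v \<in> nball 0 N" using that by (simp add: nball_def)
  qed
  have "\<forall>\<^sub>F N in sequentially. tau (pr K) V x y \<le> tau (pr K) (nball 0 N) x y"
    using eventually_ge_at_top[of R] by eventually_elim (intro tau_mono pvalid_pr[OF K] finite_nball VR)
  then show ?thesis by (rule tendsto_lowerbound[OF two_point_LIMSEQ[OF K]]) simp
qed

lemma two_point_le:
  assumes K: "long_range a b \<alpha> K" and c: "\<And>N. nm x \<le> N \<Longrightarrow> nm y \<le> N \<Longrightarrow> tau (pr K) (nball 0 N) x y \<le> c"
  shows "two_point K 1 x y \<le> c"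
proof -
  have "\<forall>\<^sub>F N in sequentially. tau (pr K) (nball 0 N) x y \<le> c"
    using eventually_ge_at_top[of "max (nm x) (nm y)"] by eventually_elim (intro c; simp)
  then show ?thesis by (rule tendsto_upperbound[OF two_point_LIMSEQ[OF K]]) simp
qed

section \<open>Susceptibility and correlation length through sums over balls\<close>

lemma two_point_nonneg: "0 \<le> two_point K \<beta> x y"
  by (simp add: two_point_def)

text \<open>In contrast to \<open>ball_chi\<close>, connections may leave the ball. These are the
  sums that define the correlation length.\<close>

definition trunc_chi :: "(int ^ 'n \<Rightarrow> int ^ 'n \<Rightarrow> real) \<Rightarrow> nat \<Rightarrow> real" where
  "trunc_chi K N = (\<Sum>y\<in>nball 0 N. two_point K 1 0 y)"

lemma trunc_chi_nonneg: "0 \<le> trunc_chi K N"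
  unfolding trunc_chi_def by (intro sum_nonneg two_point_nonneg)

lemma trunc_chi_mono: "N \<le> N' \<Longrightarrow> trunc_chi K N \<le> trunc_chi K N'"
  unfolding trunc_chi_def by (intro sum_mono2 finite_nball nball_mono two_point_nonneg)

lemma ball_chi_le_trunc_chi: "long_range a b \<alpha> K \<Longrightarrow> ball_chi K N \<le> trunc_chi K N"
  unfolding trunc_chi_def ball_chi_def by (intro sum_mono tau_le_two_point finite_nball)

lemma susceptibility_SUP: "susceptibility K 1 = (SUP N. ennreal (trunc_chi K N))"
proof -
  let ?f = "\<lambda>N x. ennreal (two_point K 1 0 x) * indicator (nball 0 N) x"
  have "susceptibility K 1 = (\<integral>\<^sup>+ x. (SUP N. ?f N x) \<partial>count_space UNIV)"
    unfolding susceptibility_eq_sum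
  proof (intro nn_integral_cong)
    fix x :: "int ^ 'a"
    show "ennreal (two_point K 1 0 x) = (SUP N. ?f N x)"
    proof (intro antisym SUP_least)
      have "ennreal (two_point K 1 0 x) = ?f (nm x) x" by (simp add: nball_def)
      also have "\<dots> \<le> (SUP N. ?f N x)" by (rule SUP_upper) simp
      finally show "ennreal (two_point K 1 0 x) \<le> (SUP N. ?f N x)" .
    qed (auto simp: indicator_def)
  qed
  also have "\<dots> = (SUP N. \<integral>\<^sup>+ x. ?f N x \<partial>count_space UNIV)"
  proof (intro nn_integral_monotone_convergence_SUP)
    show "incseq ?f"
    proof (intro incseq_SucI le_funI mult_left_mono)
      fix N and x :: "int ^ 'a"
      show "indicator (nball 0 N) x \<le> (indicator (nball 0 (Suc N)) x :: ennreal)"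
        by (auto simp: indicator_def nball_def)
    qed simp
  qed simp
  also have "\<dots> = (SUP N. ennreal (trunc_chi K N))"
  proof (intro SUP_cong refl)
    fix N
    have "(\<integral>\<^sup>+ x. ?f N x \<partial>count_space UNIV) = (\<Sum>x\<in>nball 0 N. ennreal (two_point K 1 0 x))"
      by (subst nn_integral_indicator_finite) (auto intro: finite_nball)
    then show "(\<integral>\<^sup>+ x. ?f N x \<partial>count_space UNIV) = ennreal (trunc_chi K N)"
      by (simp add: trunc_chi_def two_point_nonneg sum_ennreal)
  qed
  finally show ?thesis .
qed

lemma trunc_chi_le_of_vol_chi:
  assumes K: "long_range a b \<alpha> K" and X: "\<And>V. finite V \<Longrightarrow> 0 \<in> V \<Longrightarrow> vol_chi K V 0 \<le> X"
  shows "trunc_chi K N \<le> X"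
proof -
  have "(\<lambda>M. \<Sum>y\<in>nball 0 N. tau (pr K) (nball 0 M) 0 y) \<longlonglongrightarrow> trunc_chi K N"
    unfolding trunc_chi_def by (intro tendsto_sum two_point_LIMSEQ[OF K])
  moreover have "\<forall>\<^sub>F M in sequentially. (\<Sum>y\<in>nball 0 N. tau (pr K) (nball 0 M) 0 y) \<le> X"
    using eventually_ge_at_top[of N]
  proof eventually_elim
    case (elim M)
    have "(\<Sum>y\<in>nball 0 N. tau (pr K) (nball 0 M) 0 y) \<le> vol_chi K (nball 0 M) 0"
      unfolding vol_chi_def using elim
      by (intro sum_mono2 finite_nball nball_mono tau_nonneg pvalid_pr[OF K])
    also have "\<dots> \<le> X" by (intro X finite_nball) (simp add: nball_def)
    finally show ?case .
  qed
  ultimately show ?thesis by (rule tendsto_upperbound) simp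
qed

lemma vol_chi_le_of_trunc_chi:
  assumes K: "long_range a b \<alpha> K" and X: "\<And>N. trunc_chi K N \<le> X" and V: "finite V" "x \<in> V"
  shows "vol_chi K V x \<le> X"
proof -
  define N where "N = Max ((\<lambda>v. nm (v - x)) ` V)"
  have "V \<subseteq> nball x N"
  proof
    fix v assume "v \<in> V"
    then have "nm (v - x) \<le> N" unfolding N_def using V by (intro Max_ge) auto
    then show "v \<in> nball x N" by (simp add: nball_def)
  qed
  then have "vol_chi K V x \<le> ball_chi K N" unfolding vol_chi_def by (intro ball_chi_ge[OF K])
  also have "\<dots> \<le> trunc_chi K N" by (rule ball_chi_le_trunc_chi[OF K])
  finally show ?thesis using X[of N] by linarith
qed

lemma lattice_box_eq: "0 \<le> r \<Longrightarrow> lattice_box r = nball 0 (nat \<lfloor>r\<rfloor>)"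
proof -
  assume r: "0 \<le> r"
  have "real_of_int z \<in> {- r..r} \<longleftrightarrow> \<bar>z\<bar> \<le> int (nat \<lfloor>r\<rfloor>)" for z
    using r by (auto simp: abs_le_iff le_floor_iff)
  then show ?thesis by (simp add: lattice_box_def nball_def nm_le_iff)
qed

lemma correlation_length_alt:
  "correlation_length K 1 = Inf (ennreal ` {r. 1 \<le> r \<and> susceptibility K 1 / 2 \<le> ennreal (trunc_chi K (nat \<lfloor>r\<rfloor>))})"
  unfolding correlation_length_def trunc_chi_def
  by (rule arg_cong[where f = "\<lambda>S. Inf (ennreal ` S)"]) (auto simp: lattice_box_eq)

text \<open>Half of infinity is infinite and is not reached by a sum over a finite box, so the
  infimum is over the empty set.\<close>

lemma correlation_length_infinite:
  "susceptibility K 1 = \<infinity> \<Longrightarrow> correlation_length K 1 = \<infinity>"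
  unfolding correlation_length_alt by (simp add: ennreal_divide_eq_top_iff ennreal_top_divide top_unique)

text \<open>The box sums depend only on the integer part of the radius, so the infimum is attained
  at an integer. Some radius qualifies because X / 2 lies strictly below the supremum of the
  sums.\<close>

lemma correlation_length_finite:
  assumes X: "susceptibility K 1 = ennreal X" "0 < X"
  obtains k where "1 \<le> k" "correlation_length K 1 = ennreal (real k)" "X / 2 \<le> trunc_chi K k"
    "\<And>j. 1 \<le> j \<Longrightarrow> j < k \<Longrightarrow> trunc_chi K j < X / 2"
proof -
  let ?P = "\<lambda>k. 1 \<le> k \<and> X / 2 \<le> trunc_chi K k"
  have half: "susceptibility K 1 / 2 = ennreal (X / 2)"
    using X by (simp add: divide_ennreal[symmetric])
  have "ennreal (X / 2) < (SUP N. ennreal (trunc_chi K N))"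
    using X by (simp add: susceptibility_SUP[symmetric] ennreal_less_iff)
  then obtain N where "ennreal (X / 2) < ennreal (trunc_chi K N)" by (auto simp: less_SUP_iff)
  then have "X / 2 < trunc_chi K N" using X by (simp add: ennreal_less_iff)
  \<comment> \<open>\<open>Suc N\<close> instead of \<open>N\<close>, because admissible radii start
    at 1.\<close>
  then have "?P (Suc N)" using trunc_chi_mono[of N "Suc N" K] by simp
  then have k: "?P (LEAST k. ?P k)" by (rule LeastI)
  define k where "k = (LEAST k. ?P k)"
  have k1: "1 \<le> k" "X / 2 \<le> trunc_chi K k" using k by (auto simp: k_def)
  have kmin: "trunc_chi K j < X / 2" if "1 \<le> j" "j < k" for j
    using not_less_Least[of j ?P] that by (auto simp: k_def)
  have set: "{r. 1 \<le> r \<and> susceptibility K 1 / 2 \<le> ennreal (trunc_chi K (nat \<lfloor>r\<rfloor>))} = {real k..}"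
  proof (intro equalityI subsetI)
    fix r :: real assume "r \<in> {r. 1 \<le> r \<and> susceptibility K 1 / 2 \<le> ennreal (trunc_chi K (nat \<lfloor>r\<rfloor>))}"
    then have r: "1 \<le> r" "X / 2 \<le> trunc_chi K (nat \<lfloor>r\<rfloor>)"
      unfolding half by (auto simp: ennreal_le_iff trunc_chi_nonneg)
    have "1 \<le> nat \<lfloor>r\<rfloor>" using r(1) by (simp add: le_nat_iff)
    then have "k \<le> nat \<lfloor>r\<rfloor>" using kmin[of "nat \<lfloor>r\<rfloor>"] r(2) by linarith
    then show "r \<in> {real k..}" using r(1) by (simp add: le_nat_iff le_floor_iff)
  next
    fix r :: real assume "r \<in> {real k..}"
    then have r: "real k \<le> r" by simp
    then have "k \<le> nat \<lfloor>r\<rfloor>" by (simp add: le_nat_iff le_floor_iff)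
    then have "X / 2 \<le> trunc_chi K (nat \<lfloor>r\<rfloor>)" using trunc_chi_mono k1 order_trans by blast
    moreover have "1 \<le> r" using r k1 by linarith
    ultimately show "r \<in> {r. 1 \<le> r \<and> susceptibility K 1 / 2 \<le> ennreal (trunc_chi K (nat \<lfloor>r\<rfloor>))}"
      unfolding half by (auto intro: ennreal_leI)
  qed
  have "correlation_length K 1 = ennreal (real k)"
    unfolding correlation_length_alt set
  proof (intro antisym Inf_lower Inf_greatest)
    show "ennreal (real k) \<in> ennreal ` {real k..}" by simp
    show "ennreal (real k) \<le> z" if "z \<in> ennreal ` {real k..}" for z
      using that by (auto intro: ennreal_leI)
  qed
  then show ?thesis using that k1 kmin by blast
qed

subsection \<open>Percolation and the critical parameter\<close>

lemma large_cluster_measure: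
  assumes K: "long_range a b \<alpha> K"
  shows "{\<omega> \<in> space (perc K 1). \<exists>N. M \<le> card (cl (open_edges \<omega> (nball 0 N)) x)} \<in> sets (perc K 1)"
    and "(\<lambda>N. cluster_tail (pr K) (nball 0 N) x M) \<longlonglongrightarrow>
      measure (perc K 1) {\<omega> \<in> space (perc K 1). \<exists>N. M \<le> card (cl (open_edges \<omega> (nball 0 N)) x)}"
proof -
  interpret P: prob_space "perc K 1" by (rule prob_space_perc)
  define A where "A = (\<lambda>N. {\<omega> \<in> space (perc K 1). M \<le> card (cl (open_edges \<omega> (nball 0 N)) x)})"
  have eq: "{\<omega> \<in> space (perc K 1). \<exists>N. M \<le> card (cl (open_edges \<omega> (nball 0 N)) x)} = (\<Union>N. A N)"
    by (auto simp: A_def)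
  have m: "range A \<subseteq> sets (perc K 1)"
    unfolding A_def using perc_event(1)[OF K finite_nball, of "\<lambda>w. M \<le> card (cl w x)"] by blast
  then show "{\<omega> \<in> space (perc K 1). \<exists>N. M \<le> card (cl (open_edges \<omega> (nball 0 N)) x)} \<in> sets (perc K 1)"
    unfolding eq by (intro sets.countable_UN) auto
  have "incseq A"
  proof (rule incseq_SucI, rule subsetI)
    fix N \<omega> assume "\<omega> \<in> A N"
    moreover have "card (cl (open_edges \<omega> (nball 0 N)) x) \<le> card (cl (open_edges \<omega> (nball 0 (Suc N))) x)"
      by (intro card_mono cl_open_edges_mono nball_mono finite_cl[OF finite_nball[of 0 "Suc N"]]) (auto simp: open_edges_def)
    ultimately show "\<omega> \<in> A (Suc N)" by (auto simp: A_def)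
  qed
  then have "(\<lambda>N. measure (perc K 1) (A N)) \<longlonglongrightarrow> measure (perc K 1) (\<Union>N. A N)"
    using m by (intro P.finite_Lim_measure_incseq)
  moreover have "measure (perc K 1) (A N) = cluster_tail (pr K) (nball 0 N) x M" for N
    unfolding A_def cluster_tail_def using perc_event(2)[OF K finite_nball, of "\<lambda>w. M \<le> card (cl w x)"] by simp
  ultimately show "(\<lambda>N. cluster_tail (pr K) (nball 0 N) x M) \<longlonglongrightarrow>
      measure (perc K 1) {\<omega> \<in> space (perc K 1). \<exists>N. M \<le> card (cl (open_edges \<omega> (nball 0 N)) x)}"
    unfolding eq by simp
qed

lemma infinite_cluster_iff:
  "infinite (cluster \<omega> x) \<longleftrightarrow> (\<forall>M. \<exists>N. M \<le> card (cl (open_edges \<omega> (nball 0 N)) x))"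
proof
  assume inf: "infinite (cluster \<omega> x)"
  show "\<forall>M. \<exists>N. M \<le> card (cl (open_edges \<omega> (nball 0 N)) x)"
  proof
    fix M
    obtain F where F: "finite F" "card F = M" "F \<subseteq> cluster \<omega> x"
      using infinite_arbitrarily_large[OF inf] by blast
    have "\<exists>N. F \<subseteq> cl (open_edges \<omega> (nball 0 N)) x" using F(1,3)
    proof (induction F rule: finite_induct)
      case (insert y F)
      then obtain N where N: "F \<subseteq> cl (open_edges \<omega> (nball 0 N)) x" by auto
      obtain N' where N': "y \<in> cl (open_edges \<omega> (nball 0 N')) x" using insert.prems unfolding cluster_eq_UN by auto
      have "cl (open_edges \<omega> (nball 0 N)) x \<subseteq> cl (open_edges \<omega> (nball 0 (max N N'))) x"
        "cl (open_edges \<omega> (nball 0 N')) x \<subseteq> cl (open_edges \<omega> (nball 0 (max N N'))) x"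
        by (intro cl_open_edges_mono nball_mono; simp)+
      then show ?case using N N' by blast
    qed simp
    then obtain N where N: "F \<subseteq> cl (open_edges \<omega> (nball 0 N)) x" by blast
    have "card F \<le> card (cl (open_edges \<omega> (nball 0 N)) x)"
      by (intro card_mono N finite_cl[OF finite_nball[of 0 N]]) (auto simp: open_edges_def)
    then show "\<exists>N. M \<le> card (cl (open_edges \<omega> (nball 0 N)) x)" using F by auto
  qed
next
  assume *: "\<forall>M. \<exists>N. M \<le> card (cl (open_edges \<omega> (nball 0 N)) x)"
  show "infinite (cluster \<omega> x)"
  proof
    assume fin: "finite (cluster \<omega> x)"
    obtain N where "Suc (card (cluster \<omega> x)) \<le> card (cl (open_edges \<omega> (nball 0 N)) x)" using * by blast
    also have "\<dots> \<le> card (cluster \<omega> x)" by (intro card_mono fin cl_open_edges_subset)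
    finally show False by simp
  qed
qed

text \<open>As \<delta> does not depend on the size, it survives the decreasing limit towards the
  event that the cluster of 0 is infinite.\<close>

lemma percolates_infinite_cluster:
  fixes K :: "int ^ 'n \<Rightarrow> int ^ 'n \<Rightarrow> real"
  assumes K: "long_range a b \<alpha> K" and pc: "percolates K"
  shows "0 < measure (perc K 1) {\<omega> \<in> space (perc K 1). \<exists>x. infinite (cluster \<omega> x)}"
proof -
  interpret P: prob_space "perc K 1" by (rule prob_space_perc)
  obtain \<delta> where \<delta>: "0 < \<delta>" "\<And>M. \<exists>N. \<delta> \<le> cluster_tail (pr K) (nball 0 N) 0 M"
    using pc unfolding percolates_def by blast
  define B where "B = (\<lambda>M. {\<omega> \<in> space (perc K 1). \<exists>N. M \<le> card (cl (open_edges \<omega> (nball 0 N)) 0)})"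
  have Bm: "B M \<in> sets (perc K 1)" for M unfolding B_def by (rule large_cluster_measure[OF K])
  have low: "\<delta> \<le> measure (perc K 1) (B M)" for M
  proof -
    obtain N where N: "\<delta> \<le> cluster_tail (pr K) (nball 0 N) 0 M" using \<delta>(2) by blast
    have "\<forall>\<^sub>F N' in sequentially. \<delta> \<le> cluster_tail (pr K) (nball 0 N') 0 M"
      using eventually_ge_at_top[of N]
    proof eventually_elim
      case (elim N')
      show ?case using N cluster_tail_mono[OF pvalid_pr[OF K] finite_nball nball_mono[OF elim], of 0 0 M] by linarith
    qed
    then show ?thesis unfolding B_def
      by (rule tendsto_lowerbound[OF large_cluster_measure(2)[OF K]]) simp
  qed
  have "(\<lambda>M. measure (perc K 1) (B M)) \<longlonglongrightarrow> measure (perc K 1) (\<Inter>M. B M)"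
  proof (intro P.finite_Lim_measure_decseq)
    show "decseq B" unfolding B_def decseq_def by (auto intro: le_trans)
  qed (use Bm in auto)
  then have "\<delta> \<le> measure (perc K 1) (\<Inter>M. B M)"
    by (rule tendsto_lowerbound) (use low in auto)
  also have "\<dots> \<le> measure (perc K 1) {\<omega> \<in> space (perc K 1). \<exists>x. infinite (cluster \<omega> x)}"
  proof (intro P.finite_measure_mono)
    show "{\<omega> \<in> space (perc K 1). \<exists>x. infinite (cluster \<omega> x)} \<in> sets (perc K 1)"
      using measurable_infinite_cluster[of K 1] by (rule predE)
    show "(\<Inter>M. B M) \<subseteq> {\<omega> \<in> space (perc K 1). \<exists>x. infinite (cluster \<omega> x)}"
    proof
      fix \<omega> assume "\<omega> \<in> (\<Inter>M. B M)"
      then have "\<omega> \<in> space (perc K 1)" "infinite (cluster \<omega> 0)"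
        unfolding infinite_cluster_iff by (auto simp: B_def)
      then show "\<omega> \<in> {\<omega> \<in> space (perc K 1). \<exists>x. infinite (cluster \<omega> x)}" by blast
    qed
  qed
  finally show ?thesis using \<delta>(1) by linarith
qed

text \<open>By Markov's inequality a cluster has at least \<open>M\<close> vertices with probability
  at most X / M. Countably many starting points then form a null set.\<close>

lemma vol_chi_bounded_no_infinite_cluster:
  fixes K :: "int ^ 'n \<Rightarrow> int ^ 'n \<Rightarrow> real"
  assumes K: "long_range a b \<alpha> K" and X: "\<And>V x. finite V \<Longrightarrow> x \<in> V \<Longrightarrow> vol_chi K V x \<le> X"
  shows "measure (perc K 1) {\<omega> \<in> space (perc K 1). \<exists>x. infinite (cluster \<omega> x)} = 0"
proof -
  interpret P: prob_space "perc K 1" by (rule prob_space_perc)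
  note p = pvalid_pr[OF K]
  have X0: "0 \<le> X"
  proof -
    have "0 \<le> vol_chi K {0} 0" unfolding vol_chi_def by (intro sum_nonneg tau_nonneg p)
    then show ?thesis using X[of "{0}" 0] by simp
  qed
  define B where "B = (\<lambda>M x. {\<omega> \<in> space (perc K 1). \<exists>N. M \<le> card (cl (open_edges \<omega> (nball 0 N)) x)})"
  have Bm: "B M x \<in> sets (perc K 1)" for M x unfolding B_def by (rule large_cluster_measure[OF K])
  have up: "measure (perc K 1) (B M x) \<le> X / real M" if M: "1 \<le> M" for M x
  proof -
    have "\<forall>\<^sub>F N in sequentially. cluster_tail (pr K) (nball 0 N) x M \<le> X / real M"
      using eventually_ge_at_top[of "nm x"]
    proof eventually_elim
      case (elim N)
      then have xN: "x \<in> nball 0 N" by (simp add: nball_def)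
      have "real M * cluster_tail (pr K) (nball 0 N) x M = bex (pr K) (ed (nball 0 N)) (\<lambda>w. real M * of_bool (M \<le> card (cl w x)))"
        by (simp add: cluster_tail_def bex_cmult)
      also have "\<dots> \<le> bex (pr K) (ed (nball 0 N)) (\<lambda>w. real (card (cl w x)))"
        by (intro bex_mono p) auto
      also have "\<dots> = vol_chi K (nball 0 N) x" unfolding vol_chi_def by (rule sum_tau[OF finite_nball xN, symmetric])
      also have "\<dots> \<le> X" by (intro X finite_nball xN)
      finally show ?case using M by (simp add: field_simps)
    qed
    then show ?thesis unfolding B_def
      by (rule tendsto_upperbound[OF large_cluster_measure(2)[OF K]]) simp
  qed
  have zero: "measure (perc K 1) {\<omega> \<in> space (perc K 1). infinite (cluster \<omega> x)} = 0"
    and meas: "{\<omega> \<in> space (perc K 1). infinite (cluster \<omega> x)} \<in> sets (perc K 1)" for x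
  proof -
    have eq: "{\<omega> \<in> space (perc K 1). infinite (cluster \<omega> x)} = (\<Inter>M. B M x)"
      unfolding B_def infinite_cluster_iff by auto
    show m: "{\<omega> \<in> space (perc K 1). infinite (cluster \<omega> x)} \<in> sets (perc K 1)"
      unfolding eq using Bm by (intro sets.countable_INT) auto
    have "(\<lambda>M. X / real (Suc M)) \<longlonglongrightarrow> 0" by real_asymp
    moreover have "measure (perc K 1) {\<omega> \<in> space (perc K 1). infinite (cluster \<omega> x)} \<le> X / real (Suc M)" for M
    proof -
      have "measure (perc K 1) {\<omega> \<in> space (perc K 1). infinite (cluster \<omega> x)} \<le> measure (perc K 1) (B (Suc M) x)"
        unfolding eq using Bm by (intro P.finite_measure_mono) auto
      then show ?thesis using up[of "Suc M" x] by linarith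
    qed
    ultimately have "measure (perc K 1) {\<omega> \<in> space (perc K 1). infinite (cluster \<omega> x)} \<le> 0"
      by (intro tendsto_lowerbound[where F = sequentially and f = "\<lambda>M. X / real (Suc M)"]) auto
    then show "measure (perc K 1) {\<omega> \<in> space (perc K 1). infinite (cluster \<omega> x)} = 0"
      using measure_nonneg[of "perc K 1"] by (simp add: antisym)
  qed
  have "{\<omega> \<in> space (perc K 1). \<exists>x. infinite (cluster \<omega> x)}
      = (\<Union>x. {\<omega> \<in> space (perc K 1). infinite (cluster \<omega> x)})" by auto
  moreover have "(\<Union>x. {\<omega> \<in> space (perc K 1). infinite (cluster \<omega> x)}) \<in> null_sets (perc K 1)"
  proof (intro null_sets_UN')
    fix x show "{\<omega> \<in> space (perc K 1). infinite (cluster \<omega> x)} \<in> null_sets (perc K 1)"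
      using zero[of x] meas[of x] by (auto simp: null_sets_def P.emeasure_eq_measure)
  qed simp
  ultimately show ?thesis by (simp add: measure_eq_0_null_sets)
qed

section \<open>Estimates at the scale of the correlation length\<close>

lemma ball_chi_lower:
  fixes K :: "int ^ 'n \<Rightarrow> int ^ 'n \<Rightarrow> real"
  assumes \<alpha>: "0 < \<alpha>" "\<alpha> < 1" and b: "0 < b" and K: "long_range a b \<alpha> K"
    and W: "\<And>h. 1 \<le> h \<Longrightarrow> 2 * h \<le> r \<Longrightarrow> real h powr \<alpha> \<le> 4 * b * exit_const TYPE('n) \<alpha> * ball_chi K (2 * h)"
  shows "min (1 / 2) (1 / (16 * b * exit_const TYPE('n) \<alpha>)) * real (r + 1) powr \<alpha> \<le> ball_chi K r"
proof -
  \<comment> \<open>The 1 / 2 serves r \<le> 1, where \<open>ball_chi\<close> is at least 1.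
    Otherwise \<open>W\<close> is used at half the radius, and r + 1 \<le> 4 * h costs a further
    factor 4 powr \<alpha> \<le> 4, whence the 16.\<close>
  let ?c = "min (1 / 2) (1 / (16 * b * exit_const TYPE('n) \<alpha>))"
  have bc: "0 < b * exit_const TYPE('n) \<alpha>" using b exit_const_pos[OF \<alpha>, where 'n = 'n] by simp
  show ?thesis
  proof (cases "r \<le> 1")
    case True
    have "real (r + 1) powr \<alpha> \<le> 2 powr \<alpha>" using True \<alpha> by (intro powr_mono2) auto
    also have "\<dots> \<le> 2 powr 1" using \<alpha> by (intro powr_mono) auto
    finally have "?c * real (r + 1) powr \<alpha> \<le> 1 / 2 * 2" using bc by (intro mult_mono) auto
    then show ?thesis using ball_chi_ge_1[OF K, of r] by linarith
  next
    case False
    define h where "h = r div 2"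
    have h: "1 \<le> h" "2 * h \<le> r" "r + 1 \<le> 4 * h" unfolding h_def using False by presburger+
    have "real (r + 1) powr \<alpha> \<le> real (4 * h) powr \<alpha>" using h \<alpha> by (intro powr_mono2) auto
    also have "\<dots> = 4 powr \<alpha> * real h powr \<alpha>" by (simp add: powr_mult)
    also have "\<dots> \<le> 4 powr 1 * (4 * b * exit_const TYPE('n) \<alpha> * ball_chi K (2 * h))"
      using \<alpha> by (intro mult_mono powr_mono W h) auto
    also have "\<dots> \<le> 16 * b * exit_const TYPE('n) \<alpha> * ball_chi K r"
      using mult_left_mono[OF ball_chi_mono[OF K h(2)] less_imp_le[OF bc]] by (simp add: mult.assoc)
    finally have 1: "real (r + 1) powr \<alpha> \<le> 16 * b * exit_const TYPE('n) \<alpha> * ball_chi K r" .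
    have "?c * real (r + 1) powr \<alpha> \<le> 1 / (16 * b * exit_const TYPE('n) \<alpha>) * (16 * b * exit_const TYPE('n) \<alpha> * ball_chi K r)"
      using bc 1 by (intro mult_mono) (auto simp: mult.assoc)
    also have "\<dots> = ball_chi K r" using bc by auto
    finally show ?thesis .
  qed
qed

lemma trunc_chi_upper:
  fixes K :: "int ^ 'n \<Rightarrow> int ^ 'n \<Rightarrow> real"
  assumes \<alpha>: "0 < \<alpha>" "\<alpha> < 1" and K: "long_range a b \<alpha> K" and D: "0 \<le> D" and k: "1 \<le> k"
    and U: "\<And>x. x \<noteq> 0 \<Longrightarrow> two_point K 1 0 x \<le> D * real (nm x) powr (- real CARD('n) + \<alpha>)"
  shows "trunc_chi K k \<le> (1 + D * shell_const TYPE('n) / \<alpha>) * real k powr \<alpha>"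
proof -
  let ?d = "real CARD('n)"
  have "trunc_chi K k = two_point K 1 0 0 + (\<Sum>y\<in>nball 0 k - {0}. two_point K 1 0 y)"
    unfolding trunc_chi_def by (intro sum.remove finite_nball) (simp add: nball_def)
  also have "\<dots> \<le> 1 + (\<Sum>y\<in>nball (0 :: int ^ 'n) k - {0}. D * real (nm (y - 0)) powr (- ?d + \<alpha>))"
  proof (rule add_mono)
    interpret prob_space "perc K 1" by (rule prob_space_perc)
    show "two_point K 1 0 0 \<le> 1" by (simp add: two_point_def)
    show "(\<Sum>y\<in>nball 0 k - {0}. two_point K 1 0 y)
        \<le> (\<Sum>y\<in>nball (0 :: int ^ 'n) k - {0}. D * real (nm (y - 0)) powr (- ?d + \<alpha>))"
    proof (rule sum_mono)
      fix y :: "int ^ 'n" assume "y \<in> nball 0 k - {0}"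
      then show "two_point K 1 0 y \<le> D * real (nm (y - 0)) powr (- ?d + \<alpha>)" using U[of y] by simp
    qed
  qed
  also have "\<dots> \<le> 1 + D * (shell_const TYPE('n) * (real k powr \<alpha> / \<alpha>))"
  proof -
    have pos: "1 \<le> nm y" if "y \<noteq> 0" for y :: "int ^ 'n"
      using that nm_eq_0_iff[of y] by (cases "nm y") auto
    have "(\<Sum>y\<in>nball (0 :: int ^ 'n) k - {0}. real (nm (y - 0)) powr (- ?d + \<alpha>))
      \<le> (\<Sum>j=1..k. shell_const TYPE('n) * real j ^ (CARD('n) - 1) * real j powr (- ?d + \<alpha>))"
      using pos by (intro radial_sum_le[where f = "\<lambda>j. real j powr (- ?d + \<alpha>)"])
        (auto simp: mem_nball finite_nball)
    also have "\<dots> = shell_const TYPE('n) * (\<Sum>j=1..k. real j powr (- (1 - \<alpha>)))"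
    proof -
      have "real j ^ (CARD('n) - 1) * real j powr (- ?d + \<alpha>) = real j powr (- (1 - \<alpha>))" if "1 \<le> j" for j
        using powr_dim[OF that, where 'n = 'n and a = "- \<alpha>"] by simp
      then show ?thesis by (auto simp: sum_distrib_left mult.assoc intro!: sum.cong)
    qed
    also have "\<dots> \<le> shell_const TYPE('n) * (real k powr \<alpha> / \<alpha>)"
      using sum_powr_le[of "1 - \<alpha>" k] \<alpha> shell_const_pos[where 'n = 'n] by (intro mult_left_mono) auto
    finally have "D * (\<Sum>y\<in>nball (0 :: int ^ 'n) k - {0}. real (nm (y - 0)) powr (- ?d + \<alpha>))
        \<le> D * (shell_const TYPE('n) * (real k powr \<alpha> / \<alpha>))" by (intro mult_left_mono D)
    then show ?thesis by (simp add: sum_distrib_left)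
  qed
  also have "\<dots> \<le> real k powr \<alpha> + D * (shell_const TYPE('n) * (real k powr \<alpha> / \<alpha>))"
    using k \<alpha> ge_one_powr_ge_zero[of "real k" \<alpha>] by simp
  finally show ?thesis by (simp add: algebra_simps)
qed

lemma comparable_ennreal:
  assumes "0 \<le> f" "0 \<le> g" "f \<le> M * g" "g \<le> M * f" "0 \<le> M"
  shows "comparable M (ennreal f) (ennreal g)"
  unfolding comparable_def using assms by (auto simp: ennreal_mult[symmetric] intro!: ennreal_leI)

lemma ennpowr_ennreal: "0 \<le> t \<Longrightarrow> ennpowr (ennreal t) e = ennreal (t powr e)"
  by (simp add: ennpowr_def)

text \<open>The last clause rests on 4 / 3 < 2: if 4 / 3 of the susceptibility within the ball of
  radius \<open>r\<close> dominates all finite volumes, then the sum over this ball exceeds half of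
  the total, so the correlation length is at most \<open>r\<close>.\<close>

lemma susceptibility_cases:
  assumes K: "long_range a b \<alpha> K"
  obtains "susceptibility K 1 = \<infinity>" "correlation_length K 1 = \<infinity>" "\<And>X. \<exists>V x. finite V \<and> x \<in> V \<and> X < vol_chi K V x"
  | X k where "susceptibility K 1 = ennreal X" "correlation_length K 1 = ennreal (real k)" "1 \<le> X" "1 \<le> k"
    "X \<le> 2 * trunc_chi K k" "\<And>V x. finite V \<Longrightarrow> x \<in> V \<Longrightarrow> vol_chi K V x \<le> X"
    "\<And>r. (\<And>V x. finite V \<Longrightarrow> x \<in> V \<Longrightarrow> vol_chi K V x \<le> 4 / 3 * ball_chi K r) \<Longrightarrow> 1 \<le> r \<Longrightarrow> k \<le> r"
proof (cases "susceptibility K 1 = \<infinity>")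
  case True
  have "\<exists>V x. finite V \<and> x \<in> V \<and> X < vol_chi K V x" for X
  proof (rule ccontr)
    assume "\<not> ?thesis"
    then have "trunc_chi K N \<le> X" for N by (intro trunc_chi_le_of_vol_chi[OF K]) (auto simp: not_less)
    then have "susceptibility K 1 \<le> ennreal X"
      unfolding susceptibility_SUP by (intro SUP_least ennreal_leI)
    then show False using True by (simp add: top_unique)
  qed
  then show ?thesis using that(1) True correlation_length_infinite[OF True] by blast
next
  case False
  define X where "X = enn2real (susceptibility K 1)"
  have X: "susceptibility K 1 = ennreal X" using False by (simp add: X_def less_top)
  have X0: "0 \<le> X" by (simp add: X_def)
  have le: "trunc_chi K N \<le> X" for N
  proof -
    have "ennreal (trunc_chi K N) \<le> ennreal X"
      unfolding X[symmetric] susceptibility_SUP by (rule SUP_upper) simp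
    then show ?thesis using X0 by (simp add: ennreal_le_iff)
  qed
  have X1: "1 \<le> X" using ball_chi_ge_1[OF K, of 0] ball_chi_le_trunc_chi[OF K, of 0] le[of 0] by linarith
  then have "0 < X" by simp
  obtain k where k: "1 \<le> k" "correlation_length K 1 = ennreal (real k)" "X / 2 \<le> trunc_chi K k"
    "\<And>j. 1 \<le> j \<Longrightarrow> j < k \<Longrightarrow> trunc_chi K j < X / 2"
    using correlation_length_finite[OF X \<open>0 < X\<close>] by blast
  have "k \<le> r" if r: "\<And>V x. finite V \<Longrightarrow> x \<in> V \<Longrightarrow> vol_chi K V x \<le> 4 / 3 * ball_chi K r" "1 \<le> r" for r
  proof (rule ccontr)
    assume "\<not> k \<le> r"
    then have 1: "trunc_chi K r < X / 2" using k(4) r(2) by simp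
    have "trunc_chi K N \<le> 4 / 3 * trunc_chi K r" for N
      using trunc_chi_le_of_vol_chi[OF K, of "4 / 3 * ball_chi K r" N] r(1) ball_chi_le_trunc_chi[OF K, of r] by fastforce
    then have "susceptibility K 1 \<le> ennreal (4 / 3 * trunc_chi K r)"
      unfolding susceptibility_SUP by (intro SUP_least ennreal_leI)
    then have "X \<le> 4 / 3 * trunc_chi K r" unfolding X using trunc_chi_nonneg[of K r] by (simp add: ennreal_le_iff)
    then show False using 1 X1 by simp
  qed
  then show ?thesis
    using that(2)[OF X k(2) X1 k(1)] k(3) vol_chi_le_of_trunc_chi[OF K le] by simp
qed

text \<open>Isolates what the final bounds need: an upper bound on the kernel, the growth bound on
  ball susceptibilities and, for the pointwise part only, the merging lower bound. The relation
  between susceptibility and correlation length therefore holds even where the lower bound on the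
  kernel degenerates, as for small \<beta>.\<close>

theorem two_point_estimates:
  assumes \<alpha>: "0 < \<alpha>" "\<alpha> < 1" "\<alpha> < real CARD('n::finite)" and b: "0 < b" and A: "0 < A" and \<kappa>: "0 < \<kappa>"
  obtains M where "1 \<le> M"
    "\<And>K :: int ^ 'n \<Rightarrow> int ^ 'n \<Rightarrow> real. long_range 0 b \<alpha> K \<Longrightarrow> (\<And>m. 1 \<le> m \<Longrightarrow> ball_chi K m \<le> A * real m powr \<alpha>) \<Longrightarrow>
      comparable M (susceptibility K 1) (ennpowr (correlation_length K 1) \<alpha>)"
    "\<And>(K :: int ^ 'n \<Rightarrow> int ^ 'n \<Rightarrow> real) x. long_range 0 b \<alpha> K \<Longrightarrow> (\<And>m. 1 \<le> m \<Longrightarrow> ball_chi K m \<le> A * real m powr \<alpha>) \<Longrightarrow>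
      (\<And>x r. 2 * r < nm x \<Longrightarrow>
        \<kappa> * real (nm x) powr (- real CARD('n) - \<alpha>) * (ball_chi K r)\<^sup>2 \<le> tau (pr K) (nball 0 (2 * nm x)) 0 x) \<Longrightarrow>
      x \<noteq> 0 \<Longrightarrow>
      (let n = real (nm x);
           \<xi> = correlation_length K 1;
           P = ennreal (two_point K 1 0 x);
           F = (if ennreal n \<le> \<xi> then ennreal (n powr (- real CARD('n) + \<alpha>))
                else susceptibility K 1 ^ 2 * ennreal (n powr (- real CARD('n) - \<alpha>)));
           G = ennreal (n powr (- real CARD('n) + \<alpha>)) * ennpowr (max 1 (ennreal n / \<xi>)) (- 2 * \<alpha>)
       in comparable M P F \<and> comparable M F G)"
proof -
  let ?d = "real CARD('n)"
  obtain D where D: "0 < D" "\<And>a (K :: int ^ 'n \<Rightarrow> int ^ 'n \<Rightarrow> real) V x y. long_range a b \<alpha> K \<Longrightarrow>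
    (\<And>m. 1 \<le> m \<Longrightarrow> ball_chi K m \<le> A * real m powr \<alpha>) \<Longrightarrow> finite V \<Longrightarrow> x \<in> V \<Longrightarrow> y \<in> V \<Longrightarrow> x \<noteq> y \<Longrightarrow>
    tau (pr K) V x y \<le> D * real (nm (y - x)) powr (- ?d + \<alpha>)"
    using pointwise_upper[OF \<alpha> b A] by blast
  define c6 where "c6 = min (1 / 2) (1 / (16 * b * exit_const TYPE('n) \<alpha>))"
  have c6: "0 < c6" using b exit_const_pos[OF \<alpha>(1,2), where 'n = 'n] by (simp add: c6_def)
  define C6 where "C6 = 2 * (1 + D * shell_const TYPE('n) / \<alpha>)"
  have C6: "0 < C6" unfolding C6_def using D(1) \<alpha> shell_const_pos[where 'n = 'n] by (intro mult_pos_pos add_pos_pos) auto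
  obtain G where G: "0 < G" "\<And>a (K :: int ^ 'n \<Rightarrow> int ^ 'n \<Rightarrow> real) X \<xi> V x y. long_range a b \<alpha> K \<Longrightarrow>
    (\<And>V x y. finite V \<Longrightarrow> x \<in> V \<Longrightarrow> y \<in> V \<Longrightarrow> x \<noteq> y \<Longrightarrow>
      tau (pr K) V x y \<le> D * real (nm (y - x)) powr (- ?d + \<alpha>)) \<Longrightarrow>
    (\<And>V x. finite V \<Longrightarrow> x \<in> V \<Longrightarrow> vol_chi K V x \<le> X) \<Longrightarrow> 1 \<le> \<xi> \<Longrightarrow>
    c6 * \<xi> powr \<alpha> \<le> X \<Longrightarrow> X \<le> C6 * \<xi> powr \<alpha> \<Longrightarrow> finite V \<Longrightarrow> x \<in> V \<Longrightarrow> y \<in> V \<Longrightarrow> x \<noteq> y \<Longrightarrow>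
    tau (pr K) V x y \<le> G * X\<^sup>2 * real (nm (y - x)) powr (- ?d - \<alpha>)"
    using upper_beyond[OF \<alpha> b D(1) c6 C6] by blast
  \<comment> \<open>The merging balls have radius about half of \<open>n\<close> or of \<xi>, and (s
    / 2) powr (2 * \<alpha>) produces 4 powr \<alpha>. Passing to \<open>\<kappa>2\<close> replaces
    \<xi> powr (2 * \<alpha>) by \<open>X\<^sup>2\<close>.\<close>
  define \<kappa>1 where "\<kappa>1 = \<kappa> * c6\<^sup>2 / 4 powr \<alpha>"
  define \<kappa>2 where "\<kappa>2 = \<kappa>1 / C6\<^sup>2"
  have \<kappa>12: "0 < \<kappa>1" "0 < \<kappa>2" using \<kappa> c6 C6 by (auto simp: \<kappa>1_def \<kappa>2_def)
  define M where "M = Max {1, C6, 1 / c6, C6\<^sup>2, 1 / c6\<^sup>2, D, G, 1 / \<kappa>1, 1 / \<kappa>2}"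
  have M: "1 \<le> M" "C6 \<le> M" "1 / c6 \<le> M" "C6\<^sup>2 \<le> M" "1 / c6\<^sup>2 \<le> M" "D \<le> M" "G \<le> M" "1 / \<kappa>1 \<le> M" "1 / \<kappa>2 \<le> M"
    unfolding M_def by (intro Max_ge; simp)+
  have swapM: "y \<le> M * x" if "c * y \<le> x" "0 < c" "1 / c \<le> M" "0 \<le> x" for c x y
  proof -
    have "y = 1 / c * (c * y)" using that by simp
    also have "\<dots> \<le> 1 / c * x" using that by (intro mult_left_mono) auto
    also have "\<dots> \<le> M * x" using that by (intro mult_right_mono) auto
    finally show ?thesis .
  qed
  have leM: "y \<le> M * x" if "y \<le> c * x" "c \<le> M" "0 \<le> x" for c x y
    using that mult_right_mono[of c M x] by linarith
  have tpU: "two_point K 1 0 x \<le> D * real (nm x) powr (- ?d + \<alpha>)"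
    if K: "long_range a b \<alpha> K" and W: "\<And>m. 1 \<le> m \<Longrightarrow> ball_chi K m \<le> A * real m powr \<alpha>" and x: "x \<noteq> 0"
    for a x and K :: "int ^ 'n \<Rightarrow> int ^ 'n \<Rightarrow> real"
  proof (rule two_point_le[OF K])
    fix N assume "nm x \<le> N"
    then have "tau (pr K) (nball 0 N) 0 x \<le> D * real (nm (x - 0)) powr (- ?d + \<alpha>)"
      using x by (intro D(2)[OF K W finite_nball]) (auto simp: mem_nball)
    then show "tau (pr K) (nball 0 N) 0 x \<le> D * real (nm x) powr (- ?d + \<alpha>)" by simp
  qed
  \<comment> \<open>The contrapositive of \<open>vol_chi_le_ball_chi\<close>: where a ball fails to
    dominate the susceptibility of all finite volumes, its own susceptibility must be at least of
    order h powr \<alpha>.\<close>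
  have lower: "c6 * real (r + 1) powr \<alpha> \<le> ball_chi K r"
    if K: "long_range a b \<alpha> K" and *: "\<And>h. 1 \<le> h \<Longrightarrow> 2 * h \<le> r \<Longrightarrow>
      \<not> (\<forall>V x. finite V \<longrightarrow> x \<in> V \<longrightarrow> vol_chi K V x \<le> 4 / 3 * ball_chi K (2 * h))"
    for a r and K :: "int ^ 'n \<Rightarrow> int ^ 'n \<Rightarrow> real"
    unfolding c6_def
  proof (rule ball_chi_lower[OF \<alpha>(1,2) b K])
    fix h assume h: "1 \<le> h" "2 * h \<le> r"
    show "real h powr \<alpha> \<le> 4 * b * exit_const TYPE('n) \<alpha> * ball_chi K (2 * h)"
    proof (rule ccontr)
      assume "\<not> ?thesis"
      then have "4 * b * exit_const TYPE('n) \<alpha> * ball_chi K (2 * h) \<le> real h powr \<alpha>" by simp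
      then show False using *[OF h] vol_chi_le_ball_chi[OF K \<alpha>(1,2) h(1)] by blast
    qed
  qed
  have fin: "c6 * real k powr \<alpha> \<le> X \<and> X \<le> C6 * real k powr \<alpha> \<and> (\<forall>r<k. c6 * real (r + 1) powr \<alpha> \<le> ball_chi K r)"
    if K: "long_range a b \<alpha> K" and W: "\<And>m. 1 \<le> m \<Longrightarrow> ball_chi K m \<le> A * real m powr \<alpha>"
      and k: "1 \<le> k" "X \<le> 2 * trunc_chi K k" "\<And>V x. finite V \<Longrightarrow> x \<in> V \<Longrightarrow> vol_chi K V x \<le> X"
        "\<And>r. (\<And>V x. finite V \<Longrightarrow> x \<in> V \<Longrightarrow> vol_chi K V x \<le> 4 / 3 * ball_chi K r) \<Longrightarrow> 1 \<le> r \<Longrightarrow> k \<le> r"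
    for a X k and K :: "int ^ 'n \<Rightarrow> int ^ 'n \<Rightarrow> real"
  proof -
    \<comment> \<open>A ball of radius 2 * h < k cannot dominate all finite volumes, as this would
      bound the correlation length by its radius.\<close>
    have low: "c6 * real (r + 1) powr \<alpha> \<le> ball_chi K r" if "r < k" for r
    proof (rule lower[OF K], rule notI)
      fix h assume h: "1 \<le> h" "2 * h \<le> r" and all: "\<forall>V x. finite V \<longrightarrow> x \<in> V \<longrightarrow> vol_chi K V x \<le> 4 / 3 * ball_chi K (2 * h)"
      have "k \<le> 2 * h" using k(4)[of "2 * h"] all h by auto
      then show False using h that by simp
    qed
    have "c6 * real (k - 1 + 1) powr \<alpha> \<le> ball_chi K (k - 1)" using low[of "k - 1"] k(1) by simp
    also have "\<dots> = vol_chi K (nball 0 (k - 1)) 0" by (simp add: ball_chi_def vol_chi_def)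
    also have "\<dots> \<le> X" by (intro k(3) finite_nball) (simp add: nball_def)
    finally have 1: "c6 * real k powr \<alpha> \<le> X" using k(1) by simp
    have "trunc_chi K k \<le> (1 + D * shell_const TYPE('n) / \<alpha>) * real k powr \<alpha>"
      using D(1) by (intro trunc_chi_upper[OF \<alpha>(1,2) K _ k(1)] tpU[OF K W]) auto
    then have "X \<le> C6 * real k powr \<alpha>" using k(2) unfolding C6_def mult.assoc by linarith
    then show ?thesis using 1 low by blast
  qed
  show ?thesis
  proof (rule that[OF M(1)])
    fix K :: "int ^ 'n \<Rightarrow> int ^ 'n \<Rightarrow> real"
    assume K: "long_range 0 b \<alpha> K" and W: "\<And>m. 1 \<le> m \<Longrightarrow> ball_chi K m \<le> A * real m powr \<alpha>"
    show "comparable M (susceptibility K 1) (ennpowr (correlation_length K 1) \<alpha>)"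
    proof (cases rule: susceptibility_cases[OF K])
      case 1
      then show ?thesis using M(1) \<alpha> by (simp add: comparable_def ennpowr_def ennreal_mult_top)
    next
      case (2 X k)
      note f = fin[OF K W 2(4,5,6,7)]
      have "X \<le> M * real k powr \<alpha>" using f by (intro leM[of X C6] M) auto
      moreover have "real k powr \<alpha> \<le> M * X" using f 2(3) by (intro swapM[of c6] c6 M) auto
      ultimately have "comparable M (ennreal X) (ennreal (real k powr \<alpha>))"
        using 2(3) M(1) by (intro comparable_ennreal) auto
      then show ?thesis unfolding 2(1,2) by (simp add: ennpowr_ennreal)
    qed
  next
    fix K :: "int ^ 'n \<Rightarrow> int ^ 'n \<Rightarrow> real" and x :: "int ^ 'n"
    assume K: "long_range 0 b \<alpha> K" and W: "\<And>m. 1 \<le> m \<Longrightarrow> ball_chi K m \<le> A * real m powr \<alpha>"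
      and L: "\<And>x r. 2 * r < nm x \<Longrightarrow>
        \<kappa> * real (nm x) powr (- ?d - \<alpha>) * (ball_chi K r)\<^sup>2 \<le> tau (pr K) (nball 0 (2 * nm x)) 0 x"
      and x: "x \<noteq> 0"
    let ?n = "real (nm x)" and ?P = "two_point K 1 0 x"
    have n1: "1 \<le> nm x" using x nm_eq_0_iff[of x] by (cases "nm x") auto
    have n0: "0 < ?n" using n1 by simp
    have P0: "0 \<le> ?P" by (rule two_point_nonneg)
    have Lr: "\<kappa> * ?n powr (- ?d - \<alpha>) * (c6 * s powr \<alpha>)\<^sup>2 \<le> ?P"
      if "2 * r < nm x" "c6 * real (r + 1) powr \<alpha> \<le> ball_chi K r" "0 \<le> s" "s \<le> real (r + 1)" for r s
    proof -
      have "c6 * s powr \<alpha> \<le> c6 * real (r + 1) powr \<alpha>"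
        using that c6 \<alpha> by (intro mult_left_mono powr_mono2) auto
      then have "c6 * s powr \<alpha> \<le> ball_chi K r" using that(2) by (rule order_trans)
      then have "\<kappa> * ?n powr (- ?d - \<alpha>) * (c6 * s powr \<alpha>)\<^sup>2 \<le> \<kappa> * ?n powr (- ?d - \<alpha>) * (ball_chi K r)\<^sup>2"
        using \<kappa> c6 by (intro mult_left_mono power_mono) auto
      also have "\<dots> \<le> ?P" using L[OF that(1)] tau_le_two_point[OF K finite_nball] by (rule order_trans)
      finally show ?thesis .
    qed
    have nearP: "\<kappa>1 * ?n powr (- ?d + \<alpha>) \<le> ?P"
      if low: "\<And>r. 2 * r < nm x \<Longrightarrow> c6 * real (r + 1) powr \<alpha> \<le> ball_chi K r"
    proof -
      \<comment> \<open>The largest radius with 2 * r < nm x, for which the balls around 0 and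
        \<open>x\<close> are disjoint.\<close>
      define r where "r = (nm x - 1) div 2"
      have r: "2 * r < nm x" "nm x \<le> 2 * (r + 1)" unfolding r_def using n1 by auto
      have "\<kappa> * ?n powr (- ?d - \<alpha>) * (c6 * (?n / 2) powr \<alpha>)\<^sup>2 \<le> ?P"
        using r by (intro Lr[OF r(1) low[OF r(1)]]) auto
      moreover have "(c6 * (?n / 2) powr \<alpha>)\<^sup>2 = c6\<^sup>2 / 4 powr \<alpha> * ?n powr (2 * \<alpha>)"
      proof -
        have "(?n / 2) powr \<alpha> = ?n powr \<alpha> / 2 powr \<alpha>" using n0 by (simp add: powr_divide)
        moreover have "(2 powr \<alpha>)\<^sup>2 = (4::real) powr \<alpha>" by (simp add: power2_eq_square powr_mult[symmetric])
        moreover have "(?n powr \<alpha>)\<^sup>2 = ?n powr (2 * \<alpha>)" using n0 by (simp add: powr_power mult.commute)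
        ultimately show ?thesis by (simp add: power_mult_distrib power_divide)
      qed
      moreover have "?n powr (- ?d - \<alpha>) * ?n powr (2 * \<alpha>) = ?n powr (- ?d + \<alpha>)"
        by (simp add: powr_add[symmetric])
      ultimately show ?thesis by (simp add: \<kappa>1_def mult_ac)
    qed
    have near: "comparable M (ennreal ?P) (ennreal (?n powr (- ?d + \<alpha>)))"
      if "\<And>r. 2 * r < nm x \<Longrightarrow> c6 * real (r + 1) powr \<alpha> \<le> ball_chi K r"
    proof (intro comparable_ennreal P0)
      show "?P \<le> M * ?n powr (- ?d + \<alpha>)" using tpU[OF K W x] M by (intro leM[of ?P D]) auto
      show "?n powr (- ?d + \<alpha>) \<le> M * ?P" by (intro swapM[of \<kappa>1] nearP that \<kappa>12 M P0)
    qed (use M(1) in auto)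
    have self: "comparable M z z" for z
    proof -
      have "1 * z \<le> ennreal M * z" using M(1) by (intro mult_right_mono) (auto simp: ennreal_1[symmetric] simp del: ennreal_1 intro: ennreal_leI)
      then show ?thesis by (simp add: comparable_def)
    qed
    show "let n = ?n; \<xi> = correlation_length K 1; P = ennreal ?P;
           F = (if ennreal n \<le> \<xi> then ennreal (n powr (- ?d + \<alpha>))
                else susceptibility K 1 ^ 2 * ennreal (n powr (- ?d - \<alpha>)));
           G = ennreal (n powr (- ?d + \<alpha>)) * ennpowr (max 1 (ennreal n / \<xi>)) (- 2 * \<alpha>)
       in comparable M P F \<and> comparable M F G"
    proof (cases rule: susceptibility_cases[OF K])
      case 1
      \<comment> \<open>With unbounded finite-volume susceptibilities no ball dominates all volumes,
        so the lower bound holds at every scale.\<close>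
      have low: "c6 * real (r + 1) powr \<alpha> \<le> ball_chi K r" for r
        using 1(3) by (intro lower[OF K]) (meson not_less)
      have "ennpowr (max 1 (ennreal ?n / \<infinity>)) (- 2 * \<alpha>) = 1"
        using ennpowr_ennreal[of 1 "- 2 * \<alpha>"] by simp
      then show ?thesis unfolding Let_def 1(2) using near[OF low] self by simp
    next
      case (2 X k)
      note f = fin[OF K W 2(4,5,6,7)]
      have k0: "0 < real k" using 2(4) by simp
      have gk: "ennpowr (max 1 (ennreal ?n / ennreal (real k))) (- 2 * \<alpha>) = ennreal (max 1 (?n / real k) powr (- 2 * \<alpha>))"
      proof -
        have "ennreal ?n / ennreal (real k) = ennreal (?n / real k)" using n0 k0 by (intro divide_ennreal) auto
        then have "max 1 (ennreal ?n / ennreal (real k)) = ennreal (max 1 (?n / real k))"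
          using n0 k0 by (simp add: ennreal_1[symmetric] max_def ennreal_le_iff del: ennreal_1)
        then show ?thesis using ennpowr_ennreal[of "max 1 (?n / real k)" "- 2 * \<alpha>"] by simp
      qed
      show ?thesis
      proof (cases "nm x \<le> k")
        case True
        have low: "c6 * real (r + 1) powr \<alpha> \<le> ball_chi K r" if "2 * r < nm x" for r
          using f that True by auto
        have "max 1 (?n / real k) = 1" using True k0 by (simp add: max_def field_simps)
        then have "ennpowr (max 1 (ennreal ?n / ennreal (real k))) (- 2 * \<alpha>) = 1" unfolding gk by simp
        then show ?thesis unfolding Let_def 2(2) using near[OF low] self True by (simp add: ennreal_le_iff)
      next
        case False
        then have kn: "real k < ?n" by simp
        have X0: "0 < X" using 2(3) by simp
        define w where "w = ?n powr (- ?d - \<alpha>)"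
        have w0: "0 \<le> w" by (simp add: w_def)
        \<comment> \<open>Beyond the correlation length both closed forms become multiples of
          \<open>w\<close>, and comparing them amounts to comparing \<open>X\<^sup>2\<close> with
          \<xi> powr (2 * \<alpha>).\<close>
        have g: "?n powr (- ?d + \<alpha>) * max 1 (?n / real k) powr (- 2 * \<alpha>) = (real k powr \<alpha>)\<^sup>2 * w"
        proof -
          have "max 1 (?n / real k) = ?n / real k" using kn k0 by (simp add: max_def field_simps)
          then have "max 1 (?n / real k) powr (- 2 * \<alpha>) = ?n powr (- 2 * \<alpha>) * real k powr (2 * \<alpha>)"
          proof -
            have "(?n / real k) powr (- 2 * \<alpha>) = ?n powr (- 2 * \<alpha>) / real k powr (- 2 * \<alpha>)"
              using n0 k0 by (intro powr_divide)
            moreover have "real k powr (- 2 * \<alpha>) = 1 / real k powr (2 * \<alpha>)"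
              using powr_minus_divide[of "real k" "2 * \<alpha>"] by simp
            ultimately show ?thesis unfolding \<open>max 1 (?n / real k) = ?n / real k\<close> by simp
          qed
          moreover have "?n powr (- ?d + \<alpha>) * ?n powr (- 2 * \<alpha>) = w"
            unfolding powr_add[symmetric] w_def by (rule arg_cong[where f = "\<lambda>e. ?n powr e"]) simp
          moreover have "real k powr (2 * \<alpha>) = (real k powr \<alpha>)\<^sup>2" using k0 by (simp add: powr_power mult.commute)
          ultimately show ?thesis by (simp only: mult.assoc[symmetric]) (rule mult.commute)
        qed
        have PU: "?P \<le> G * (X\<^sup>2 * w)"
        proof (intro two_point_le[OF K])
          fix N assume "nm x \<le> N"
          then have "tau (pr K) (nball 0 N) 0 x \<le> G * X\<^sup>2 * real (nm (x - 0)) powr (- ?d - \<alpha>)"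
            using f 2(4) x by (intro G(2)[OF K D(2)[OF K W] 2(6), where \<xi> = "real k"] finite_nball) (auto simp: mem_nball)
          then show "tau (pr K) (nball 0 N) 0 x \<le> G * (X\<^sup>2 * w)" by (simp add: w_def mult.assoc)
        qed
        have PL: "\<kappa>2 * (X\<^sup>2 * w) \<le> ?P"
        proof -
          \<comment> \<open>The balls must be disjoint and below the correlation length. Whichever
            bound is active, \<open>r + 1\<close> is at least k / 2, because nm x > k.\<close>
          define r where "r = min ((nm x - 1) div 2) (k - 1)"
          have r: "2 * r < nm x" "r < k" "k \<le> 2 * (r + 1)"
            unfolding r_def using n1 2(4) False by auto
          have "\<kappa> * w * (c6 * (real k / 2) powr \<alpha>)\<^sup>2 \<le> ?P"
            unfolding w_def using r f by (intro Lr[OF r(1)]) auto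
          moreover have "(c6 * (real k / 2) powr \<alpha>)\<^sup>2 = c6\<^sup>2 / 4 powr \<alpha> * (real k powr \<alpha>)\<^sup>2"
          proof -
            have "(real k / 2) powr \<alpha> = real k powr \<alpha> / 2 powr \<alpha>" using k0 by (simp add: powr_divide)
            moreover have "(2 powr \<alpha>)\<^sup>2 = (4::real) powr \<alpha>"
              by (simp add: power2_eq_square powr_mult[symmetric])
            ultimately show ?thesis by (simp add: power_mult_distrib power_divide)
          qed
          ultimately have 1: "\<kappa>1 * w * (real k powr \<alpha>)\<^sup>2 \<le> ?P" by (simp add: \<kappa>1_def mult_ac)
          have "X\<^sup>2 \<le> C6\<^sup>2 * (real k powr \<alpha>)\<^sup>2"
            using f X0 power_mono[of X "C6 * real k powr \<alpha>" 2] by (simp add: power_mult_distrib)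
          then have "\<kappa>2 * (X\<^sup>2 * w) \<le> \<kappa>2 * ((C6\<^sup>2 * (real k powr \<alpha>)\<^sup>2) * w)"
            using \<kappa>12 w0 by (intro mult_left_mono mult_right_mono) auto
          also have "\<dots> = \<kappa>1 * w * (real k powr \<alpha>)\<^sup>2" using C6 by (simp add: \<kappa>2_def)
          finally show ?thesis using 1 by linarith
        qed
        have F: "susceptibility K 1 ^ 2 * ennreal w = ennreal (X\<^sup>2 * w)"
          unfolding 2(1) using X0 w0 by (simp add: ennreal_mult power2_eq_square)
        have 1: "comparable M (ennreal ?P) (ennreal (X\<^sup>2 * w))"
        proof (intro comparable_ennreal P0)
          show "?P \<le> M * (X\<^sup>2 * w)" using w0 by (intro leM[of ?P G] PU M) auto
          show "X\<^sup>2 * w \<le> M * ?P" by (intro swapM[of \<kappa>2] PL \<kappa>12 M P0)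
        qed (use w0 M(1) in auto)
        have 2: "comparable M (ennreal (X\<^sup>2 * w)) (ennreal ((real k powr \<alpha>)\<^sup>2 * w))"
        proof (rule comparable_ennreal)
          have "X\<^sup>2 \<le> C6\<^sup>2 * (real k powr \<alpha>)\<^sup>2"
            using f X0 power_mono[of X "C6 * real k powr \<alpha>" 2] by (simp add: power_mult_distrib)
          then have "X\<^sup>2 * w \<le> C6\<^sup>2 * ((real k powr \<alpha>)\<^sup>2 * w)"
            using mult_right_mono[OF _ w0] by (simp add: mult.assoc[symmetric])
          then show "X\<^sup>2 * w \<le> M * ((real k powr \<alpha>)\<^sup>2 * w)"
            using w0 M by (intro leM[of _ "C6\<^sup>2"]) auto
          have "c6\<^sup>2 * (real k powr \<alpha>)\<^sup>2 \<le> X\<^sup>2"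
            using f c6 power_mono[of "c6 * real k powr \<alpha>" X 2] by (simp add: power_mult_distrib)
          then have "c6\<^sup>2 * ((real k powr \<alpha>)\<^sup>2 * w) \<le> X\<^sup>2 * w"
            using mult_right_mono[OF _ w0] by (simp add: mult.assoc[symmetric])
          then show "(real k powr \<alpha>)\<^sup>2 * w \<le> M * (X\<^sup>2 * w)"
            using w0 c6 M by (intro swapM[of "c6\<^sup>2"]) auto
        qed (use M(1) w0 in auto)
        have "\<not> ennreal ?n \<le> ennreal (real k)" using kn n0 by (simp add: ennreal_le_iff)
        moreover have "ennreal (?n powr (- ?d + \<alpha>)) * ennpowr (max 1 (ennreal ?n / ennreal (real k))) (- 2 * \<alpha>)
            = ennreal ((real k powr \<alpha>)\<^sup>2 * w)"
          unfolding gk g[symmetric] by (rule ennreal_mult[symmetric]) auto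
        ultimately show ?thesis using 1 2 F by (simp add: Let_def \<open>correlation_length K 1 = ennreal (real k)\<close> w_def)
      qed
    qed
  qed
qed

section \<open>The critical regime\<close>

text \<open>Only the product \<beta> * J enters the edge probabilities, so it suffices to study
  kernels at parameter 1.\<close>

lemma perc_scale: "perc J \<beta> = perc (\<lambda>x y. \<beta> * J x y) 1"
  unfolding perc_def edge_prob_def by simp

lemma two_point_scale: "two_point J \<beta> = two_point (\<lambda>x y. \<beta> * J x y) 1"
  unfolding two_point_def perc_scale[of J \<beta>] by simp

lemma susceptibility_scale: "susceptibility J \<beta> = susceptibility (\<lambda>x y. \<beta> * J x y) 1"
  unfolding susceptibility_def perc_scale[of J \<beta>] by simp

lemma correlation_length_scale: "correlation_length J \<beta> = correlation_length (\<lambda>x y. \<beta> * J x y) 1"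
  unfolding correlation_length_def two_point_scale[of J \<beta>] susceptibility_scale[of J \<beta>] by simp

lemma long_range_scale:
  assumes "long_range c C \<alpha> J" "0 \<le> \<beta>"
  shows "long_range (c * \<beta>) (C * \<beta>) \<alpha> (\<lambda>x y. \<beta> * J x y)"
proof -
  have "c * \<beta> * s \<le> \<beta> * t \<and> \<beta> * t \<le> C * \<beta> * s" if "c * s \<le> t \<and> t \<le> C * s" for s t
    using that assms(2) mult_left_mono[of "c * s" t \<beta>] mult_left_mono[of t "C * s" \<beta>] by (simp add: mult_ac)
  then show ?thesis using assms unfolding long_range_def by simp
qed

lemma continuous_on_pr:
  assumes J: "long_range c C \<alpha> J"
  shows "continuous_on {0..} (\<lambda>\<beta>. pr (\<lambda>x y. \<beta> * J x y) e)"
proof (cases "e \<in> edges")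
  case True
  then obtain x y where e: "e = {x, y}" "x \<noteq> y" by (auto simp: edges_def)
  have "continuous_on {0..} (\<lambda>\<beta>. 1 - exp (- (\<beta> * J x y)))" by (intro continuous_intros)
  then show ?thesis
    by (rule continuous_on_eq) (use e pr_pair[OF long_range_scale[OF J] e(2)] in auto)
qed (simp add: pr_def)

lemma continuous_on_tau:
  "long_range c C \<alpha> J \<Longrightarrow> continuous_on {0..} (\<lambda>\<beta>. tau (pr (\<lambda>x y. \<beta> * J x y)) V x y)"
  unfolding tau_def by (intro continuous_on_bex continuous_on_pr)

lemma continuous_on_ball_chi:
  "long_range c C \<alpha> J \<Longrightarrow> continuous_on {0..} (\<lambda>\<beta>. ball_chi (\<lambda>x y. \<beta> * J x y) m)"
  unfolding ball_chi_def by (intro continuous_on_sum continuous_on_tau)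

text \<open>The approach to \<beta> is from below, where the model does not percolate, and stays
  above \<beta> / 2, so that one lower bound on the kernel serves for all parameters used.\<close>

lemma le_at_left_endpoint:
  fixes f :: "real \<Rightarrow> real"
  assumes f: "continuous_on {0..} f" and \<beta>: "0 < \<beta>" and le: "\<And>t. \<beta> / 2 < t \<Longrightarrow> t < \<beta> \<Longrightarrow> f t \<le> u"
  shows "f \<beta> \<le> u"
proof (rule continuous_le_on_closure[where f = f and x = \<beta> and S = "{\<beta> / 2<..<\<beta>}"])
  have cl: "closure {\<beta> / 2<..<\<beta>} = {\<beta> / 2..\<beta>}" using \<beta> by (intro closure_greaterThanLessThan) simp
  show "continuous_on (closure {\<beta> / 2<..<\<beta>}) f"
    unfolding cl using \<beta> by (intro continuous_on_subset[OF f]) auto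
  show "\<beta> \<in> closure {\<beta> / 2<..<\<beta>}" unfolding cl using \<beta> by simp
qed (use le in auto)

lemma subcritical_not_percolates:
  fixes J :: "int ^ 'n \<Rightarrow> int ^ 'n \<Rightarrow> real"
  assumes J: "long_range c C \<alpha> J" and \<beta>: "0 \<le> \<beta>" "ereal \<beta> < beta_c J"
  shows "\<not> percolates (\<lambda>x y. \<beta> * J x y)"
proof
  assume "percolates (\<lambda>x y. \<beta> * J x y)"
  then have "0 < measure (perc J \<beta>) {\<omega> \<in> space (perc J \<beta>). \<exists>x. infinite (cluster \<omega> x)}"
    unfolding perc_scale[of J \<beta>] by (rule percolates_infinite_cluster[OF long_range_scale[OF J \<beta>(1)]])
  then have "beta_c J \<le> ereal \<beta>" unfolding beta_c_def using \<beta>(1) by (intro Inf_lower) auto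
  then show False using \<beta>(2) by simp
qed

text \<open>With expected degree at most 1 / 2 the finite-volume susceptibilities are bounded by 2,
  which excludes infinite clusters. This keeps the critical parameter away from 0, uniformly in the
  kernel.\<close>

lemma beta_c_ge:
  fixes J :: "int ^ 'n \<Rightarrow> int ^ 'n \<Rightarrow> real"
  assumes J: "long_range c C \<alpha> J" and \<alpha>: "0 < \<alpha>" and small: "C * \<beta>1 * (shell_const TYPE('n) * (1 + 1 / \<alpha>)) \<le> 1 / 2"
  shows "ereal \<beta>1 \<le> beta_c J"
  unfolding beta_c_def
proof (intro Inf_greatest, safe)
  fix \<beta> assume \<beta>: "0 \<le> \<beta>"
    and pos: "0 < measure (perc J \<beta>) {\<omega> \<in> space (perc J \<beta>). \<exists>x. infinite (cluster \<omega> x)}"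
  show "ereal \<beta>1 \<le> ereal \<beta>"
  proof (rule ccontr)
    assume "\<not> ?thesis"
    then have lt: "\<beta> \<le> \<beta>1" by simp
    have "0 \<le> C * (shell_const TYPE('n) * (1 + 1 / \<alpha>))"
      using J \<alpha> shell_const_pos[where 'n = 'n] by (intro mult_nonneg_nonneg) (auto simp: long_range_def)
    then have "C * (shell_const TYPE('n) * (1 + 1 / \<alpha>)) * \<beta> \<le> C * (shell_const TYPE('n) * (1 + 1 / \<alpha>)) * \<beta>1"
      by (intro mult_left_mono lt)
    then have "C * \<beta> * (shell_const TYPE('n) * (1 + 1 / \<alpha>)) \<le> 1 / 2"
      using small by (simp only: mult_ac)
    then have "vol_chi (\<lambda>x y. \<beta> * J x y) V x \<le> 2" if "finite V" "x \<in> V" for V x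
      using that by (intro vol_chi_small[OF long_range_scale[OF J \<beta>] \<alpha>])
    then have "measure (perc J \<beta>) {\<omega> \<in> space (perc J \<beta>). \<exists>x. infinite (cluster \<omega> x)} = 0"
      unfolding perc_scale[of J \<beta>] by (intro vol_chi_bounded_no_infinite_cluster[OF long_range_scale[OF J \<beta>]])
    then show False using pos by simp
  qed
qed

text \<open>Up to \<open>\<beta>\<^sub>c\<close> included, all finite-volume bounds hold with uniform constants: below \<open>\<beta>\<^sub>c\<close> because the
  model does not percolate, and at \<open>\<beta>\<^sub>c\<close> by continuity in \<open>\<beta>\<close> of finite-volume probabilities. For small
  \<open>\<beta>\<close>, where the lower bound on the kernel degenerates, the susceptibility is at most 2.\<close>

theorem uniform_bounds:
  assumes \<alpha>: "0 < \<alpha>" "\<alpha> < real CARD('n::finite)" and c: "0 < c" and C: "0 < C"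
  obtains b A \<kappa> where "0 < b" "0 < A" "0 < \<kappa>"
    "\<And>(J :: int ^ 'n \<Rightarrow> int ^ 'n \<Rightarrow> real) \<beta>. long_range c C \<alpha> J \<Longrightarrow> 0 \<le> \<beta> \<Longrightarrow> ereal \<beta> \<le> beta_c J \<Longrightarrow>
      long_range 0 b \<alpha> (\<lambda>x y. \<beta> * J x y)"
    "\<And>(J :: int ^ 'n \<Rightarrow> int ^ 'n \<Rightarrow> real) \<beta> m. long_range c C \<alpha> J \<Longrightarrow> 0 \<le> \<beta> \<Longrightarrow> ereal \<beta> \<le> beta_c J \<Longrightarrow> 1 \<le> m \<Longrightarrow>
      ball_chi (\<lambda>x y. \<beta> * J x y) m \<le> A * real m powr \<alpha>"
    "\<And>(J :: int ^ 'n \<Rightarrow> int ^ 'n \<Rightarrow> real) \<beta> x r. long_range c C \<alpha> J \<Longrightarrow> beta_c J / 2 \<le> ereal \<beta> \<Longrightarrow>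
      ereal \<beta> \<le> beta_c J \<Longrightarrow> 2 * r < nm x \<Longrightarrow>
      \<kappa> * real (nm x) powr (- real CARD('n) - \<alpha>) * (ball_chi (\<lambda>x y. \<beta> * J x y) r)\<^sup>2
        \<le> tau (pr (\<lambda>x y. \<beta> * J x y)) (nball 0 (2 * nm x)) 0 x"
    "\<And>(J :: int ^ 'n \<Rightarrow> int ^ 'n \<Rightarrow> real) \<beta>. long_range c C \<alpha> J \<Longrightarrow> beta_c J / 2 \<le> ereal \<beta> \<Longrightarrow> 0 \<le> \<beta>"
proof -
  let ?d = "real CARD('n)"
  obtain E where E: "0 < E" "\<And>a b (K :: int ^ 'n \<Rightarrow> int ^ 'n \<Rightarrow> real). long_range a b \<alpha> K \<Longrightarrow> E \<le> a \<Longrightarrow> percolates K"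
    using strong_kernel_percolates[OF \<alpha>] by blast
  define s1 where "s1 = shell_const TYPE('n) * (1 + 1 / \<alpha>)"
  have s1: "0 < s1" using shell_const_pos[where 'n = 'n] \<alpha> by (simp add: s1_def add_pos_pos)
  define \<beta>1 where "\<beta>1 = 1 / (2 * C * s1)"
  have \<beta>1: "0 < \<beta>1" "C * \<beta>1 * s1 = 1 / 2" using C s1 by (auto simp: \<beta>1_def)
  \<comment> \<open>At this parameter the kernel has lower constant \<open>E\<close> and percolates,
    so it bounds \<open>beta_c J\<close> from above.\<close>
  define \<beta>2 where "\<beta>2 = E / c"
  have \<beta>2: "0 < \<beta>2" using E c by (simp add: \<beta>2_def)
  have lo: "ereal \<beta>1 \<le> beta_c J" if "long_range c C \<alpha> J" for J :: "int ^ 'n \<Rightarrow> int ^ 'n \<Rightarrow> real"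
    using beta_c_ge[OF that \<alpha>(1), of \<beta>1] \<beta>1(2) by (simp add: s1_def)
  have hi: "beta_c J \<le> ereal \<beta>2" if J: "long_range c C \<alpha> J" for J :: "int ^ 'n \<Rightarrow> int ^ 'n \<Rightarrow> real"
  proof (rule ccontr)
    assume "\<not> ?thesis"
    then have "\<not> percolates (\<lambda>x y. \<beta>2 * J x y)"
      using \<beta>2 by (intro subcritical_not_percolates[OF J]) auto
    moreover have "E \<le> c * \<beta>2" using c by (simp add: \<beta>2_def)
    ultimately show False using E(2)[OF long_range_scale[OF J]] \<beta>2 by simp
  qed
  \<comment> \<open>A lower constant for the kernel at all parameters t > \<beta> / 2 with \<beta>
    \<ge> \<beta>1 / 2: one halving comes from the range of \<beta> below the critical value, the
    other from the approach by continuity.\<close>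
  define a where "a = c * (\<beta>1 / 4)"
  have a: "0 < a" using c \<beta>1 by (simp add: a_def)
  obtain A0 where A0: "0 < A0" "\<And>b (K :: int ^ 'n \<Rightarrow> int ^ 'n \<Rightarrow> real) m. long_range a b \<alpha> K \<Longrightarrow>
    \<not> percolates K \<Longrightarrow> 1 \<le> m \<Longrightarrow> ball_chi K m \<le> A0 * real m powr \<alpha>"
    using ball_chi_upper[OF \<alpha> a] by blast
  obtain \<kappa> where \<kappa>: "0 < \<kappa>" "\<And>b (K :: int ^ 'n \<Rightarrow> int ^ 'n \<Rightarrow> real) x r. long_range a b \<alpha> K \<Longrightarrow> \<not> percolates K \<Longrightarrow>
    2 * r < nm x \<Longrightarrow>
    \<kappa> * real (nm x) powr (- ?d - \<alpha>) * (ball_chi K r)\<^sup>2 \<le> tau (pr K) (nball 0 (2 * nm x)) 0 x"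
    using pointwise_lower[OF \<alpha> a] by blast
  have lrt: "long_range a (C * t) \<alpha> (\<lambda>x y. t * J x y)" if "long_range c C \<alpha> J" "\<beta>1 / 4 \<le> t"
    for J :: "int ^ 'n \<Rightarrow> int ^ 'n \<Rightarrow> real" and t
    using that a c \<beta>1 by (intro long_range_weaken[OF long_range_scale[OF that(1)]]) (auto simp: a_def)
  have below: "long_range a (C * t) \<alpha> (\<lambda>x y. t * J x y) \<and> \<not> percolates (\<lambda>x y. t * J x y)"
    if J: "long_range c C \<alpha> J" and \<beta>: "\<beta>1 / 2 \<le> \<beta>" "ereal \<beta> \<le> beta_c J" and t: "\<beta> / 2 < t" "t < \<beta>"
    for J :: "int ^ 'n \<Rightarrow> int ^ 'n \<Rightarrow> real" and \<beta> t
  proof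
    show "long_range a (C * t) \<alpha> (\<lambda>x y. t * J x y)" using \<beta> t by (intro lrt[OF J]) simp
    have "ereal t < ereal \<beta>" using t by simp
    also have "\<dots> \<le> beta_c J" by (rule \<beta>(2))
    finally show "\<not> percolates (\<lambda>x y. t * J x y)"
      using \<beta> t \<beta>1 by (intro subcritical_not_percolates[OF J]) auto
  qed
  have half: "\<beta>1 / 2 \<le> \<beta>" if J: "long_range c C \<alpha> J" and \<beta>: "beta_c J / 2 \<le> ereal \<beta>"
    for J :: "int ^ 'n \<Rightarrow> int ^ 'n \<Rightarrow> real" and \<beta>
  proof -
    have "ereal (\<beta>1 / 2) = ereal \<beta>1 / 2" by simp
    also have "\<dots> \<le> beta_c J / 2" by (intro ereal_divide_right_mono lo J) simp
    also have "\<dots> \<le> ereal \<beta>" by (rule \<beta>)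
    finally show ?thesis by simp
  qed
  show ?thesis
  proof (rule that[of "C * \<beta>2" "max A0 2" \<kappa>])
    show "0 < C * \<beta>2" "0 < max A0 2" "0 < \<kappa>" using C \<beta>2 \<kappa> by auto
  next
    fix J :: "int ^ 'n \<Rightarrow> int ^ 'n \<Rightarrow> real" and \<beta>
    assume J: "long_range c C \<alpha> J" and \<beta>: "0 \<le> \<beta>" "ereal \<beta> \<le> beta_c J"
    have "\<beta> \<le> \<beta>2" using order_trans[OF \<beta>(2) hi[OF J]] by simp
    then show "long_range 0 (C * \<beta>2) \<alpha> (\<lambda>x y. \<beta> * J x y)"
      using C c \<beta> by (intro long_range_weaken[OF long_range_scale[OF J \<beta>(1)]]) (auto intro: mult_left_mono)
  next
    fix J :: "int ^ 'n \<Rightarrow> int ^ 'n \<Rightarrow> real" and \<beta> and m :: nat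
    assume J: "long_range c C \<alpha> J" and \<beta>: "0 \<le> \<beta>" "ereal \<beta> \<le> beta_c J" and m: "1 \<le> m"
    have m1: "1 \<le> real m powr \<alpha>" using m \<alpha> by (intro ge_one_powr_ge_zero) auto
    show "ball_chi (\<lambda>x y. \<beta> * J x y) m \<le> max A0 2 * real m powr \<alpha>"
    proof (cases "\<beta> \<le> \<beta>1")
      case True
      have "C * \<beta> * s1 \<le> C * \<beta>1 * s1" using True C s1 by (intro mult_right_mono mult_left_mono) auto
      then have "C * \<beta> * (shell_const TYPE('n) * (1 + 1 / \<alpha>)) \<le> 1 / 2" using \<beta>1(2) unfolding s1_def by linarith
      then have "vol_chi (\<lambda>x y. \<beta> * J x y) (nball 0 m) 0 \<le> 2"
        by (intro vol_chi_small[OF long_range_scale[OF J \<beta>(1)] \<alpha>(1)] finite_nball) (simp_all add: mem_nball)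
      then have "ball_chi (\<lambda>x y. \<beta> * J x y) m \<le> 2 * 1" by (simp add: vol_chi_def ball_chi_def)
      also have "\<dots> \<le> max A0 2 * real m powr \<alpha>" using m1 by (intro mult_mono) auto
      finally show ?thesis .
    next
      case False
      have "ball_chi (\<lambda>x y. \<beta> * J x y) m \<le> A0 * real m powr \<alpha>"
      proof (rule le_at_left_endpoint[where f = "\<lambda>t. ball_chi (\<lambda>x y. t * J x y) m"])
        fix t assume "\<beta> / 2 < t" "t < \<beta>"
        then show "ball_chi (\<lambda>x y. t * J x y) m \<le> A0 * real m powr \<alpha>"
          using below[OF J _ \<beta>(2)] False \<beta>1 m by (intro A0(2)) auto
      qed (use False \<beta>1 continuous_on_ball_chi[OF J] in auto)
      also have "\<dots> \<le> max A0 2 * real m powr \<alpha>" by (intro mult_right_mono) auto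
      finally show ?thesis .
    qed
  next
    fix J :: "int ^ 'n \<Rightarrow> int ^ 'n \<Rightarrow> real" and \<beta> and x :: "int ^ 'n" and r :: nat
    assume J: "long_range c C \<alpha> J" and \<beta>: "beta_c J / 2 \<le> ereal \<beta>" "ereal \<beta> \<le> beta_c J" and r: "2 * r < nm x"
    \<comment> \<open>Both sides vary with the parameter, so continuity is applied to their
      difference.\<close>
    let ?f = "\<lambda>t. \<kappa> * real (nm x) powr (- ?d - \<alpha>) * (ball_chi (\<lambda>x y. t * J x y) r)\<^sup>2
        - tau (pr (\<lambda>x y. t * J x y)) (nball 0 (2 * nm x)) 0 x"
    have h: "\<beta>1 / 2 \<le> \<beta>" by (rule half[OF J \<beta>(1)])
    have "?f \<beta> \<le> 0"
    proof (rule le_at_left_endpoint[where f = ?f])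
      show "continuous_on {0..} ?f" by (intro continuous_intros continuous_on_ball_chi[OF J] continuous_on_tau[OF J])
      fix t assume t: "\<beta> / 2 < t" "t < \<beta>"
      show "?f t \<le> 0" using \<kappa>(2)[OF _ _ r] below[OF J h \<beta>(2) t] by fastforce
    qed (use h \<beta>1 in auto)
    then show "\<kappa> * real (nm x) powr (- ?d - \<alpha>) * (ball_chi (\<lambda>x y. \<beta> * J x y) r)\<^sup>2
        \<le> tau (pr (\<lambda>x y. \<beta> * J x y)) (nball 0 (2 * nm x)) 0 x" by simp
  next
    fix J :: "int ^ 'n \<Rightarrow> int ^ 'n \<Rightarrow> real" and \<beta>
    assume "long_range c C \<alpha> J" "beta_c J / 2 \<le> ereal \<beta>"
    from half[OF this] show "0 \<le> \<beta>" using \<beta>1 by linarith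
  qed
qed

theorem theorem1p5:
  fixes \<alpha> c C :: real
  assumes "0 < \<alpha>" and "\<alpha> < real CARD('n::finite)" and "0 < c" and "\<alpha> < 1"
  shows "\<exists>A>0. \<forall>J :: int ^ 'n \<Rightarrow> int ^ 'n \<Rightarrow> real.
    (\<forall>x y. 0 \<le> J x y) \<and> (\<forall>x y. J x y = J y x) \<and>
    (\<forall>x y. J x y = J 0 (y - x)) \<and> (\<lambda>x. J 0 x) summable_on UNIV \<and>
    (\<forall>x y. x \<noteq> y \<longrightarrow>
       c * linf_norm (x - y) powr (- real CARD('n) - \<alpha>) \<le> J x y \<and>
       J x y \<le> C * linf_norm (x - y) powr (- real CARD('n) - \<alpha>))
    \<longrightarrow>
    (\<forall>\<beta>. 0 \<le> \<beta> \<and> ereal \<beta> \<le> beta_c J \<longrightarrow>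
       comparable A (susceptibility J \<beta>) (ennpowr (correlation_length J \<beta>) \<alpha>)) \<and>
    (\<forall>\<beta> x. beta_c J / 2 \<le> ereal \<beta> \<and> ereal \<beta> \<le> beta_c J \<and> x \<noteq> 0 \<longrightarrow>
       (let n = linf_norm x;
            \<xi> = correlation_length J \<beta>;
            P = ennreal (two_point J \<beta> 0 x);
            F = (if ennreal n \<le> \<xi> then ennreal (n powr (- real CARD('n) + \<alpha>))
                 else susceptibility J \<beta> ^ 2 * ennreal (n powr (- real CARD('n) - \<alpha>)));
            G = ennreal (n powr (- real CARD('n) + \<alpha>)) *
                ennpowr (max 1 (ennreal n / \<xi>)) (- 2 * \<alpha>)
        in comparable A P F \<and> comparable A F G))"
proof -
  \<comment> \<open>\<open>C\<close> is an arbitrary real, whereas the uniform bounds ask for a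
    positive constant.\<close>
  define C' where "C' = max C 1"
  have C': "0 < C'" "C \<le> C'" by (auto simp: C'_def)
  obtain b A \<kappa> where pos: "0 < b" "0 < A" "0 < \<kappa>"
    and kernel: "\<And>(J :: int ^ 'n \<Rightarrow> int ^ 'n \<Rightarrow> real) \<beta>. long_range c C' \<alpha> J \<Longrightarrow> 0 \<le> \<beta> \<Longrightarrow> ereal \<beta> \<le> beta_c J \<Longrightarrow>
      long_range 0 b \<alpha> (\<lambda>x y. \<beta> * J x y)"
    and upper: "\<And>(J :: int ^ 'n \<Rightarrow> int ^ 'n \<Rightarrow> real) \<beta> m. long_range c C' \<alpha> J \<Longrightarrow> 0 \<le> \<beta> \<Longrightarrow> ereal \<beta> \<le> beta_c J \<Longrightarrow> 1 \<le> m \<Longrightarrow>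
      ball_chi (\<lambda>x y. \<beta> * J x y) m \<le> A * real m powr \<alpha>"
    and lower: "\<And>(J :: int ^ 'n \<Rightarrow> int ^ 'n \<Rightarrow> real) \<beta> x r. long_range c C' \<alpha> J \<Longrightarrow> beta_c J / 2 \<le> ereal \<beta> \<Longrightarrow>
      ereal \<beta> \<le> beta_c J \<Longrightarrow> 2 * r < nm x \<Longrightarrow>
      \<kappa> * real (nm x) powr (- real CARD('n) - \<alpha>) * (ball_chi (\<lambda>x y. \<beta> * J x y) r)\<^sup>2
        \<le> tau (pr (\<lambda>x y. \<beta> * J x y)) (nball 0 (2 * nm x)) 0 x"
    and nonneg: "\<And>(J :: int ^ 'n \<Rightarrow> int ^ 'n \<Rightarrow> real) \<beta>. long_range c C' \<alpha> J \<Longrightarrow> beta_c J / 2 \<le> ereal \<beta> \<Longrightarrow> 0 \<le> \<beta>"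
    by (rule uniform_bounds[OF assms(1-3) C'(1)]) (rule that)
  show ?thesis
  proof (rule two_point_estimates[OF assms(1) assms(4) assms(2) pos])
    fix M assume M: "1 \<le> M"
    and chi: "\<And>K :: int ^ 'n \<Rightarrow> int ^ 'n \<Rightarrow> real. long_range 0 b \<alpha> K \<Longrightarrow> (\<And>m. 1 \<le> m \<Longrightarrow> ball_chi K m \<le> A * real m powr \<alpha>) \<Longrightarrow>
      comparable M (susceptibility K 1) (ennpowr (correlation_length K 1) \<alpha>)"
    and tp: "\<And>(K :: int ^ 'n \<Rightarrow> int ^ 'n \<Rightarrow> real) x. long_range 0 b \<alpha> K \<Longrightarrow> (\<And>m. 1 \<le> m \<Longrightarrow> ball_chi K m \<le> A * real m powr \<alpha>) \<Longrightarrow>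
      (\<And>x r. 2 * r < nm x \<Longrightarrow>
        \<kappa> * real (nm x) powr (- real CARD('n) - \<alpha>) * (ball_chi K r)\<^sup>2 \<le> tau (pr K) (nball 0 (2 * nm x)) 0 x) \<Longrightarrow>
      x \<noteq> 0 \<Longrightarrow>
      (let n = real (nm x);
           \<xi> = correlation_length K 1;
           P = ennreal (two_point K 1 0 x);
           F = (if ennreal n \<le> \<xi> then ennreal (n powr (- real CARD('n) + \<alpha>))
                else susceptibility K 1 ^ 2 * ennreal (n powr (- real CARD('n) - \<alpha>)));
           G = ennreal (n powr (- real CARD('n) + \<alpha>)) * ennpowr (max 1 (ennreal n / \<xi>)) (- 2 * \<alpha>)
       in comparable M P F \<and> comparable M F G)"
  show ?thesis
  proof (intro exI[of _ M] conjI allI impI)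
    show "0 < M" using M by simp
    fix J :: "int ^ 'n \<Rightarrow> int ^ 'n \<Rightarrow> real"
    assume *: "(\<forall>x y. 0 \<le> J x y) \<and> (\<forall>x y. J x y = J y x) \<and>
      (\<forall>x y. J x y = J 0 (y - x)) \<and> (\<lambda>x. J 0 x) summable_on UNIV \<and>
      (\<forall>x y. x \<noteq> y \<longrightarrow>
         c * linf_norm (x - y) powr (- real CARD('n) - \<alpha>) \<le> J x y \<and>
         J x y \<le> C * linf_norm (x - y) powr (- real CARD('n) - \<alpha>))"
    have J: "long_range c C' \<alpha> J"
      unfolding long_range_def
    proof (intro conjI allI impI)
      fix x y z :: "int ^ 'n"
      show "0 \<le> J x y" "J x y = J y x" using * by auto
      have "J (x + z) (y + z) = J 0 ((y + z) - (x + z))" "J x y = J 0 (y - x)" using * by blast+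
      then show "J (x + z) (y + z) = J x y" by simp
      assume xy: "x \<noteq> y"
      have nm: "linf_norm (x - y) = real (nm (y - x))" by (simp add: linf_norm_eq_nm nm_commute)
      have 1: "c * real (nm (y - x)) powr (- real CARD('n) - \<alpha>) \<le> J x y"
        "J x y \<le> C * real (nm (y - x)) powr (- real CARD('n) - \<alpha>)"
        using * xy unfolding nm[symmetric] by blast+
      then show "c * real (nm (y - x)) powr (- real CARD('n) - \<alpha>) \<le> J x y" by simp
      have "C * real (nm (y - x)) powr (- real CARD('n) - \<alpha>) \<le> C' * real (nm (y - x)) powr (- real CARD('n) - \<alpha>)"
        using C' by (intro mult_right_mono) auto
      then show "J x y \<le> C' * real (nm (y - x)) powr (- real CARD('n) - \<alpha>)" using 1(2) by linarith
    qed (use assms C' in auto)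
    {
      fix \<beta> assume "0 \<le> \<beta> \<and> ereal \<beta> \<le> beta_c J"
      then show "comparable M (susceptibility J \<beta>) (ennpowr (correlation_length J \<beta>) \<alpha>)"
        unfolding susceptibility_scale[of J \<beta>] correlation_length_scale[of J \<beta>]
        by (intro chi kernel[OF J] upper[OF J]) auto
    next
      fix \<beta> and x :: "int ^ 'n"
      assume \<beta>: "beta_c J / 2 \<le> ereal \<beta> \<and> ereal \<beta> \<le> beta_c J \<and> x \<noteq> 0"
      \<comment> \<open>The pointwise range gives \<beta> only as at least half of
        \<open>beta_c J\<close>, which is bounded below by a positive constant.\<close>
      then have "0 \<le> \<beta>" using nonneg[OF J] by blast
      with \<beta> show "let n = linf_norm x;
            \<xi> = correlation_length J \<beta>;
            P = ennreal (two_point J \<beta> 0 x);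
            F = (if ennreal n \<le> \<xi> then ennreal (n powr (- real CARD('n) + \<alpha>))
                 else susceptibility J \<beta> ^ 2 * ennreal (n powr (- real CARD('n) - \<alpha>)));
            G = ennreal (n powr (- real CARD('n) + \<alpha>)) *
                ennpowr (max 1 (ennreal n / \<xi>)) (- 2 * \<alpha>)
        in comparable M P F \<and> comparable M F G"
        unfolding susceptibility_scale[of J \<beta>] correlation_length_scale[of J \<beta>] two_point_scale[of J \<beta>]
          linf_norm_eq_nm
        by (intro tp kernel[OF J] upper[OF J] lower[OF J]) auto
    }
  qed
  qed
qed

end
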